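(* Let $n>1$ and $1\le k\le n-1$ be integers. Let $\Omega(n,k)=\{x\in\{0,1\}^n : x_1+\cdots+x_n=k\}$, let $Q_{\rm BL}(x,y)=\frac{1}{k(n-k)}$ if $\|x-y\|_{\ell^1}=2$ and $Q_{\rm BL}(x,y)=0$ otherwise, and let $\pi_{\rm BL}(x)=\binom{n}{k}^{-1}$ for all $x\in\Omega(n,k)$. Then the Ricci curvature of the Bernoulli--Laplace model $(\Omega(n,k),Q_{\rm BL},\pi_{\rm BL})$ is bounded from below by $\frac{n+2}{2k(n-k)}$, i.e. $$\mathrm{Ric}(\Omega(n,k),Q_{\rm BL},\pi_{\rm BL})\ \ge\ \frac{n+2}{2k(n-k)}.$$
   Context: A Markov triple $(\mathcal X,Q,\pi)$ consists of a finite set $\mathcal X$, transition rates $Q(x,y)\ge 0$ for $x\ne y$ with $Q(x,x)=0$, and a probability measure $\pi$ on $\mathcal X$ with $\pi(x)Q(x,y)=\pi(y)Q(y,x)$ for all $x,y$. Probability densities: $\mathscr P(\mathcal X)=\{\rho:\mathcal X\to[0,\infty) : \sum_{x}\pi(x)\rho(x)=1\}$. Relative entropy: $\mathcal H(\rho)=\sum_{x}\pi(x)\rho(x)\log\rho(x)$ (with $0\log 0=0$). Logarithmic mean: $\theta(r,s)=\int_0^1 r^{1-p}s^p\,dp$ for $r,s\ge 0$. For $\rho\in\mathscr P(\mathcal X)$ write $\hat\rho(x,y)=\theta(\rho(x),\rho(y))$. Transport metric $\mathcal W$ on $\mathscr P(\mathcal X)$: for $\rho_0,\rho_1\in\mathscr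 P(\mathcal X)$, $$\mathcal W(\rho_0,\rho_1)^2=\inf_{\rho,\psi}\Big\{\tfrac12\int_0^1\sum_{x,y\in\mathcal X}(\psi_t(x)-\psi_t(y))^2\hat\rho_t(x,y)Q(x,y)\pi(x)\,dt\Big\},$$ where the infimum runs over all piecewise smooth curves $\rho:[0,1]\to\mathscr P(\mathcal X)$ and all $\psi:[0,1]\times\mathcal X\to\mathbb R$ satisfying $\frac{d}{dt}\rho_t(x)+\sum_{y\in\mathcal X}(\psi_t(y)-\psi_t(x))\hat\rho_t(x,y)Q(x,y)=0$ for all $x\in\mathcal X$, with $\rho(0)=\rho_0$ and $\rho(1)=\rho_1$. A constant speed geodesic is a curve $\rho:[0,1]\to\mathscr P(\mathcal X)$ with $\mathcal W(\rho_s,\rho_t)=|t-s|\,\mathcal W(\rho_0,\rho_1)$ for all $s,t\in[0,1]$. Ricci curvature: for $\kappa\in\mathbb R$, $(\mathcal X,Q,\pi)$ has Ricci curvature bounded from below by $\kappa$, written $\mathrm{Ric}(\mathcal X,Q,\pi)\ge\kappa$, if for every constant speed geodesic $(\rho_t)_{t\in[0,1]}$ in $(\mathscr P(\mathcal X),\mathcal W)$ and every $t\in[0,1]$, $$\mathcal H(\rho_t)\le(1-t)\mathcal H(\rho_0)+t\,\mathcal H(\rho_1)-\frac{\kappa}{2}t(1-t)\mathcal W(\rho_0,\rho_1)^2.$$ *)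

theory Defs
  imports "HOL-Analysis.Analysis"
begin

section \<open>Markov triples\<close>

text \<open>The state space is a finite carrier set \<open>X\<close>.  Everything below depends on functions on the
  state space only through their values on \<open>X\<close>.\<close>

locale markov_triple =
  fixes X :: "'a set" and Q :: "'a \<Rightarrow> 'a \<Rightarrow> real" and \<pi> :: "'a \<Rightarrow> real"
  assumes finite_space: "finite X"
    and rate_nonneg: "x \<in> X \<Longrightarrow> y \<in> X \<Longrightarrow> x \<noteq> y \<Longrightarrow> 0 \<le> Q x y"
    and rate_diag: "x \<in> X \<Longrightarrow> Q x x = 0"
    and prob_nonneg: "x \<in> X \<Longrightarrow> 0 \<le> \<pi> x"
    and prob_sum: "(\<Sum>x\<in>X. \<pi> x) = 1"
    and detailed_balance: "x \<in> X \<Longrightarrow> y \<in> X \<Longrightarrow> \<pi> x * Q x y = \<pi> y * Q y x"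

definition densities :: "'a set \<Rightarrow> ('a \<Rightarrow> real) \<Rightarrow> ('a \<Rightarrow> real) set" where
  "densities X \<pi> = {\<rho>. (\<forall>x\<in>X. 0 \<le> \<rho> x) \<and> (\<Sum>x\<in>X. \<pi> x * \<rho> x) = 1}"

text \<open>Since \<open>ln 0 = 0\<close> in HOL, the convention \<open>0 log 0 = 0\<close> is built in.\<close>

definition entropy :: "'a set \<Rightarrow> ('a \<Rightarrow> real) \<Rightarrow> ('a \<Rightarrow> real) \<Rightarrow> real" where
  "entropy X \<pi> \<rho> = (\<Sum>x\<in>X. \<pi> x * \<rho> x * ln (\<rho> x))"

text \<open>Note that \<open>0 powr 0 = 0\<close>; this affects the integrand only at the end points.\<close>

definition log_mean :: "real \<Rightarrow> real \<Rightarrow> real" where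
  "log_mean r s = integral {0..1} (\<lambda>p. r powr (1 - p) * s powr p)"

section \<open>The transport metric\<close>

text \<open>One-sided derivatives are used at the end points: \<open>g k\<close> is the \<open>k\<close>-th derivative.\<close>

definition smooth_on_interval :: "(real \<Rightarrow> real) \<Rightarrow> real \<Rightarrow> real \<Rightarrow> bool" where
  "smooth_on_interval f a b \<longleftrightarrow>
     (\<exists>g :: nat \<Rightarrow> real \<Rightarrow> real. (\<forall>t\<in>{a..b}. g 0 t = f t) \<and>
        (\<forall>k. \<forall>t\<in>{a..b}. (g k has_real_derivative g (Suc k) t) (at t within {a..b})))"

text \<open>Smooth on each closed interval between consecutive points of \<open>B\<close>; as neighbouring intervals
  share their end points, such a function is continuous on \<open>{0..1}\<close>.\<close>

definition piecewise_smooth_along :: "real set \<Rightarrow> (real \<Rightarrow> real) \<Rightarrow> bool" where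
  "piecewise_smooth_along B f \<longleftrightarrow>
     finite B \<and> {0, 1} \<subseteq> B \<and> B \<subseteq> {0..1} \<and>
     (\<forall>a\<in>B. \<forall>b\<in>B. a < b \<and> B \<inter> {a<..<b} = {} \<longrightarrow> smooth_on_interval f a b)"

text \<open>The continuity equation is required at every time outside a finite set of break points of
  the piecewise smooth curve \<open>\<rho>\<close>.\<close>

definition solves_continuity_eq ::
  "'a set \<Rightarrow> ('a \<Rightarrow> 'a \<Rightarrow> real) \<Rightarrow> (real \<Rightarrow> 'a \<Rightarrow> real) \<Rightarrow> (real \<Rightarrow> 'a \<Rightarrow> real) \<Rightarrow> bool" where
  "solves_continuity_eq X Q \<rho> \<psi> \<longleftrightarrow>
     (\<exists>B. (\<forall>x\<in>X. piecewise_smooth_along B (\<lambda>t. \<rho> t x)) \<and>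
        (\<forall>t\<in>{0..1} - B. \<forall>x\<in>X. \<exists>D. ((\<lambda>s. \<rho> s x) has_real_derivative D) (at t) \<and>
           D + (\<Sum>y\<in>X. (\<psi> t y - \<psi> t x) * log_mean (\<rho> t x) (\<rho> t y) * Q x y) = 0))"

definition action ::
  "'a set \<Rightarrow> ('a \<Rightarrow> 'a \<Rightarrow> real) \<Rightarrow> ('a \<Rightarrow> real) \<Rightarrow>
   (real \<Rightarrow> 'a \<Rightarrow> real) \<Rightarrow> (real \<Rightarrow> 'a \<Rightarrow> real) \<Rightarrow> ennreal" where
  "action X Q \<pi> \<rho> \<psi> = ennreal (1 / 2) *
     (\<integral>\<^sup>+t\<in>{0..1}. ennreal (\<Sum>x\<in>X. \<Sum>y\<in>X.
        (\<psi> t x - \<psi> t y)\<^sup>2 * log_mean (\<rho> t x) (\<rho> t y) * Q x y * \<pi> x) \<partial>lborel)"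

definition transport_sq ::
  "'a set \<Rightarrow> ('a \<Rightarrow> 'a \<Rightarrow> real) \<Rightarrow> ('a \<Rightarrow> real) \<Rightarrow> ('a \<Rightarrow> real) \<Rightarrow> ('a \<Rightarrow> real) \<Rightarrow> ennreal" where
  "transport_sq X Q \<pi> \<rho>0 \<rho>1 =
     Inf {action X Q \<pi> \<rho> \<psi> | \<rho> \<psi>.
        (\<forall>t\<in>{0..1}. \<rho> t \<in> densities X \<pi>) \<and> solves_continuity_eq X Q \<rho> \<psi> \<and>
        (\<forall>x\<in>X. \<rho> 0 x = \<rho>0 x) \<and> (\<forall>x\<in>X. \<rho> 1 x = \<rho>1 x)}"

text \<open>The infimum is taken in \<open>[0, \<infinity>]\<close>, so the distance is \<open>\<infinity>\<close> if no admissible curve of finite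
  action exists (this can occur only for reducible chains).\<close>

definition transport_dist ::
  "'a set \<Rightarrow> ('a \<Rightarrow> 'a \<Rightarrow> real) \<Rightarrow> ('a \<Rightarrow> real) \<Rightarrow> ('a \<Rightarrow> real) \<Rightarrow> ('a \<Rightarrow> real) \<Rightarrow> ennreal" where
  "transport_dist X Q \<pi> \<rho>0 \<rho>1 =
     (if transport_sq X Q \<pi> \<rho>0 \<rho>1 = \<infinity> then \<infinity>
      else ennreal (sqrt (enn2real (transport_sq X Q \<pi> \<rho>0 \<rho>1))))"

lemma transport_dist_squared:
  "(transport_dist X Q \<pi> \<rho>0 \<rho>1)\<^sup>2 = transport_sq X Q \<pi> \<rho>0 \<rho>1"
  unfolding transport_dist_def
  by (cases "transport_sq X Q \<pi> \<rho>0 \<rho>1")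
     (auto simp: power2_eq_square ennreal_mult[symmetric] ennreal_top_mult)

section \<open>Geodesics and Ricci curvature\<close>

definition constant_speed_geodesic ::
  "'a set \<Rightarrow> ('a \<Rightarrow> 'a \<Rightarrow> real) \<Rightarrow> ('a \<Rightarrow> real) \<Rightarrow> (real \<Rightarrow> 'a \<Rightarrow> real) \<Rightarrow> bool" where
  "constant_speed_geodesic X Q \<pi> \<rho> \<longleftrightarrow>
     (\<forall>t\<in>{0..1}. \<rho> t \<in> densities X \<pi>) \<and>
     (\<forall>s\<in>{0..1}. \<forall>t\<in>{0..1}.
        transport_dist X Q \<pi> (\<rho> s) (\<rho> t)
          = ennreal \<bar>t - s\<bar> * transport_dist X Q \<pi> (\<rho> 0) (\<rho> 1))"

definition Ric_bounded_below ::
  "'a set \<Rightarrow> ('a \<Rightarrow> 'a \<Rightarrow> real) \<Rightarrow> ('a \<Rightarrow> real) \<Rightarrow> real \<Rightarrow> bool" where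
  "Ric_bounded_below X Q \<pi> \<kappa> \<longleftrightarrow> markov_triple X Q \<pi> \<and>
     (\<forall>\<rho>. constant_speed_geodesic X Q \<pi> \<rho> \<longrightarrow>
       (\<forall>t\<in>{0..1}.
          ereal (entropy X \<pi> (\<rho> t))
            \<le> ereal ((1 - t) * entropy X \<pi> (\<rho> 0) + t * entropy X \<pi> (\<rho> 1))
              - ereal (\<kappa> / 2 * t * (1 - t)) * enn2ereal ((transport_dist X Q \<pi> (\<rho> 0) (\<rho> 1))\<^sup>2)))"

section \<open>The Bernoulli--Laplace model\<close>

text \<open>Points of \<open>{0,1}\<^sup>n\<close> are integer-valued functions on \<open>{1..n}\<close>, with value \<open>undefined\<close>
  outside of \<open>{1..n}\<close>.\<close>

definition slice :: "nat \<Rightarrow> nat \<Rightarrow> (nat \<Rightarrow> int) set" where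
  "slice n k = {x \<in> {1..n} \<rightarrow>\<^sub>E {0, 1}. (\<Sum>i\<in>{1..n}. x i) = int k}"

definition Q_BL :: "nat \<Rightarrow> nat \<Rightarrow> (nat \<Rightarrow> int) \<Rightarrow> (nat \<Rightarrow> int) \<Rightarrow> real" where
  "Q_BL n k x y =
     (if (\<Sum>i\<in>{1..n}. \<bar>x i - y i\<bar>) = 2 then 1 / (real k * (real n - real k)) else 0)"

definition pi_BL :: "nat \<Rightarrow> nat \<Rightarrow> (nat \<Rightarrow> int) \<Rightarrow> real" where
  "pi_BL n k x = 1 / real (n choose k)"

lemma card_slice: "card (slice n k) = n choose k"
proof -
  let ?f = "\<lambda>x::nat \<Rightarrow> int. {i\<in>{1..n}. x i = 1}"
  let ?g = "\<lambda>A::nat set. \<lambda>i\<in>{1..n}. if i \<in> A then 1 else (0::int)"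
  have sum_eq: "(\<Sum>i\<in>{1..n}. x i) = int (card (?f x))" if "x \<in> {1..n} \<rightarrow>\<^sub>E {0, 1}" for x
  proof -
    have "(\<Sum>i\<in>{1..n}. x i) = (\<Sum>i\<in>{1..n}. if x i = 1 then 1 else 0)"
      using that by (intro sum.cong) (auto simp: PiE_iff)
    then show ?thesis by (simp add: sum.If_cases Int_def)
  qed
  have "bij_betw ?f (slice n k) {A. A \<subseteq> {1..n} \<and> card A = k}"
  proof (rule bij_betw_byWitness[where f' = ?g])
    show "\<forall>x\<in>slice n k. ?g (?f x) = x"
    proof
      fix x assume x: "x \<in> slice n k"
      show "?g (?f x) = x"
      proof
        fix i show "?g (?f x) i = x i"
          using x by (cases "i \<in> {1..n}") (auto simp: slice_def PiE_iff extensional_def)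
      qed
    qed
    show f_g: "\<forall>A\<in>{A. A \<subseteq> {1..n} \<and> card A = k}. ?f (?g A) = A"
      by auto
    show "?f ` slice n k \<subseteq> {A. A \<subseteq> {1..n} \<and> card A = k}"
      using sum_eq by (auto simp: slice_def)
    show "?g ` {A. A \<subseteq> {1..n} \<and> card A = k} \<subseteq> slice n k"
    proof (rule image_subsetI)
      fix A assume A: "A \<in> {A. A \<subseteq> {1..n} \<and> card A = k}"
      have g: "?g A \<in> {1..n} \<rightarrow>\<^sub>E {0, 1}" by auto
      have "(\<Sum>i\<in>{1..n}. ?g A i) = int k"
        unfolding sum_eq[OF g] using f_g A by simp
      then show "?g A \<in> slice n k" using g by (simp add: slice_def)
    qed
  qed
  then show ?thesis
    using bij_betw_same_card n_subsets[of "{1..n}" k] by fastforce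
qed

lemma markov_triple_BL:
  assumes "k \<le> n"
  shows "markov_triple (slice n k) (Q_BL n k) (pi_BL n k)"
proof
  have "finite ({1..n} \<rightarrow>\<^sub>E {0, 1 :: int})" by (intro finite_PiE) auto
  then show "finite (slice n k)" by (rule rev_finite_subset) (auto simp: slice_def)
  show "(\<Sum>x\<in>slice n k. pi_BL n k x) = 1"
    using assms by (simp add: pi_BL_def card_slice)
qed (use assms in \<open>auto simp: Q_BL_def pi_BL_def abs_minus_commute\<close>)

end

theory Submission
  imports Defs "HOL-Real_Asymp.Real_Asymp"
begin

text \<open>The argument follows Daneri and Savare: a gradient estimate for the heat semigroup
  \<open>P\<close> implies an evolution variational inequality, which in turn forces convexity of the entropy
  along every geodesic, without any regularity of the geodesic itself.

  Write \<open>K \<rho> \<psi>\<close> for the flux of a potential, so that admissible curves satisfy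
  \<open>\<rho>' = K \<rho> \<psi>\<close>, and \<open>A(\<rho>, \<psi>) = (\<psi>, K \<rho> \<psi>)\<close>. Given a curve
  \<open>\<rho>\<close> from \<open>\<sigma>\<close> to \<open>\<tau>\<close>, consider \<open>\<mu> s = P (h s) (\<rho> s)\<close>, which runs from
  \<open>\<sigma>\<close> to \<open>P h \<tau>\<close> and is positive for \<open>s > 0\<close>; hence \<open>\<mu>' = K \<mu> \<phi>\<close> is solvable.
  Since the Laplacian is \<open>- K \<mu> (ln \<mu>)\<close>, the pairing of \<open>\<phi>\<close> with the Laplacian of
  \<open>\<mu>\<close> is minus the derivative of the entropy, and the gradient estimate
  \<open>exp (2 \<kappa> t) A(\<rho>, P t \<phi>) \<le> A(P t \<rho>, \<phi>)\<close> bounds the rest: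
  \<open>A(\<mu>, \<phi>) \<le> exp (- 2 \<kappa> h s) A(\<rho>, \<psi>) - 2 h d/ds H(\<mu>)\<close>.

  The gradient estimate follows from a Bochner inequality, which holds for each of the means
  \<open>r powr (1 - p) * s powr p\<close> separately and is inherited by their integral, the logarithmic
  mean. For the Bernoulli--Laplace model it is verified by splitting pairs of moves into equal
  moves, triangles and commuting squares; only concavity and homogeneity of the mean enter.\<close>

section \<open>Piecewise smooth functions\<close>

text \<open>Why the variational inequality forces convexity: if \<rho> divides a geodesic from
  \<sigma> to \<tau> at time \<theta>, the triangle inequality makes it a minimiser of (1 -
  \<theta>) W(\<sigma>, .)^2 + \<theta> W(\<tau>, .)^2. Replacing \<rho> by its heat flow at time h
  cannot lower this sum, while the variational inequality from both ends bounds its change by terms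
  of order h; dividing by 2 h and letting h tend to 0 leaves the entropy inequality at \<rho>. The
  obstacle is that densities may vanish, where the logarithmic mean degenerates and a velocity need
  not determine a potential. Potentials are therefore solved for only after the heat flow has moved
  the curve into the interior, with continuous dependence on time. Running the curve at a suitable
  speed replaces exp (- 2 \<kappa> h s) by the constant 2 \<kappa> h / (exp (2 \<kappa> h) - 1),
  which is 1 - \<kappa> h to first order: the source of \<kappa> in the convexity bound. The three
  kinds of pairs of moves total 8 + 2 (n - 2) = 2 (n + 2); with the rate c = 1 / (k (n - k)) this
  gives \<kappa> = (n + 2) c / 2.\<close>

primrec times_differentiable :: "nat \<Rightarrow> real set \<Rightarrow> (real \<Rightarrow> real) \<Rightarrow> bool" where
  "times_differentiable 0 S f \<longleftrightarrow> True"
| "times_differentiable (Suc k) S f \<longleftrightarrow>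
     (\<exists>f'. (\<forall>t\<in>S. (f has_real_derivative f' t) (at t within S)) \<and> times_differentiable k S f')"

lemma times_differentiable_SucI:
  "(\<And>t. t \<in> S \<Longrightarrow> (f has_real_derivative f' t) (at t within S)) \<Longrightarrow>
    times_differentiable k S f' \<Longrightarrow> times_differentiable (Suc k) S f"
  by auto

lemma times_differentiable_cong:
  assumes "\<And>t. t \<in> S \<Longrightarrow> f t = g t" and "times_differentiable k S f"
  shows "times_differentiable k S g"
proof (cases k)
  case (Suc m)
  then obtain f' where f': "\<forall>t\<in>S. (f has_real_derivative f' t) (at t within S)"
    "times_differentiable m S f'"
    using assms(2) by auto
  have "(g has_real_derivative f' t) (at t within S)" if "t \<in> S" for t
    using f'(1) that assms(1) has_derivative_transform[of t S g f]
    unfolding has_field_derivative_def by auto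
  then show ?thesis using Suc f'(2) by auto
qed simp

lemma times_differentiable_SucD:
  "times_differentiable (Suc k) S f \<Longrightarrow> times_differentiable k S f"
proof (induction k arbitrary: f)
  case (Suc k)
  then show ?case by (metis times_differentiable.simps(2))
qed simp

lemma times_differentiable_const [simp]: "times_differentiable k S (\<lambda>_. c)"
proof (induction k arbitrary: c)
  case (Suc k)
  have "((\<lambda>_. c) has_real_derivative 0) (at t within S)" for t by simp
  then show ?case using Suc[of 0] by (rule times_differentiable_SucI)
qed simp

lemma times_differentiable_add:
  "times_differentiable k S f \<Longrightarrow> times_differentiable k S g
    \<Longrightarrow> times_differentiable k S (\<lambda>t. f t + g t)"
proof (induction k arbitrary: f g)
  case (Suc k)
  then obtain f' g' where
    "\<forall>t\<in>S. (f has_real_derivative f' t) (at t within S)" "times_differentiable k S f'"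
    "\<forall>t\<in>S. (g has_real_derivative g' t) (at t within S)" "times_differentiable k S g'"
    by auto
  then show ?case
    by (simp, intro exI[of _ "\<lambda>t. f' t + g' t"] conjI ballI Suc.IH)
       (auto intro!: derivative_eq_intros)
qed simp

lemma times_differentiable_mult:
  "times_differentiable k S f \<Longrightarrow> times_differentiable k S g
    \<Longrightarrow> times_differentiable k S (\<lambda>t. f t * g t)"
proof (induction k arbitrary: f g)
  case (Suc k)
  then obtain f' g' where *:
    "\<forall>t\<in>S. (f has_real_derivative f' t) (at t within S)" "times_differentiable k S f'"
    "\<forall>t\<in>S. (g has_real_derivative g' t) (at t within S)" "times_differentiable k S g'"
    by auto
  have "times_differentiable k S (\<lambda>t. f' t * g t + f t * g' t)"
    by (intro times_differentiable_add Suc.IH *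
        times_differentiable_SucD[OF Suc.prems(1)] times_differentiable_SucD[OF Suc.prems(2)])
  moreover have "((\<lambda>t. f t * g t) has_real_derivative f' t * g t + f t * g' t) (at t within S)"
    if "t \<in> S" for t
    using DERIV_mult[OF *(1)[rule_format, OF that] *(3)[rule_format, OF that]]
    by (simp add: mult.commute)
  ultimately show ?case by (intro times_differentiable_SucI)
qed simp

lemma times_differentiable_sum:
  "(\<And>i. i \<in> I \<Longrightarrow> times_differentiable k S (f i))
    \<Longrightarrow> times_differentiable k S (\<lambda>t. \<Sum>i\<in>I. f i t)"
  by (induction I rule: infinite_finite_induct) (auto intro: times_differentiable_add)

lemma times_differentiable_compose:
  "times_differentiable k S f \<Longrightarrow> times_differentiable k R h \<Longrightarrow> h ` R \<subseteq> S
    \<Longrightarrow> times_differentiable k R (\<lambda>t. f (h t))"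
proof (induction k arbitrary: f)
  case (Suc k)
  then obtain f' h' where *:
    "\<forall>t\<in>S. (f has_real_derivative f' t) (at t within S)" "times_differentiable k S f'"
    "\<forall>t\<in>R. (h has_real_derivative h' t) (at t within R)" "times_differentiable k R h'"
    by auto
  have "times_differentiable k R (\<lambda>t. f' (h t) * h' t)"
    by (intro times_differentiable_mult Suc.IH[OF *(2)] *(4)
        times_differentiable_SucD[OF Suc.prems(2)] Suc.prems(3))
  moreover have "((\<lambda>t. f (h t)) has_real_derivative f' (h t) * h' t) (at t within R)"
    if "t \<in> R" for t
  proof -
    have "(f has_real_derivative f' (h t)) (at (h t) within h ` R)"
      using *(1) Suc.prems(3) that by (meson DERIV_subset image_eqI subset_iff)
    from DERIV_image_chain[OF this *(3)[rule_format, OF that]] show ?thesis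
      by (simp add: o_def)
  qed
  ultimately show ?case by (intro times_differentiable_SucI)
qed simp

lemma times_differentiable_subset:
  "times_differentiable k S f \<Longrightarrow> R \<subseteq> S \<Longrightarrow> times_differentiable k R f"
proof (induction k arbitrary: f)
  case (Suc k)
  then obtain f' where "\<forall>t\<in>S. (f has_real_derivative f' t) (at t within S)"
    "times_differentiable k S f'"
    by auto
  with Suc show ?case
    by (intro times_differentiable_SucI[where f' = f']) (auto intro: DERIV_subset)
qed simp

lemma times_differentiable_affine: "times_differentiable k S (\<lambda>t. a + b * t)"
proof (cases k)
  case (Suc m)
  have "((\<lambda>t. a + b * t) has_real_derivative b) (at t within S)" for t
    by (auto intro!: derivative_eq_intros)
  then show ?thesis
    unfolding Suc by (rule times_differentiable_SucI[where f' = "\<lambda>_. b"]) simp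
qed simp

lemma times_differentiable_exp: "times_differentiable k S (\<lambda>t. exp (c * t))"
proof (induction k)
  case (Suc k)
  have "times_differentiable k S (\<lambda>t. c * exp (c * t))"
    using times_differentiable_mult[OF times_differentiable_const Suc] by simp
  moreover have "((\<lambda>t. exp (c * t)) has_real_derivative c * exp (c * t)) (at t within S)" for t
    by (auto intro!: derivative_eq_intros)
  ultimately show ?case by (intro times_differentiable_SucI)
qed simp

lemma times_differentiable_sequence:
  assumes "\<And>k t. t \<in> S \<Longrightarrow> (g k has_real_derivative g (Suc k) t) (at t within S)"
  shows "times_differentiable m S (g k)"
  using assms by (induction m arbitrary: k) auto

text \<open>Differentiability order by order passes to products and compositions by induction, with
  no formula for higher derivatives. Conversely, the derivatives chosen for different orders are
  glued into one sequence; they agree because derivatives within a nondegenerate interval are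
  unique.\<close>

lemma smooth_on_interval_iff:
  assumes "a < b"
  shows "smooth_on_interval f a b \<longleftrightarrow> (\<forall>k. times_differentiable k {a..b} f)"
proof
  assume "smooth_on_interval f a b"
  then obtain g where g: "\<And>t. t \<in> {a..b} \<Longrightarrow> g 0 t = f t"
    "\<And>k t. t \<in> {a..b} \<Longrightarrow> (g k has_real_derivative g (Suc k) t) (at t within {a..b})"
    unfolding smooth_on_interval_def by blast
  show "\<forall>k. times_differentiable k {a..b} f"
    using times_differentiable_cong[of "{a..b}" "g 0" f] times_differentiable_sequence[of "{a..b}" g] g
    by blast
next
  assume all: "\<forall>k. times_differentiable k {a..b} f"
  define D where "D = (\<lambda>(f::real \<Rightarrow> real) t. SOME d. (f has_real_derivative d) (at t within {a..b}))"
  define g where "g k = (D ^^ k) f" for k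
  have step: "(\<forall>t\<in>{a..b}. (h has_real_derivative D h t) (at t within {a..b})) \<and>
      (\<forall>k. times_differentiable k {a..b} (D h))"
    if h: "\<forall>k. times_differentiable k {a..b} h" for h
  proof (intro conjI ballI allI)
    have D: "(h has_real_derivative D h t) (at t within {a..b})" if "t \<in> {a..b}" for t
    proof -
      have "\<exists>d. (h has_real_derivative d) (at t within {a..b})"
        using h[rule_format, of 1] that by auto
      then show ?thesis unfolding D_def by (rule someI_ex)
    qed
    then show "(h has_real_derivative D h t) (at t within {a..b})" if "t \<in> {a..b}" for t
      using that .
    fix k
    obtain h' where h': "\<forall>t\<in>{a..b}. (h has_real_derivative h' t) (at t within {a..b})"
      "times_differentiable k {a..b} h'"
      using h[rule_format, of "Suc k"] by auto
    have "h' t = D h t" if "t \<in> {a..b}" for t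
    proof -
      have "at t within {a..b} \<noteq> bot"
        using that assms by (simp add: trivial_limit_within islimpt_Icc)
      then show ?thesis
        using has_field_derivative_unique D[OF that] h'(1) that by blast
    qed
    then show "times_differentiable k {a..b} (D h)"
      using times_differentiable_cong h'(2) by blast
  qed
  have "\<forall>m. times_differentiable m {a..b} (g k)" for k
    by (induction k) (use all step in \<open>auto simp: g_def\<close>)
  then show "smooth_on_interval f a b"
    unfolding smooth_on_interval_def using step
    by (intro exI[of _ g]) (auto simp: g_def)
qed

text \<open>The end points need not be break points: the interval lies inside the cell between the
  last break point \<open>c\<close> up to \<open>a\<close> and the first one \<open>d\<close> from
  \<open>b\<close> on.\<close>

lemma piecewise_smooth_alongD:
  assumes "piecewise_smooth_along B f" and ab: "0 \<le> a" "a < b" "b \<le> 1" "B \<inter> {a<..<b} = {}"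
  shows "smooth_on_interval f a b"
proof -
  have B: "finite B" "{0, 1} \<subseteq> B"
    using assms(1) by (auto simp: piecewise_smooth_along_def)
  define c where "c = Max (B \<inter> {..a})"
  define d where "d = Min (B \<inter> {b..})"
  have c: "c \<in> B \<inter> {..a}" unfolding c_def using B ab by (intro Max_in) auto
  have d: "d \<in> B \<inter> {b..}" unfolding d_def using B ab by (intro Min_in) auto
  have "B \<inter> {c<..<d} = {}"
  proof (rule ccontr)
    assume "B \<inter> {c<..<d} \<noteq> {}"
    then obtain t where t: "t \<in> B" "c < t" "t < d" by auto
    have "t \<le> c" if "t \<le> a" unfolding c_def by (rule Max_ge) (use B t that in auto)
    moreover have "d \<le> t" if "b \<le> t" unfolding d_def by (rule Min_le) (use B t that in auto)
    ultimately show False using t ab by force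
  qed
  moreover have "c < d" using c d ab by auto
  ultimately have "smooth_on_interval f c d"
    using assms(1) c d unfolding piecewise_smooth_along_def by blast
  then show ?thesis
    using \<open>c < d\<close> c d ab times_differentiable_subset[of _ "{c..d}" f "{a..b}"]
    by (simp add: smooth_on_interval_iff)
qed

lemma piecewise_smooth_along_compose:
  assumes "piecewise_smooth_along B f" and "a < b" and "0 \<le> c" "c < d" "d \<le> 1" "B \<inter> {c<..<d} = {}"
    and "\<And>k. times_differentiable k {a..b} h" and "h ` {a..b} \<subseteq> {c..d}"
  shows "smooth_on_interval (\<lambda>t. f (h t)) a b"
  using piecewise_smooth_alongD[OF assms(1,3-6)] assms(2,4,7,8)
  by (auto simp: smooth_on_interval_iff intro: times_differentiable_compose)

text \<open>Supplies continuity in time of the velocity of a curve off the break points, on which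
  the measurability of the deformed action later rests.\<close>

lemma piecewise_smooth_along_derivative:
  assumes f: "piecewise_smooth_along B f"
  obtains f' where "\<And>t. t \<in> {0..1} - B \<Longrightarrow> (f has_real_derivative f' t) (at t)"
    and "continuous_on ({0..1} - B) f'"
proof
  have B: "finite B" "{0, 1} \<subseteq> B"
    using f by (auto simp: piecewise_smooth_along_def)
  define f' where "f' t = deriv f t" for t
  have local: "(f has_real_derivative f' t) (at t) \<and> isCont f' t" if t: "t \<in> {0..1} - B" for t
  proof -
    have "open (- B)" using B by (simp add: finite_imp_closed open_Compl)
    then obtain e where e: "e > 0" "ball t e \<subseteq> - B" using t open_contains_ball by blast
    have t01: "0 < t" "t < 1" using t B by (auto simp: less_le)
    define u where "u = max 0 (t - e)"
    define v where "v = min 1 (t + e)"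
    have uv: "0 \<le> u" "u < t" "t < v" "v \<le> 1" using t01 e by (auto simp: u_def v_def)
    have "B \<inter> {u<..<v} = {}" using e(2) by (auto simp: u_def v_def ball_def dist_real_def subset_iff)
    then have "smooth_on_interval f u v" using piecewise_smooth_alongD[OF f] uv by simp
    \<comment> \<open>The second derivative is taken in order to make the first one
      continuous.\<close>
    then have "times_differentiable 2 {u..v} f" using uv by (simp add: smooth_on_interval_iff)
    then obtain g g' where g: "\<forall>t\<in>{u..v}. (f has_real_derivative g t) (at t within {u..v})"
      "\<forall>t\<in>{u..v}. (g has_real_derivative g' t) (at t within {u..v})"
      by (auto simp: numeral_2_eq_2)
    have inner: "(f has_real_derivative g s) (at s)" if "s \<in> {u<..<v}" for s
      using g(1)[rule_format, of s] that at_within_interior[of s "{u..v}"]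
      by (auto simp: interior_atLeastAtMost_real)
    then have eq: "f' s = g s" if "s \<in> {u<..<v}" for s
      using that DERIV_imp_deriv unfolding f'_def by blast
    have "isCont g t"
      using g(2)[rule_format, of t] uv at_within_interior[of t "{u..v}"]
      by (auto simp: interior_atLeastAtMost_real intro: DERIV_isCont)
    moreover have "eventually (\<lambda>s. f' s = g s) (nhds t)"
      using eventually_nhds_in_open[of "{u<..<v}" t] uv by (auto elim!: eventually_mono intro: eq)
    ultimately have "isCont f' t" by (simp add: isCont_cong)
    moreover have "(f has_real_derivative f' t) (at t)" using inner[of t] eq[of t] uv by simp
    ultimately show ?thesis by simp
  qed
  show "\<And>t. t \<in> {0..1} - B \<Longrightarrow> (f has_real_derivative f' t) (at t)" using local by blast
  show "continuous_on ({0..1} - B) f'"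
    using local by (blast intro: continuous_at_imp_continuous_on)
qed

lemma piecewise_smooth_along_continuous:
  assumes f: "piecewise_smooth_along B f"
  shows "continuous_on {0..1} f"
proof -
  have B: "finite B" "{0, 1} \<subseteq> B" "B \<subseteq> {0..1}"
    using f by (auto simp: piecewise_smooth_along_def)
  define I where "I = {(a, b). a \<in> B \<and> b \<in> B \<and> a < b \<and> B \<inter> {a<..<b} = {}}"
  have "I \<subseteq> B \<times> B" by (auto simp: I_def)
  then have fin: "finite I" using B by (meson finite_SigmaI finite_subset)
  have "continuous_on (\<Union>(a, b)\<in>I. {a..b}) f"
  proof (rule continuous_on_closed_Union[OF fin])
    fix i assume "i \<in> I"
    then obtain a b where i: "i = (a, b)" "a \<in> B" "b \<in> B" "a < b" "B \<inter> {a<..<b} = {}"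
      by (auto simp: I_def)
    then have "smooth_on_interval f a b"
      using f by (simp add: piecewise_smooth_along_def)
    then have "times_differentiable (Suc 0) {a..b} f" using i by (simp add: smooth_on_interval_iff)
    then obtain f' where "\<forall>t\<in>{a..b}. (f has_real_derivative f' t) (at t within {a..b})"
      by auto
    then have "continuous_on {a..b} f" by (intro DERIV_continuous_on[where D = f']) auto
    then show "continuous_on (case i of (a, b) \<Rightarrow> {a..b}) f" by (simp add: i(1))
  qed auto
  moreover have "{0..1} \<subseteq> (\<Union>(a, b)\<in>I. {a..b})"
  proof
    fix t :: real assume t: "t \<in> {0..1}"
    show "t \<in> (\<Union>(a, b)\<in>I. {a..b})"
    \<comment> \<open>No break point lies to the right of 1, so there the cell ending at 1 is used;
      every other \<open>t\<close> lies in the cell starting at the last break point up to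
      \<open>t\<close>.\<close>
    proof (cases "t = 1")
      case False
      define a where "a = Max (B \<inter> {..t})"
      define b where "b = Min (B \<inter> {t<..})"
      have a: "a \<in> B \<inter> {..t}" unfolding a_def using B t by (intro Max_in) auto
      have b: "b \<in> B \<inter> {t<..}" unfolding b_def using B t False by (intro Min_in) auto
      have "B \<inter> {a<..<b} = {}"
      proof (rule ccontr)
        assume "B \<inter> {a<..<b} \<noteq> {}"
        then obtain s where s: "s \<in> B" "a < s" "s < b" by auto
        have "s \<le> a" if "s \<le> t" unfolding a_def by (rule Max_ge) (use B s that in auto)
        moreover have "b \<le> s" if "t < s" unfolding b_def by (rule Min_le) (use B s that in auto)
        ultimately show False using s by linarith
      qed
      then have "(a, b) \<in> I" "t \<in> {a..b}" using a b by (auto simp: I_def)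
      then show ?thesis by blast
    next
      case True
      define a where "a = Max (B \<inter> {..<1})"
      have a: "a \<in> B \<inter> {..<1}" unfolding a_def using B by (intro Max_in) auto
      have "B \<inter> {a<..<1} = {}"
      proof (rule ccontr)
        assume "B \<inter> {a<..<1} \<noteq> {}"
        then obtain s where s: "s \<in> B" "a < s" "s < 1" by auto
        have "s \<le> a" unfolding a_def by (rule Max_ge) (use B s in auto)
        then show False using s by simp
      qed
      then have "(a, 1) \<in> I" "t \<in> {a..1}" using a B True by (auto simp: I_def)
      then show ?thesis by blast
    qed
  qed
  ultimately show ?thesis by (rule continuous_on_subset)
qed

section \<open>Parametrized linear systems and the logarithmic mean\<close>

text \<open>Gaussian elimination, one index at a time. Pivots of a positive definite matrix are
  positive, so every division keeps the solution continuous in the parameter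
  \<open>t\<close>.\<close>

lemma positive_definite_system_solvable:
  fixes a :: "'t::topological_space \<Rightarrow> 'a \<Rightarrow> 'a \<Rightarrow> real"
  assumes "finite X"
    and "\<And>t x y. t \<in> T \<Longrightarrow> x \<in> X \<Longrightarrow> y \<in> X \<Longrightarrow> a t x y = a t y x"
    and "\<And>t \<phi>. t \<in> T \<Longrightarrow> \<exists>x\<in>X. \<phi> x \<noteq> 0 \<Longrightarrow> 0 < (\<Sum>x\<in>X. \<Sum>y\<in>X. a t x y * \<phi> x * \<phi> y)"
    and "\<And>x y. x \<in> X \<Longrightarrow> y \<in> X \<Longrightarrow> continuous_on T (\<lambda>t. a t x y)"
    and "\<And>x. x \<in> X \<Longrightarrow> continuous_on T (\<lambda>t. b t x)"
  shows "\<exists>\<phi>. (\<forall>x\<in>X. continuous_on T (\<lambda>t. \<phi> t x)) \<and>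
      (\<forall>t\<in>T. \<forall>x\<in>X. (\<Sum>y\<in>X. a t x y * \<phi> t y) = b t x)"
  using assms
proof (induction X arbitrary: a b rule: finite_induct)
  case (insert z X)
  note sym = insert.prems(1) and pos = insert.prems(2)
    and cont_a = insert.prems(3) and cont_b = insert.prems(4)
  \<comment> \<open>The Schur complement of the pivot, and the right-hand side after elimination of
    \<open>z\<close>.\<close>
  define a' where "a' t x y = a t x y - a t x z * a t z y / a t z z" for t x y
  define b' where "b' t x = b t x - a t x z * b t z / a t z z" for t x
  have pivot: "a t z z > 0" if "t \<in> T" for t
  proof -
    have "(\<Sum>x\<in>insert z X. \<Sum>y\<in>insert z X. a t x y * of_bool (x = z) * of_bool (y = z)) = a t z z"
      using insert.hyps by (auto intro!: sum.neutral)
    then show ?thesis using pos[OF that, of "\<lambda>x. of_bool (x = z)"] by simp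
  qed
  have "\<exists>\<phi>. (\<forall>x\<in>X. continuous_on T (\<lambda>t. \<phi> t x)) \<and>
      (\<forall>t\<in>T. \<forall>x\<in>X. (\<Sum>y\<in>X. a' t x y * \<phi> t y) = b' t x)"
  proof (rule insert.IH)
    fix t x y assume "t \<in> T" "x \<in> X" "y \<in> X"
    then show "a' t x y = a' t y x"
      using sym[of t x y] sym[of t x z] sym[of t y z] by (simp add: a'_def)
  next
    fix t \<phi> assume t: "t \<in> T" and nz: "\<exists>x\<in>X. \<phi> x \<noteq> (0::real)"
    define S where "S = (\<Sum>y\<in>X. a t z y * \<phi> y)"
    \<comment> \<open>This value at \<open>z\<close> minimises the quadratic form over the
      coordinate \<open>z\<close>, so the form at \<eta> equals that of the Schur complement at
      \<phi>.\<close>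
    define \<eta> where "\<eta> = \<phi>(z := - (S / a t z z))"
    have \<eta>: "\<eta> x = \<phi> x" if "x \<in> X" for x using that insert.hyps by (auto simp: \<eta>_def)
    have S': "(\<Sum>x\<in>X. a t x z * \<phi> x) = S"
      unfolding S_def using sym[OF t] by (intro sum.cong) auto
    have "(\<Sum>x\<in>insert z X. \<Sum>y\<in>insert z X. a t x y * \<eta> x * \<eta> y)
        = a t z z * \<eta> z * \<eta> z + (\<Sum>y\<in>X. a t z y * \<phi> y) * \<eta> z
          + ((\<Sum>x\<in>X. a t x z * \<phi> x) * \<eta> z + (\<Sum>x\<in>X. \<Sum>y\<in>X. a t x y * \<phi> x * \<phi> y))"
      using insert.hyps \<eta>
      by (simp add: sum.distrib sum_distrib_left sum_distrib_right algebra_simps cong: sum.cong)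
    also have "\<dots> = (\<Sum>x\<in>X. \<Sum>y\<in>X. a t x y * \<phi> x * \<phi> y) - S * S / a t z z"
      unfolding S' S_def[symmetric] using pivot[OF t] by (simp add: \<eta>_def field_simps)
    also have "S * S / a t z z = (\<Sum>x\<in>X. a t x z * \<phi> x) * (\<Sum>y\<in>X. a t z y * \<phi> y) / a t z z"
      by (simp only: S' S_def[symmetric])
    also have "\<dots> = (\<Sum>x\<in>X. \<Sum>y\<in>X. a t x z * a t z y / a t z z * \<phi> x * \<phi> y)"
      by (simp add: sum_product sum_divide_distrib mult_ac)
    also have "(\<Sum>x\<in>X. \<Sum>y\<in>X. a t x y * \<phi> x * \<phi> y) - \<dots>
        = (\<Sum>x\<in>X. \<Sum>y\<in>X. a' t x y * \<phi> x * \<phi> y)"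
      unfolding sum_subtractf[symmetric] by (simp add: a'_def left_diff_distrib)
    finally have "(\<Sum>x\<in>insert z X. \<Sum>y\<in>insert z X. a t x y * \<eta> x * \<eta> y)
        = (\<Sum>x\<in>X. \<Sum>y\<in>X. a' t x y * \<phi> x * \<phi> y)" .
    moreover have "\<exists>x\<in>insert z X. \<eta> x \<noteq> 0" using nz \<eta> by auto
    ultimately show "0 < (\<Sum>x\<in>X. \<Sum>y\<in>X. a' t x y * \<phi> x * \<phi> y)"
      using pos[OF t, of \<eta>] by (simp only:)
  next
    fix x y assume "x \<in> X" "y \<in> X"
    then show "continuous_on T (\<lambda>t. a' t x y)"
      unfolding a'_def using pivot
      by (intro continuous_intros cont_a) (auto dest: pivot)
  next
    fix x assume "x \<in> X"
    then show "continuous_on T (\<lambda>t. b' t x)"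
      unfolding b'_def using pivot
      by (intro continuous_intros cont_a cont_b) (auto dest: pivot)
  qed
  then obtain \<phi> where \<phi>: "\<forall>x\<in>X. continuous_on T (\<lambda>t. \<phi> t x)"
    "\<forall>t\<in>T. \<forall>x\<in>X. (\<Sum>y\<in>X. a' t x y * \<phi> t y) = b' t x" by blast
  define \<psi> where "\<psi> t = (\<phi> t)(z := (b t z - (\<Sum>y\<in>X. a t z y * \<phi> t y)) / a t z z)" for t
  have \<psi>: "\<psi> t x = \<phi> t x" if "x \<in> X" for t x using that insert.hyps by (auto simp: \<psi>_def)
  have split: "(\<Sum>y\<in>insert z X. a t x y * \<psi> t y) = a t x z * \<psi> t z + (\<Sum>y\<in>X. a t x y * \<phi> t y)" for t x
    using insert.hyps \<psi> by (simp cong: sum.cong)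
  have solve: "(\<Sum>y\<in>insert z X. a t x y * \<psi> t y) = b t x" if t: "t \<in> T" and x: "x \<in> insert z X" for t x
  proof (cases "x = z")
    case True
    then show ?thesis using pivot[OF t] by (simp only: split) (simp add: \<psi>_def)
  next
    case False
    then have "(\<Sum>y\<in>X. a' t x y * \<phi> t y) = b' t x" using \<phi>(2) t x by blast
    then have "(\<Sum>y\<in>X. a t x y * \<phi> t y) - a t x z / a t z z * (\<Sum>y\<in>X. a t z y * \<phi> t y)
        = b t x - a t x z * b t z / a t z z"
      by (simp add: a'_def b'_def left_diff_distrib sum_subtractf sum_distrib_left mult.assoc)
    then show ?thesis
      using pivot[OF t] by (simp only: split) (simp add: \<psi>_def field_simps)
  qed
  have "continuous_on T (\<lambda>t. \<psi> t x)" if "x \<in> insert z X" for x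
  proof (cases "x = z")
    case True
    have "continuous_on T (\<lambda>t. (b t z - (\<Sum>y\<in>X. a t z y * \<phi> t y)) / a t z z)"
      using \<phi>(1) by (intro continuous_intros cont_a cont_b) (auto dest: pivot)
    then show ?thesis using True by (simp add: \<psi>_def)
  next
    case False
    then show ?thesis using \<phi>(1) that \<psi> by simp
  qed
  with solve show ?case by blast
qed simp

section \<open>Weighted geometric means and their average, the logarithmic mean\<close>

definition geometric_mean :: "real \<Rightarrow> real \<Rightarrow> real \<Rightarrow> real" where
  "geometric_mean p r s = r powr (1 - p) * s powr p"

lemma geometric_mean_nonneg [simp]: "0 \<le> geometric_mean p r s"
  by (simp add: geometric_mean_def)

lemma geometric_mean_self: "0 \<le> r \<Longrightarrow> geometric_mean p r r = r"
  by (cases "r = 0") (simp_all add: geometric_mean_def flip: powr_add)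

lemma geometric_mean_deriv:
  assumes "0 < r" "0 < s"
  shows "((\<lambda>p. geometric_mean p r s) has_real_derivative (ln s - ln r) * geometric_mean p r s) (at p within S)"
proof -
  have "((\<lambda>p. exp ((1 - p) * ln r + p * ln s)) has_real_derivative
      (ln s - ln r) * exp ((1 - p) * ln r + p * ln s)) (at p within S)"
    by (auto intro!: derivative_eq_intros)
  moreover have "geometric_mean p r s = exp ((1 - p) * ln r + p * ln s)" for p
    using assms by (simp add: geometric_mean_def powr_def exp_add)
  ultimately show ?thesis by simp
qed

lemma geometric_mean_integrable:
  assumes "0 \<le> r" "0 \<le> s"
  shows "(\<lambda>p. geometric_mean p r s) integrable_on {0..1}"
proof (cases "r = 0 \<or> s = 0")
  case True
  \<comment> \<open>\<open>0 powr q = 0\<close> for every exponent \<open>q\<close>, also for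
    \<open>q = 0\<close>, so the integrand vanishes at the end points of the interval too.\<close>
  then have "(\<lambda>p. geometric_mean p r s) = (\<lambda>_. 0)" by (auto simp: geometric_mean_def)
  then show ?thesis by (simp only: integrable_0)
next
  case False
  then have "continuous_on {0..1} (\<lambda>p. geometric_mean p r s)"
    using assms False by (intro DERIV_continuous_on[OF geometric_mean_deriv]) auto
  then show ?thesis by (rule integrable_continuous_real)
qed

lemma log_mean_eq: "log_mean r s = integral {0..1} (\<lambda>p. geometric_mean p r s)"
  by (simp add: log_mean_def geometric_mean_def)

lemma log_mean_nonneg: "0 \<le> r \<Longrightarrow> 0 \<le> s \<Longrightarrow> 0 \<le> log_mean r s"
  unfolding log_mean_eq by (intro integral_nonneg geometric_mean_integrable) auto

lemma log_mean_mono: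
  assumes "0 \<le> r" "0 \<le> s" "r \<le> r'" "s \<le> s'"
  shows "log_mean r s \<le> log_mean r' s'"
  unfolding log_mean_eq
proof (intro integral_le geometric_mean_integrable)
  fix p :: real assume "p \<in> {0..1}"
  then show "geometric_mean p r s \<le> geometric_mean p r' s'"
    unfolding geometric_mean_def using assms by (intro mult_mono powr_mono2) auto
qed (use assms in auto)

lemma log_mean_self: "0 \<le> r \<Longrightarrow> log_mean r r = r"
  by (simp add: log_mean_eq geometric_mean_self)

text \<open>Multiplication by \<open>ln s - ln r\<close> turns the integrand into the derivative of
  the geometric mean in \<open>p\<close>. Stating (r - s) / (ln r - ln s) as a product keeps the
  case \<open>r = s\<close>.\<close>

lemma log_mean_mult_ln_diff:
  assumes "0 < r" "0 < s"
  shows "log_mean r s * (ln r - ln s) = r - s"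
proof -
  have "((\<lambda>p. (ln s - ln r) * geometric_mean p r s) has_integral geometric_mean 1 r s - geometric_mean 0 r s) {0..1}"
    using assms geometric_mean_deriv[of r s]
    by (intro fundamental_theorem_of_calculus)
       (auto simp: has_real_derivative_iff_has_vector_derivative)
  moreover have "geometric_mean 1 r s = s" "geometric_mean 0 r s = r"
    using assms by (simp_all add: geometric_mean_def)
  ultimately have "integral {0..1} (\<lambda>p. (ln s - ln r) * geometric_mean p r s) = s - r"
    by (metis integral_unique)
  then have "(ln s - ln r) * log_mean r s = s - r"
    by (simp only: log_mean_eq integral_mult_right)
  then show ?thesis by (simp add: algebra_simps)
qed

lemma log_mean_commute:
  assumes "0 \<le> r" "0 \<le> s"
  shows "log_mean r s = log_mean s r"
proof (cases "r = 0 \<or> s = 0 \<or> r = s")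
  case True
  then show ?thesis by (auto simp: log_mean_def)
next
  case False
  then have pos: "0 < r" "0 < s" and "ln r \<noteq> ln s" using assms by auto
  have "log_mean r s * (ln r - ln s) = log_mean s r * (ln r - ln s)"
    using log_mean_mult_ln_diff[OF pos] log_mean_mult_ln_diff[OF pos(2,1)] by (simp add: algebra_simps)
  then show ?thesis using \<open>ln r \<noteq> ln s\<close> by simp
qed

lemma log_mean_pos:
  assumes "0 < r" "0 < s"
  shows "0 < log_mean r s"
  using log_mean_mono[of "min r s" "min r s" r s] assms by (simp add: log_mean_self)

lemma continuous_on_log_mean:
  assumes "continuous_on T f" "continuous_on T g" "\<And>t. t \<in> T \<Longrightarrow> 0 < f t" "\<And>t. t \<in> T \<Longrightarrow> 0 < g t"
  shows "continuous_on T (\<lambda>t. log_mean (f t) (g t))"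
proof -
  define U :: "(real \<times> real) set" where "U = {0<..} \<times> {0<..}"
  have "continuous_on (U \<times> cbox 0 (1::real))
      (\<lambda>(z, p). fst z powr (1 - p) * snd z powr p)"
    unfolding U_def case_prod_beta by (intro continuous_intros) auto
  then have "continuous_on U (\<lambda>z. integral (cbox 0 1) (\<lambda>p. fst z powr (1 - p) * snd z powr p))"
    by (rule integral_continuous_on_param)
  then have "continuous_on U (\<lambda>z. log_mean (fst z) (snd z))"
    by (simp add: log_mean_def)
  from continuous_on_compose2[OF this continuous_on_Pair[OF assms(1,2)]]
  show ?thesis using assms(3,4) by (auto simp: U_def)
qed

text \<open>Weighted AM-GM for the ratios \<open>u / r\<close> and \<open>v / s\<close>.
  Geometrically, the tangent plane at \<open>(r, s)\<close> lies above a concave function, and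
  homogeneity of degree 1 removes its constant term.\<close>

lemma geometric_mean_tangent:
  assumes "0 < r" "0 < s" "0 < u" "0 < v" "0 \<le> p" "p \<le> 1"
  shows "geometric_mean p u v \<le> geometric_mean p r s * ((1 - p) * (u / r) + p * (v / s))"
proof -
  have "(u / r) powr (1 - p) * (v / s) powr p \<le> (1 - p) * (u / r) + p * (v / s)"
    using assms by (intro Youngs_inequality_0) auto
  then have "geometric_mean p r s * ((u / r) powr (1 - p) * (v / s) powr p)
      \<le> geometric_mean p r s * ((1 - p) * (u / r) + p * (v / s))"
    by (intro mult_left_mono) auto
  moreover have "geometric_mean p r s * ((u / r) powr (1 - p) * (v / s) powr p) = geometric_mean p u v"
    using assms by (simp add: geometric_mean_def powr_divide)
  ultimately show ?thesis by simp
qed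

section \<open>Calculus on a Markov triple\<close>

context markov_triple
begin

definition inner :: "('a \<Rightarrow> real) \<Rightarrow> ('a \<Rightarrow> real) \<Rightarrow> real" where
  "inner f g = (\<Sum>x\<in>X. \<pi> x * f x * g x)"

definition laplacian :: "('a \<Rightarrow> real) \<Rightarrow> 'a \<Rightarrow> real" where
  "laplacian f x = (\<Sum>y\<in>X. Q x y * (f y - f x))"

text \<open>The action of a potential \<open>f\<close> at the density \<open>\<rho>\<close> is \<open>dirichlet w f f\<close> for the edge
  weights \<open>w x y = log_mean (\<rho> x) (\<rho> y)\<close>, and the continuity equation reads
  \<open>d/dt \<rho> = flux w f\<close>.\<close>

definition dirichlet :: "('a \<Rightarrow> 'a \<Rightarrow> real) \<Rightarrow> ('a \<Rightarrow> real) \<Rightarrow> ('a \<Rightarrow> real) \<Rightarrow> real" where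
  "dirichlet w f g = 1 / 2 * (\<Sum>x\<in>X. \<Sum>y\<in>X. (f x - f y) * (g x - g y) * w x y * (\<pi> x * Q x y))"

definition flux :: "('a \<Rightarrow> 'a \<Rightarrow> real) \<Rightarrow> ('a \<Rightarrow> real) \<Rightarrow> 'a \<Rightarrow> real" where
  "flux w f x = (\<Sum>y\<in>X. (f x - f y) * w x y * Q x y)"

lemma rate_nonneg': "x \<in> X \<Longrightarrow> y \<in> X \<Longrightarrow> 0 \<le> Q x y"
  using rate_nonneg rate_diag by (cases "x = y") auto

text \<open>Summation by parts: exchanging the names of \<open>x\<close> and \<open>y\<close> and
  using detailed balance gives a second expression, and the Dirichlet form is the mean of the
  two.\<close>

lemma inner_flux:
  assumes sym: "\<And>x y. x \<in> X \<Longrightarrow> y \<in> X \<Longrightarrow> w x y = w y x"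
  shows "inner g (flux w f) = dirichlet w g f"
proof -
  have 1: "inner g (flux w f) = (\<Sum>x\<in>X. \<Sum>y\<in>X. g x * (f x - f y) * w x y * (\<pi> x * Q x y))"
    unfolding inner_def flux_def by (simp add: sum_distrib_left algebra_simps)
  also have "\<dots> = (\<Sum>y\<in>X. \<Sum>x\<in>X. g x * (f x - f y) * w x y * (\<pi> x * Q x y))"
    by (rule sum.swap)
  also have "\<dots> = (\<Sum>x\<in>X. \<Sum>y\<in>X. g y * (f y - f x) * w x y * (\<pi> x * Q x y))"
    using sym detailed_balance by (intro sum.cong refl) (metis mult.assoc)
  finally have "2 * inner g (flux w f) = (\<Sum>x\<in>X. \<Sum>y\<in>X. g x * (f x - f y) * w x y * (\<pi> x * Q x y))
      + (\<Sum>x\<in>X. \<Sum>y\<in>X. g y * (f y - f x) * w x y * (\<pi> x * Q x y))"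
    using 1 by simp
  also have "\<dots> = 2 * dirichlet w g f"
    unfolding dirichlet_def by (simp add: sum.distrib[symmetric] algebra_simps)
  finally show ?thesis by simp
qed

lemma dirichlet_commute: "dirichlet w f g = dirichlet w g f"
  unfolding dirichlet_def by (simp add: mult.commute)

lemma dirichlet_nonneg:
  "(\<And>x y. x \<in> X \<Longrightarrow> y \<in> X \<Longrightarrow> 0 \<le> w x y) \<Longrightarrow> 0 \<le> dirichlet w f f"
  unfolding dirichlet_def
  by (intro zero_le_square mult_nonneg_nonneg sum_nonneg) (auto simp: prob_nonneg rate_nonneg')

lemma dirichlet_mono:
  "(\<And>x y. x \<in> X \<Longrightarrow> y \<in> X \<Longrightarrow> w x y \<le> w' x y) \<Longrightarrow> dirichlet w f f \<le> dirichlet w' f f"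
  unfolding dirichlet_def
  by (intro mult_left_mono sum_mono mult_right_mono)
     (auto simp: prob_nonneg rate_nonneg' intro!: mult_left_mono)

lemma dirichlet_add_scaled:
  "dirichlet w (\<lambda>x. f x - c * g x) (\<lambda>x. f x - c * g x)
    = dirichlet w f f - 2 * c * dirichlet w f g + c\<^sup>2 * dirichlet w g g"
  unfolding dirichlet_def
  by (simp add: sum_distrib_left sum.distrib[symmetric] sum_subtractf[symmetric] algebra_simps power2_eq_square)

text \<open>Young's inequality, from nonnegativity of the form at
  \<open>f - (a / c) g\<close>.\<close>

lemma dirichlet_polarization_le:
  assumes "\<And>x y. x \<in> X \<Longrightarrow> y \<in> X \<Longrightarrow> 0 \<le> w x y" and "0 < c"
  shows "2 * a * dirichlet w f g \<le> c * dirichlet w f f + a\<^sup>2 / c * dirichlet w g g"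
proof -
  have "0 \<le> c * dirichlet w (\<lambda>x. f x - a / c * g x) (\<lambda>x. f x - a / c * g x)"
    using assms by (intro mult_nonneg_nonneg dirichlet_nonneg) auto
  also have "\<dots> = c * dirichlet w f f + a\<^sup>2 / c * dirichlet w g g - 2 * a * dirichlet w f g"
    using assms(2) unfolding dirichlet_add_scaled by (simp add: field_simps power2_eq_square)
  finally show ?thesis by simp
qed

text \<open>Conservation of mass: a constant has zero Dirichlet pairing with every
  potential.\<close>

lemma sum_flux:
  assumes "\<And>x y. x \<in> X \<Longrightarrow> y \<in> X \<Longrightarrow> w x y = w y x"
  shows "inner (\<lambda>_. c) (flux w f) = 0"
  using inner_flux[where w = w and g = "\<lambda>_. c" and f = f, OF assms] by (simp add: dirichlet_def)

section \<open>The heat semigroup\<close>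

definition total_rate :: real where
  "total_rate = (\<Sum>x\<in>X. \<Sum>y\<in>X. Q x y)"

text \<open>Adding \<open>total_rate\<close> to the diagonal of the generator makes all entries nonnegative, so that
  positivity of the semigroup can be read off its power series.\<close>

definition jump_matrix :: "'a \<Rightarrow> 'a \<Rightarrow> real" where
  "jump_matrix x y = (if x = y then total_rate - (\<Sum>z\<in>X. Q x z) else Q x y)"

primrec jump_power :: "nat \<Rightarrow> 'a \<Rightarrow> 'a \<Rightarrow> real" where
  "jump_power 0 x y = of_bool (x = y)"
| "jump_power (Suc m) x y = (\<Sum>z\<in>X. jump_matrix x z * jump_power m z y)"

text \<open>Uniformization of the matrix exponential of \<open>t\<close> times the Laplacian: the
  series is the exponential of \<open>t\<close> times \<open>jump_matrix\<close>, and the prefactor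
  undoes the shift by \<open>total_rate\<close>.\<close>

definition heat_kernel :: "real \<Rightarrow> 'a \<Rightarrow> 'a \<Rightarrow> real" where
  "heat_kernel t x y = exp (- total_rate * t) * (\<Sum>m. jump_power m x y / fact m * t ^ m)"

definition heat :: "real \<Rightarrow> ('a \<Rightarrow> real) \<Rightarrow> 'a \<Rightarrow> real" where
  "heat t f x = (\<Sum>y\<in>X. heat_kernel t x y * f y)"

lemma jump_matrix_nonneg:
  assumes "x \<in> X" "y \<in> X"
  shows "0 \<le> jump_matrix x y"
proof -
  have "(\<Sum>z\<in>X. Q x z) \<le> total_rate"
    unfolding total_rate_def using assms finite_space
    by (intro member_le_sum[of x X "\<lambda>x. \<Sum>z\<in>X. Q x z"]) (auto intro: sum_nonneg rate_nonneg')
  then show ?thesis using assms by (auto simp: jump_matrix_def rate_nonneg')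
qed

lemma jump_matrix_apply:
  assumes "x \<in> X"
  shows "(\<Sum>y\<in>X. jump_matrix x y * f y) = laplacian f x + total_rate * f x"
proof -
  have "(\<Sum>y\<in>X. jump_matrix x y * f y)
      = (\<Sum>y\<in>X. Q x y * f y + (if x = y then (total_rate - (\<Sum>z\<in>X. Q x z)) * f x else 0))"
    using assms by (intro sum.cong) (auto simp: jump_matrix_def rate_diag)
  also have "\<dots> = (\<Sum>y\<in>X. Q x y * f y) + (total_rate - (\<Sum>z\<in>X. Q x z)) * f x"
    using assms finite_space by (simp add: sum.distrib)
  also have "\<dots> = laplacian f x + total_rate * f x"
    by (simp add: laplacian_def algebra_simps sum_subtractf sum_distrib_left)
  finally show ?thesis .
qed

lemma jump_power_nonneg: "x \<in> X \<Longrightarrow> y \<in> X \<Longrightarrow> 0 \<le> jump_power m x y"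
  by (induction m arbitrary: x) (auto intro!: sum_nonneg mult_nonneg_nonneg jump_matrix_nonneg)

lemma sum_jump_power: "x \<in> X \<Longrightarrow> (\<Sum>y\<in>X. jump_power m x y) = total_rate ^ m"
proof (induction m arbitrary: x)
  case 0
  then show ?case using finite_space by simp
next
  case (Suc m)
  have "(\<Sum>y\<in>X. jump_power (Suc m) x y) = (\<Sum>z\<in>X. jump_matrix x z * (\<Sum>y\<in>X. jump_power m z y))"
    by (simp add: sum_distrib_left) (rule sum.swap)
  also have "\<dots> = (\<Sum>z\<in>X. jump_matrix x z * total_rate ^ m)"
    using Suc.IH by simp
  also have "\<dots> = total_rate ^ Suc m"
    using Suc.prems by (simp add: jump_matrix_apply laplacian_def)
  finally show ?case .
qed

lemma jump_power_le: "x \<in> X \<Longrightarrow> y \<in> X \<Longrightarrow> jump_power m x y \<le> total_rate ^ m"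
  using member_le_sum[of y X "jump_power m x"] finite_space jump_power_nonneg
  by (simp add: sum_jump_power)

text \<open>The recursion that peels off the last jump. Transposition reverses the order of the
  factors, so reversibility of the powers needs both forms.\<close>

lemma jump_power_Suc':
  "x \<in> X \<Longrightarrow> y \<in> X \<Longrightarrow> jump_power (Suc m) x y = (\<Sum>z\<in>X. jump_power m x z * jump_matrix z y)"
proof (induction m arbitrary: x)
  case 0
  have "(\<Sum>z\<in>X. jump_matrix x z * of_bool (z = y)) = jump_matrix x y"
    "(\<Sum>z\<in>X. of_bool (x = z) * jump_matrix z y) = jump_matrix x y"
    using 0 finite_space by (simp_all add: Int_absorb1)
  then show ?case by simp
next
  case (Suc m)
  have "jump_power (Suc (Suc m)) x y = (\<Sum>u\<in>X. jump_matrix x u * jump_power (Suc m) u y)"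
    by simp
  also have "\<dots> = (\<Sum>u\<in>X. jump_matrix x u * (\<Sum>z\<in>X. jump_power m u z * jump_matrix z y))"
    using Suc by (intro sum.cong refl) metis
  also have "\<dots> = (\<Sum>z\<in>X. (\<Sum>u\<in>X. jump_matrix x u * jump_power m u z) * jump_matrix z y)"
    by (simp add: sum_distrib_left sum_distrib_right mult.assoc) (rule sum.swap)
  finally show ?case by simp
qed

lemma jump_power_reversible:
  "x \<in> X \<Longrightarrow> y \<in> X \<Longrightarrow> \<pi> x * jump_power m x y = \<pi> y * jump_power m y x"
proof (induction m arbitrary: x y)
  case (Suc m)
  have A: "\<pi> u * jump_matrix u v = \<pi> v * jump_matrix v u" if "u \<in> X" "v \<in> X" for u v
    using that detailed_balance by (auto simp: jump_matrix_def)
  have "\<pi> x * jump_power (Suc m) x y = (\<Sum>z\<in>X. \<pi> x * jump_matrix x z * jump_power m z y)"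
    by (simp add: sum_distrib_left mult.assoc)
  also have "\<dots> = (\<Sum>z\<in>X. jump_matrix z x * (\<pi> z * jump_power m z y))"
    using A Suc.prems by (intro sum.cong) (auto simp: algebra_simps)
  also have "\<dots> = (\<Sum>z\<in>X. jump_matrix z x * (\<pi> y * jump_power m y z))"
    using Suc by (intro sum.cong) auto
  also have "\<dots> = \<pi> y * jump_power (Suc m) y x"
    using Suc.prems by (simp only: jump_power_Suc') (simp add: sum_distrib_left algebra_simps)
  finally show ?case .
qed auto

text \<open>The row sums bound the entries of the powers by those of \<open>total_rate\<close>,
  which makes an exponential series the majorant.\<close>

lemma summable_heat_series:
  assumes "x \<in> X" "y \<in> X"
  shows "summable (\<lambda>m. jump_power m x y / fact m * t ^ m)"
proof (rule summable_comparison_test')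
  show "summable (\<lambda>m. (total_rate * \<bar>t\<bar>) ^ m / fact m)"
    using summable_exp[of "total_rate * \<bar>t\<bar>"] by (simp add: divide_inverse mult.commute)
  fix m
  have "norm (jump_power m x y / fact m * t ^ m) = jump_power m x y * \<bar>t\<bar> ^ m / fact m"
    using assms by (simp add: abs_mult power_abs jump_power_nonneg)
  also have "\<dots> \<le> total_rate ^ m * \<bar>t\<bar> ^ m / fact m"
    using assms by (intro divide_right_mono mult_right_mono jump_power_le) auto
  finally show "norm (jump_power m x y / fact m * t ^ m) \<le> (total_rate * \<bar>t\<bar>) ^ m / fact m"
    by (simp add: power_mult_distrib)
qed

lemma heat_kernel_nonneg: "x \<in> X \<Longrightarrow> y \<in> X \<Longrightarrow> 0 \<le> t \<Longrightarrow> 0 \<le> heat_kernel t x y"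
  unfolding heat_kernel_def
  by (intro mult_nonneg_nonneg suminf_nonneg summable_heat_series)
     (auto intro!: mult_nonneg_nonneg jump_power_nonneg divide_nonneg_nonneg)

lemma heat_kernel_0: "x \<in> X \<Longrightarrow> y \<in> X \<Longrightarrow> heat_kernel 0 x y = of_bool (x = y)"
  using powser_zero[of "\<lambda>m. jump_power m x y / fact m"] by (simp add: heat_kernel_def)

lemma sum_heat_kernel:
  assumes "x \<in> X"
  shows "(\<Sum>y\<in>X. heat_kernel t x y) = 1"
proof -
  have "(\<Sum>y\<in>X. heat_kernel t x y)
      = exp (- total_rate * t) * (\<Sum>m. \<Sum>y\<in>X. jump_power m x y / fact m * t ^ m)"
    unfolding heat_kernel_def sum_distrib_left[symmetric]
    using assms by (subst suminf_sum) (blast intro: summable_heat_series, simp)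
  also have "(\<lambda>m. \<Sum>y\<in>X. jump_power m x y / fact m * t ^ m)
      = (\<lambda>m. (total_rate * t) ^ m /\<^sub>R fact m)"
    unfolding sum_distrib_right[symmetric] sum_divide_distrib[symmetric] sum_jump_power[OF assms]
    by (simp add: power_mult_distrib divide_inverse mult_ac)
  also have "(\<Sum>m. (total_rate * t) ^ m /\<^sub>R fact m) = exp (total_rate * t)"
    by (simp add: exp_def)
  finally show ?thesis by (simp flip: exp_add)
qed

lemma heat_kernel_reversible:
  assumes "x \<in> X" "y \<in> X"
  shows "\<pi> x * heat_kernel t x y = \<pi> y * heat_kernel t y x"
proof -
  have *: "\<pi> u * (\<Sum>m. jump_power m u v / fact m * t ^ m)
      = (\<Sum>m. \<pi> u * jump_power m u v / fact m * t ^ m)" if "u \<in> X" "v \<in> X" for u v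
    using suminf_mult[OF summable_heat_series[OF that, of t], of "\<pi> u"] by (simp add: mult.assoc)
  show ?thesis
    using *[of x y] *[of y x] assms jump_power_reversible[OF assms]
    by (simp add: heat_kernel_def mult.left_commute)
qed

lemma heat_kernel_deriv:
  assumes "x \<in> X" "y \<in> X"
  shows "((\<lambda>t. heat_kernel t x y) has_real_derivative laplacian (\<lambda>z. heat_kernel t z y) x) (at t)"
proof -
  define s where "s t z = (\<Sum>m. jump_power m z y / fact m * t ^ m)" for t z
  have "((\<lambda>t. s t x) has_real_derivative (\<Sum>m. diffs (\<lambda>m. jump_power m x y / fact m) m * t ^ m)) (at t)"
    unfolding s_def
    by (rule termdiffs_strong_converges_everywhere) (rule summable_heat_series[OF assms])
  \<comment> \<open>Formal differentiation shifts the index: the coefficient of \<open>t ^ m\<close>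
    becomes \<open>jump_power (Suc m) x y / fact m\<close>, and the additional jump is split off in
    front.\<close>
  also have "(\<lambda>m. diffs (\<lambda>m. jump_power m x y / fact m) m * t ^ m)
      = (\<lambda>m. \<Sum>z\<in>X. jump_matrix x z * (jump_power m z y / fact m * t ^ m))"
  proof
    fix m
    have "diffs (\<lambda>m. jump_power m x y / fact m) m = jump_power (Suc m) x y / fact m"
      by (simp add: diffs_def field_simps del: jump_power.simps of_nat_Suc)
    then show "diffs (\<lambda>m. jump_power m x y / fact m) m * t ^ m
        = (\<Sum>z\<in>X. jump_matrix x z * (jump_power m z y / fact m * t ^ m))"
      by (simp add: sum_divide_distrib sum_distrib_right mult.assoc)
  qed
  also have "(\<Sum>m. \<Sum>z\<in>X. jump_matrix x z * (jump_power m z y / fact m * t ^ m))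
      = (\<Sum>z\<in>X. \<Sum>m. jump_matrix x z * (jump_power m z y / fact m * t ^ m))"
    by (rule suminf_sum) (intro summable_mult summable_heat_series assms(2))
  also have "\<dots> = (\<Sum>z\<in>X. jump_matrix x z * s t z)"
    unfolding s_def by (intro sum.cong refl suminf_mult summable_heat_series assms(2))
  finally have s: "((\<lambda>t. s t x) has_real_derivative (\<Sum>z\<in>X. jump_matrix x z * s t z)) (at t)" .
  have "((\<lambda>t. exp (- total_rate * t) * s t x) has_real_derivative
      exp (- total_rate * t) * (\<Sum>z\<in>X. jump_matrix x z * s t z)
      - total_rate * exp (- total_rate * t) * s t x) (at t)"
    by (rule derivative_eq_intros s refl)+ (simp add: algebra_simps)
  also have "exp (- total_rate * t) * (\<Sum>z\<in>X. jump_matrix x z * s t z)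
      - total_rate * exp (- total_rate * t) * s t x
    = (\<Sum>z\<in>X. jump_matrix x z * heat_kernel t z y) - total_rate * heat_kernel t x y"
    by (simp add: heat_kernel_def s_def sum_distrib_left algebra_simps)
  also have "\<dots> = laplacian (\<lambda>z. heat_kernel t z y) x"
    using assms(1) by (simp add: jump_matrix_apply)
  finally show ?thesis by (simp add: heat_kernel_def s_def)
qed

lemma laplacian_deriv:
  assumes "\<And>z. z \<in> X \<Longrightarrow> ((\<lambda>t. u t z) has_real_derivative u' z) (at t within S)" and "x \<in> X"
  shows "((\<lambda>t. laplacian (u t) x) has_real_derivative laplacian u' x) (at t within S)"
  unfolding laplacian_def using assms
  by (auto intro!: DERIV_sum DERIV_cmult DERIV_diff)

lemma heat_deriv:
  assumes "x \<in> X"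
  shows "((\<lambda>t. heat t f x) has_real_derivative laplacian (heat t f) x) (at t within S)"
proof -
  have "((\<lambda>t. heat t f x) has_real_derivative (\<Sum>y\<in>X. laplacian (\<lambda>z. heat_kernel t z y) x * f y)) (at t within S)"
    unfolding heat_def using assms
    by (intro DERIV_sum DERIV_cmult_right DERIV_subset[OF heat_kernel_deriv]) auto
  also have "(\<Sum>y\<in>X. laplacian (\<lambda>z. heat_kernel t z y) x * f y) = laplacian (heat t f) x"
    unfolding laplacian_def heat_def sum_subtractf[symmetric] left_diff_distrib[symmetric]
      sum_distrib_right sum_distrib_left
    by (subst sum.swap) (simp add: mult.assoc)
  finally show ?thesis .
qed

text \<open>The time derivative of order \<open>k\<close> is the \<open>k\<close>-fold Laplacian in
  the first variable.\<close>

lemma times_differentiable_heat_kernel: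
  assumes "x \<in> X" "y \<in> X"
  shows "times_differentiable k S (\<lambda>t. heat_kernel t x y)"
proof -
  have "((\<lambda>t. (laplacian ^^ k) (\<lambda>z. heat_kernel t z y) x) has_real_derivative
      (laplacian ^^ Suc k) (\<lambda>z. heat_kernel t z y) x) (at t within S)" if "x \<in> X" for t k x
    using that
  proof (induction k arbitrary: x)
    case 0
    then show ?case using DERIV_subset[OF heat_kernel_deriv] assms by simp
  next
    case (Suc k)
    show ?case
      using laplacian_deriv[OF Suc.IH Suc.prems] by simp
  qed
  from times_differentiable_sequence[of S "\<lambda>k t. (laplacian ^^ k) (\<lambda>z. heat_kernel t z y) x" k 0, OF this]
  show ?thesis using assms by simp
qed

lemma heat_0: "x \<in> X \<Longrightarrow> heat 0 f x = f x"
  unfolding heat_def using finite_space by (simp add: heat_kernel_0 Int_absorb1)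

lemma heat_const: "x \<in> X \<Longrightarrow> heat t (\<lambda>_. c) x = c"
  using sum_heat_kernel[of x t] by (simp add: heat_def sum_distrib_right[symmetric])

lemma heat_add: "heat t (\<lambda>x. f x + g x) x = heat t f x + heat t g x"
  by (simp add: heat_def sum.distrib algebra_simps)

lemma heat_nonneg:
  "x \<in> X \<Longrightarrow> 0 \<le> t \<Longrightarrow> (\<And>y. y \<in> X \<Longrightarrow> 0 \<le> f y) \<Longrightarrow> 0 \<le> heat t f x"
  unfolding heat_def by (intro sum_nonneg mult_nonneg_nonneg heat_kernel_nonneg) auto

text \<open>Self-adjointness gives conservation of mass, and it moves the semigroup from a velocity
  onto a potential, where the gradient estimate applies.\<close>

lemma inner_heat: "inner (heat t f) g = inner f (heat t g)"
proof -
  have "inner (heat t f) g = (\<Sum>x\<in>X. \<Sum>y\<in>X. \<pi> x * heat_kernel t x y * f y * g x)"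
    by (simp add: inner_def heat_def sum_distrib_left sum_distrib_right mult_ac)
  also have "\<dots> = (\<Sum>x\<in>X. \<Sum>y\<in>X. \<pi> y * heat_kernel t y x * f y * g x)"
    using heat_kernel_reversible by (intro sum.cong) auto
  also have "\<dots> = (\<Sum>y\<in>X. \<Sum>x\<in>X. \<pi> y * heat_kernel t y x * f y * g x)"
    by (rule sum.swap)
  also have "\<dots> = inner f (heat t g)"
    by (simp add: inner_def heat_def sum_distrib_left mult_ac)
  finally show ?thesis .
qed

lemma heat_density:
  assumes "\<rho> \<in> densities X \<pi>" "0 \<le> t"
  shows "heat t \<rho> \<in> densities X \<pi>"
proof -
  have "inner (\<lambda>_. 1) (heat t \<rho>) = inner (\<lambda>_. 1) \<rho>"
    unfolding inner_heat[symmetric] by (simp add: inner_def heat_const)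
  then show ?thesis
    using assms by (auto simp: densities_def inner_def intro!: heat_nonneg)
qed

end

text \<open>Irreducibility is stated through closed sets instead of paths: a property holds
  everywhere as soon as it holds somewhere and is inherited along positive rates.\<close>

locale irreducible_markov_triple = markov_triple +
  assumes prob_pos: "x \<in> X \<Longrightarrow> 0 < \<pi> x"
    and irreducible: "S \<subseteq> X \<Longrightarrow> S \<noteq> {} \<Longrightarrow>
      (\<And>x y. x \<in> S \<Longrightarrow> y \<in> X \<Longrightarrow> 0 < Q x y \<Longrightarrow> y \<in> S) \<Longrightarrow> S = X"
begin

lemma rate_pos_sym: "x \<in> X \<Longrightarrow> y \<in> X \<Longrightarrow> 0 < Q x y \<Longrightarrow> 0 < Q y x"
  by (metis detailed_balance prob_pos zero_less_mult_pos zero_less_mult_iff less_asym)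

lemma heat_kernel_pos:
  assumes "x \<in> X" "y \<in> X" "0 < t"
  shows "0 < heat_kernel t x y"
proof -
  \<comment> \<open>The states that can reach \<open>y\<close> in some number of jumps. Passing to a
    successor \<open>z\<close> of \<open>x\<close> requires a jump back from \<open>z\<close> to
    \<open>x\<close>, which reversibility provides.\<close>
  have "{x \<in> X. \<exists>m. 0 < jump_power m x y} = X"
  proof (rule irreducible)
    have "0 < jump_power 0 y y" by simp
    then show "{x \<in> X. \<exists>m. 0 < jump_power m x y} \<noteq> {}" using assms(2) by blast
    fix x z assume x: "x \<in> {x \<in> X. \<exists>m. 0 < jump_power m x y}" and z: "z \<in> X" "0 < Q x z"
    then obtain m where m: "0 < jump_power m x y" and "x \<in> X" by blast
    have "x \<noteq> z" using z rate_diag by force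
    then have "0 < jump_matrix z x * jump_power m x y"
      using m rate_pos_sym[OF \<open>x \<in> X\<close> z] by (simp add: jump_matrix_def)
    also have "\<dots> \<le> jump_power (Suc m) z y"
      unfolding jump_power.simps using z \<open>x \<in> X\<close> finite_space assms(2)
      by (intro member_le_sum[of x X "\<lambda>u. jump_matrix z u * jump_power m u y"])
         (auto intro!: mult_nonneg_nonneg jump_matrix_nonneg jump_power_nonneg)
    finally show "z \<in> {x \<in> X. \<exists>m. 0 < jump_power m x y}" using z by blast
  qed auto
  then obtain m where "0 < jump_power m x y" using assms by blast
  then have "0 < (\<Sum>m. jump_power m x y / fact m * t ^ m)"
    using assms
    by (intro suminf_pos2[where i = m] summable_heat_series)
       (auto intro!: mult_nonneg_nonneg jump_power_nonneg divide_nonneg_nonneg)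
  then show ?thesis by (simp add: heat_kernel_def)
qed

lemma heat_pos:
  assumes "x \<in> X" "0 < t" and f: "f \<in> densities X \<pi>"
  shows "0 < heat t f x"
proof -
  have "\<exists>y\<in>X. f y \<noteq> 0" using f by (force simp: densities_def intro: ccontr)
  then obtain y where y: "y \<in> X" "0 < f y" using f by (force simp: densities_def)
  have "0 < heat_kernel t x y * f y" using heat_kernel_pos assms y by simp
  also have "\<dots> \<le> heat t f x"
    unfolding heat_def using assms y finite_space
    by (intro member_le_sum[of y X "\<lambda>y. heat_kernel t x y * f y"])
       (auto simp: densities_def intro!: mult_nonneg_nonneg heat_kernel_nonneg)
  finally show ?thesis .
qed

text \<open>Every summand vanishes, so the level set of \<open>f\<close> through \<open>x\<close> is
  closed under transitions and irreducibility makes it all of \<open>X\<close>.\<close>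

lemma dirichlet_eq_0D:
  assumes w: "\<And>x y. x \<in> X \<Longrightarrow> y \<in> X \<Longrightarrow> 0 < w x y" and 0: "dirichlet w f f = 0"
    and "x \<in> X" "y \<in> X"
  shows "f x = f y"
proof -
  have nn: "0 \<le> (f u - f v) * (f u - f v) * w u v * (\<pi> u * Q u v)" if "u \<in> X" "v \<in> X" for u v
    using that w[of u v] by (auto simp: prob_nonneg rate_nonneg' intro!: mult_nonneg_nonneg)
  have "(\<Sum>u\<in>X. \<Sum>v\<in>X. (f u - f v) * (f u - f v) * w u v * (\<pi> u * Q u v)) = 0"
    using 0 by (simp add: dirichlet_def)
  then have *: "(f u - f v) * (f u - f v) * w u v * (\<pi> u * Q u v) = 0" if "u \<in> X" "v \<in> X" for u v
    using that nn finite_space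
    by (subst (asm) sum_nonneg_eq_0_iff) (auto simp: sum_nonneg sum_nonneg_eq_0_iff)
  have "{z \<in> X. f z = f x} = X"
  proof (rule irreducible)
    fix u v assume "u \<in> {z \<in> X. f z = f x}" "v \<in> X" "0 < Q u v"
    then show "v \<in> {z \<in> X. f z = f x}"
      using *[of u v] w[of u v] prob_pos[of u] by auto
  qed (use assms in auto)
  then have "y \<in> {z \<in> X. f z = f x}" using assms(4) by simp
  then show ?thesis by simp
qed

end

section \<open>The gradient estimate\<close>

definition mean_weight :: "('a \<Rightarrow> real) \<Rightarrow> 'a \<Rightarrow> 'a \<Rightarrow> real" where
  "mean_weight \<rho> x y = log_mean (\<rho> x) (\<rho> y)"

context markov_triple
begin

lemma dirichlet_cong:
  assumes "\<And>x y. x \<in> X \<Longrightarrow> y \<in> X \<Longrightarrow> w x y = w' x y"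
    and "\<And>x. x \<in> X \<Longrightarrow> f x = f' x" and "\<And>x. x \<in> X \<Longrightarrow> g x = g' x"
  shows "dirichlet w f g = dirichlet w' f' g'"
  unfolding dirichlet_def using assms by (simp cong: sum.cong)

lemma has_integral_dirichlet:
  assumes "\<And>x. x \<in> X \<Longrightarrow> 0 \<le> \<rho> x"
  shows "((\<lambda>p. dirichlet (\<lambda>x y. geometric_mean p (\<rho> x) (\<rho> y)) f g) has_integral
      dirichlet (mean_weight \<rho>) f g) {0..1}"
  unfolding dirichlet_def mean_weight_def log_mean_eq using assms finite_space
  by (intro has_integral_mult_right has_integral_sum has_integral_mult_left integrable_integral
      geometric_mean_integrable) auto

text \<open>The kernel averages, so the minimum of \<open>f\<close> stays a lower bound. Time 0 is
  included because the interpolation in the gradient estimate starts there.\<close>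

lemma heat_pos':
  assumes "x \<in> X" "0 \<le> t" and f: "\<And>y. y \<in> X \<Longrightarrow> 0 < f y"
  shows "0 < heat t f x"
proof -
  define c where "c = Min (f ` X)"
  have c: "0 < c" "\<And>y. y \<in> X \<Longrightarrow> c \<le> f y"
    using f assms(1) finite_space by (subst c_def, subst Min_gr_iff, auto) (simp add: c_def)
  have "c = (\<Sum>y\<in>X. heat_kernel t x y * c)"
    using sum_heat_kernel[OF assms(1)] by (simp add: sum_distrib_right[symmetric])
  also have "\<dots> \<le> heat t f x"
    unfolding heat_def using assms c by (intro sum_mono mult_left_mono heat_kernel_nonneg) auto
  finally show ?thesis using c by simp
qed

end

text \<open>The right-hand side of \<open>bochner\<close> is the derivative at time \<open>0\<close> of the Dirichlet form of
  \<open>exp (- t * L) f\<close> with weights given by \<open>exp (t * L) \<rho>\<close>, \<open>L\<close> being the Laplacian.\<close>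

locale bochner_markov_triple = irreducible_markov_triple +
  fixes \<kappa> :: real
  assumes curvature_pos: "0 < \<kappa>"
    and bochner: "0 \<le> p \<Longrightarrow> p \<le> 1 \<Longrightarrow> (\<And>x. x \<in> X \<Longrightarrow> 0 < \<rho> x) \<Longrightarrow>
      2 * \<kappa> * dirichlet (\<lambda>x y. geometric_mean p (\<rho> x) (\<rho> y)) f f
      \<le> 1 / 2 * (\<Sum>x\<in>X. \<Sum>y\<in>X. geometric_mean p (\<rho> x) (\<rho> y) *
          ((f x - f y)\<^sup>2 * ((1 - p) * (laplacian \<rho> x / \<rho> x) + p * (laplacian \<rho> y / \<rho> y))
            - 2 * (f x - f y) * (laplacian f x - laplacian f y)) * (\<pi> x * Q x y))"
begin

text \<open>The interpolation \<open>\<Phi> r\<close> runs the density for time \<open>r\<close> and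
  the potential for the remaining time \<open>t - r\<close>. Its derivative is
  \<open>exp (- 2 * \<kappa> * r)\<close> times the difference of the two sides of
  \<open>bochner\<close>, so it is nondecreasing.\<close>

lemma gradient_estimate_weighted:
  assumes p: "0 \<le> p" "p \<le> 1" and "0 \<le> t" and \<rho>: "\<And>x. x \<in> X \<Longrightarrow> 0 < \<rho> x"
  shows "exp (2 * \<kappa> * t) * dirichlet (\<lambda>x y. geometric_mean p (\<rho> x) (\<rho> y)) (heat t f) (heat t f)
    \<le> dirichlet (\<lambda>x y. geometric_mean p (heat t \<rho> x) (heat t \<rho> y)) f f"
proof -
  define w where "w r x y = geometric_mean p (heat r \<rho> x) (heat r \<rho> y)" for r x y
  define u where "u r = heat (t - r) f" for r
  define w' where "w' r x y = w r x y * ((1 - p) * (laplacian (heat r \<rho>) x / heat r \<rho> x)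
      + p * (laplacian (heat r \<rho>) y / heat r \<rho> y))" for r x y
  define \<Phi> where "\<Phi> r = exp (- 2 * \<kappa> * r) * dirichlet (w r) (u r) (u r)" for r
  have u: "((\<lambda>r. u r x) has_real_derivative - laplacian (u r) x) (at r)" if "x \<in> X" for x r
  proof -
    have "((\<lambda>r. t - r) has_real_derivative - 1) (at r)" by (auto intro!: derivative_eq_intros)
    from DERIV_chain2[OF heat_deriv[OF that, of f] this] show ?thesis by (simp add: u_def)
  qed
  have w: "((\<lambda>r. w r x y) has_real_derivative w' r x y) (at r)"
    if "x \<in> X" "y \<in> X" "0 \<le> r" for x y r
  proof -
    have pos: "0 < heat r \<rho> x" "0 < heat r \<rho> y" using that \<rho> by (auto intro: heat_pos')
    note d = heat_deriv[OF that(1), of \<rho> r UNIV] heat_deriv[OF that(2), of \<rho> r UNIV]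
    have "((\<lambda>r. exp ((1 - p) * ln (heat r \<rho> x) + p * ln (heat r \<rho> y))) has_real_derivative
        exp ((1 - p) * ln (heat r \<rho> x) + p * ln (heat r \<rho> y)) *
        ((1 - p) * (laplacian (heat r \<rho>) x / heat r \<rho> x)
          + p * (laplacian (heat r \<rho>) y / heat r \<rho> y))) (at r)"
      using pos by (auto intro!: derivative_eq_intros d simp: mult.commute)
    moreover have "exp ((1 - p) * ln (heat r \<rho> x) + p * ln (heat r \<rho> y)) = w r x y"
      using pos by (simp add: w_def geometric_mean_def powr_def exp_add)
    \<comment> \<open>The representation by \<open>exp\<close> and \<open>ln\<close> holds while
      both values are positive, so the derivative is transferred to the weight through equality near
      \<open>r\<close>.\<close>
    moreover have "\<forall>\<^sub>F r in nhds r. exp ((1 - p) * ln (heat r \<rho> x) + p * ln (heat r \<rho> y)) = w r x y"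
    proof -
      have "((\<lambda>r. heat r \<rho> x) \<longlongrightarrow> heat r \<rho> x) (nhds r)" "((\<lambda>r. heat r \<rho> y) \<longlongrightarrow> heat r \<rho> y) (nhds r)"
        using d DERIV_isCont unfolding tendsto_nhds_iff isCont_def by blast+
      then have "\<forall>\<^sub>F r in nhds r. 0 < heat r \<rho> x \<and> 0 < heat r \<rho> y"
        using pos by (auto intro: eventually_conj order_tendstoD)
      then show ?thesis
        by eventually_elim (simp add: w_def geometric_mean_def powr_def exp_add)
    qed
    ultimately show ?thesis unfolding w'_def using DERIV_cong_ev by force
  qed
  have deriv: "\<exists>y. (\<Phi> has_real_derivative y) (at r) \<and> 0 \<le> y" if r: "0 \<le> r" for r
  proof -
    define D where "D = 1 / 2 * (\<Sum>x\<in>X. \<Sum>y\<in>X. w r x y *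
          ((u r x - u r y)\<^sup>2 * ((1 - p) * (laplacian (heat r \<rho>) x / heat r \<rho> x)
              + p * (laplacian (heat r \<rho>) y / heat r \<rho> y))
            - 2 * (u r x - u r y) * (laplacian (u r) x - laplacian (u r) y)) * (\<pi> x * Q x y))"
    have "((\<lambda>r. dirichlet (w r) (u r) (u r)) has_real_derivative D) (at r)"
      unfolding dirichlet_def D_def
    proof (intro DERIV_cmult DERIV_sum DERIV_cmult_right)
      fix x y assume xy: "x \<in> X" "y \<in> X"
      show "((\<lambda>r. (u r x - u r y) * (u r x - u r y) * w r x y) has_real_derivative
          w r x y * ((u r x - u r y)\<^sup>2 * ((1 - p) * (laplacian (heat r \<rho>) x / heat r \<rho> x)
              + p * (laplacian (heat r \<rho>) y / heat r \<rho> y))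
            - 2 * (u r x - u r y) * (laplacian (u r) x - laplacian (u r) y))) (at r)"
        by (rule derivative_eq_intros u w xy r refl)+
           (simp add: w'_def power2_eq_square algebra_simps)
    qed
    then have "(\<Phi> has_real_derivative exp (- 2 * \<kappa> * r) * (D - 2 * \<kappa> * dirichlet (w r) (u r) (u r))) (at r)"
      unfolding \<Phi>_def by (auto intro!: derivative_eq_intros simp: algebra_simps)
    moreover have "2 * \<kappa> * dirichlet (w r) (u r) (u r) \<le> D"
      unfolding D_def w_def using p r \<rho> by (intro bochner heat_pos') auto
    ultimately show ?thesis by (intro exI conjI) auto
  qed
  have "\<Phi> 0 \<le> \<Phi> t"
    by (rule DERIV_nonneg_imp_nondecreasing[OF \<open>0 \<le> t\<close>]) (rule deriv)
  moreover have "\<Phi> 0 = dirichlet (\<lambda>x y. geometric_mean p (\<rho> x) (\<rho> y)) (heat t f) (heat t f)"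
    unfolding \<Phi>_def w_def u_def by (simp add: heat_0 cong: dirichlet_cong)
  moreover have "\<Phi> t = exp (- 2 * \<kappa> * t) * dirichlet (\<lambda>x y. geometric_mean p (heat t \<rho> x) (heat t \<rho> y)) f f"
    unfolding \<Phi>_def w_def u_def by (simp add: heat_0 cong: dirichlet_cong)
  ultimately show ?thesis by (simp add: exp_minus field_simps)
qed

lemma gradient_estimate_pos:
  assumes "0 \<le> t" and \<rho>: "\<And>x. x \<in> X \<Longrightarrow> 0 < \<rho> x"
  shows "exp (2 * \<kappa> * t) * dirichlet (mean_weight \<rho>) (heat t f) (heat t f)
    \<le> dirichlet (mean_weight (heat t \<rho>)) f f"
proof (rule has_integral_le)
  show "((\<lambda>p. exp (2 * \<kappa> * t) * dirichlet (\<lambda>x y. geometric_mean p (\<rho> x) (\<rho> y)) (heat t f) (heat t f))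
      has_integral exp (2 * \<kappa> * t) * dirichlet (mean_weight \<rho>) (heat t f) (heat t f)) {0..1}"
    using \<rho> by (intro has_integral_mult_right has_integral_dirichlet) (auto intro: less_imp_le)
  show "((\<lambda>p. dirichlet (\<lambda>x y. geometric_mean p (heat t \<rho> x) (heat t \<rho> y)) f f)
      has_integral dirichlet (mean_weight (heat t \<rho>)) f f) {0..1}"
    using assms by (intro has_integral_dirichlet) (auto intro: less_imp_le heat_pos')
qed (use assms gradient_estimate_weighted in auto)

text \<open>A density with zeros is replaced by \<open>\<rho> + \<epsilon>\<close>: the left side
  only grows, by monotonicity of the mean, and on the right \<open>heat t \<rho>\<close> is already
  positive, where the mean is continuous as \<epsilon> tends to 0.\<close>

lemma gradient_estimate:
  assumes "0 < t" and \<rho>: "\<rho> \<in> densities X \<pi>"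
  shows "exp (2 * \<kappa> * t) * dirichlet (mean_weight \<rho>) (heat t f) (heat t f)
    \<le> dirichlet (mean_weight (heat t \<rho>)) f f"
proof -
  define g where "g \<epsilon> = dirichlet (mean_weight (\<lambda>x. heat t \<rho> x + \<epsilon>)) f f" for \<epsilon>
  have nn: "0 \<le> \<rho> x" if "x \<in> X" for x using \<rho> that by (simp add: densities_def)
  have "exp (2 * \<kappa> * t) * dirichlet (mean_weight \<rho>) (heat t f) (heat t f) \<le> g \<epsilon>" if "0 < \<epsilon>" for \<epsilon>
  proof -
    have "dirichlet (mean_weight \<rho>) (heat t f) (heat t f)
        \<le> dirichlet (mean_weight (\<lambda>x. \<rho> x + \<epsilon>)) (heat t f) (heat t f)"
      using nn that by (intro dirichlet_mono) (auto simp: mean_weight_def intro!: log_mean_mono)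
    then have "exp (2 * \<kappa> * t) * dirichlet (mean_weight \<rho>) (heat t f) (heat t f)
        \<le> exp (2 * \<kappa> * t) * dirichlet (mean_weight (\<lambda>x. \<rho> x + \<epsilon>)) (heat t f) (heat t f)"
      by (intro mult_left_mono) auto
    also have "\<dots> \<le> dirichlet (mean_weight (heat t (\<lambda>x. \<rho> x + \<epsilon>))) f f"
      using nn that assms(1) by (intro gradient_estimate_pos) (auto intro: add_nonneg_pos)
    also have "\<dots> = g \<epsilon>"
      unfolding g_def by (intro dirichlet_cong) (auto simp: mean_weight_def heat_add heat_const)
    finally show ?thesis .
  qed
  moreover have "continuous_on {0..1} g"
    unfolding g_def dirichlet_def mean_weight_def using heat_pos[OF _ assms]
    by (intro continuous_intros continuous_on_log_mean) (auto intro: add_pos_nonneg)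
  then have "(g \<longlongrightarrow> g 0) (at_right 0)"
    unfolding continuous_on_def by (force simp: at_within_Icc_at_right)
  ultimately have "exp (2 * \<kappa> * t) * dirichlet (mean_weight \<rho>) (heat t f) (heat t f) \<le> g 0"
    by (intro tendsto_lowerbound[where f = g and F = "at_right 0"])
       (auto simp: eventually_at_right_less intro: eventually_mono[OF eventually_at_right_less])
  then show ?thesis by (simp add: g_def)
qed

end

section \<open>Curves deformed by the heat flow\<close>

lemma continuous_on_x_ln_x: "continuous_on {0..} (\<lambda>x::real. x * ln x)"
proof -
  have "((\<lambda>x::real. x * ln x) \<longlongrightarrow> 0) (at_right 0)" by real_asymp
  then have "continuous (at 0 within {0..}) (\<lambda>x::real. x * ln x)"
    by (simp add: continuous_within at_within_Ici_at_right)
  moreover have "isCont (\<lambda>x::real. x * ln x) x" if "0 < x" for x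
    using that by (intro continuous_intros) auto
  ultimately show ?thesis
    unfolding continuous_on_eq_continuous_within
    by (metis atLeast_iff continuous_at_imp_continuous_at_within order_le_less)
qed

context markov_triple
begin

lemma continuous_on_entropy:
  assumes "\<And>x. x \<in> X \<Longrightarrow> continuous_on T (\<lambda>t. \<mu> t x)"
    and "\<And>t x. t \<in> T \<Longrightarrow> x \<in> X \<Longrightarrow> 0 \<le> \<mu> t x"
  shows "continuous_on T (\<lambda>t. entropy X \<pi> (\<mu> t))"
  unfolding entropy_def mult.assoc
proof (intro continuous_on_sum continuous_on_mult_left)
  fix x assume "x \<in> X"
  then show "continuous_on T (\<lambda>t. \<mu> t x * ln (\<mu> t x))"
    using assms by (intro continuous_on_compose2[OF continuous_on_x_ln_x]) auto
qed

text \<open>The derivative of \<open>x ln x\<close> is \<open>ln x + 1\<close>, and the summand 1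
  drops out because the velocity has mean zero.\<close>

lemma entropy_deriv:
  assumes "\<And>x. x \<in> X \<Longrightarrow> ((\<lambda>t. \<mu> t x) has_real_derivative v x) (at t)"
    and "\<And>x. x \<in> X \<Longrightarrow> 0 < \<mu> t x" and "inner (\<lambda>_. 1) v = 0"
  shows "((\<lambda>t. entropy X \<pi> (\<mu> t)) has_real_derivative inner v (\<lambda>x. ln (\<mu> t x))) (at t)"
proof -
  have "((\<lambda>t. entropy X \<pi> (\<mu> t)) has_real_derivative (\<Sum>x\<in>X. \<pi> x * (v x * ln (\<mu> t x) + v x))) (at t)"
    unfolding entropy_def mult.assoc
  proof (intro DERIV_sum DERIV_cmult)
    fix x assume "x \<in> X"
    then show "((\<lambda>t. \<mu> t x * ln (\<mu> t x)) has_real_derivative v x * ln (\<mu> t x) + v x) (at t)"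
      using assms(1)[of x] assms(2)[of x] by (auto intro!: derivative_eq_intros)
  qed
  also have "(\<Sum>x\<in>X. \<pi> x * (v x * ln (\<mu> t x) + v x)) = inner v (\<lambda>x. ln (\<mu> t x))"
    using assms(3) by (simp add: inner_def sum.distrib algebra_simps)
  finally show ?thesis .
qed

lemma inner_commute: "inner f g = inner g f"
  by (simp add: inner_def algebra_simps)

lemma inner_add: "inner f (\<lambda>x. g x + c * h x) = inner f g + c * inner f h"
  by (simp add: inner_def sum.distrib sum_distrib_left algebra_simps)

lemma inner_cong: "(\<And>x. x \<in> X \<Longrightarrow> f x = f' x) \<Longrightarrow> (\<And>x. x \<in> X \<Longrightarrow> g x = g' x) \<Longrightarrow> inner f g = inner f' g'"
  by (simp add: inner_def cong: sum.cong)

lemma mean_weight_sym: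
  "(\<And>x. x \<in> X \<Longrightarrow> 0 \<le> \<rho> x) \<Longrightarrow> x \<in> X \<Longrightarrow> y \<in> X \<Longrightarrow> mean_weight \<rho> x y = mean_weight \<rho> y x"
  by (simp add: mean_weight_def log_mean_commute)

text \<open>The heat flow is the gradient flow of the entropy.\<close>

lemma laplacian_eq_flux_ln:
  assumes "\<And>x. x \<in> X \<Longrightarrow> 0 < \<rho> x" and "x \<in> X"
  shows "laplacian \<rho> x = - flux (mean_weight \<rho>) (\<lambda>x. ln (\<rho> x)) x"
proof -
  have "(ln (\<rho> x) - ln (\<rho> y)) * mean_weight \<rho> x y * Q x y = (\<rho> x - \<rho> y) * Q x y" if "y \<in> X" for y
    using log_mean_mult_ln_diff[of "\<rho> x" "\<rho> y"] assms that by (simp add: mean_weight_def mult.commute)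
  then have "flux (mean_weight \<rho>) (\<lambda>x. ln (\<rho> x)) x = (\<Sum>y\<in>X. (\<rho> x - \<rho> y) * Q x y)"
    unfolding flux_def by (intro sum.cong) auto
  then show ?thesis
    unfolding laplacian_def by (simp add: sum_negf[symmetric] algebra_simps)
qed

lemma heat_curve_deriv:
  assumes "\<And>y. y \<in> X \<Longrightarrow> ((\<lambda>s. r s y) has_real_derivative r' y) (at s)"
    and "x \<in> X"
  shows "((\<lambda>s. heat (a + b * s) (r s) x) has_real_derivative
      heat (a + b * s) r' x + b * laplacian (heat (a + b * s) (r s)) x) (at s)"
proof -
  define k where "k = heat_kernel (a + b * s)"
  have "((\<lambda>s. heat (a + b * s) (r s) x) has_real_derivative
      (\<Sum>y\<in>X. k x y * r' y + b * (laplacian (\<lambda>z. k z y) x * r s y))) (at s)"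
    unfolding heat_def
  proof (rule DERIV_sum)
    fix y assume y: "y \<in> X"
    have "((\<lambda>s. a + b * s) has_real_derivative b) (at s)" by (auto intro!: derivative_eq_intros)
    from DERIV_chain2[OF heat_kernel_deriv[OF assms(2) y] this]
    have "((\<lambda>s. heat_kernel (a + b * s) x y) has_real_derivative laplacian (\<lambda>z. k z y) x * b) (at s)"
      by (simp add: k_def)
    from DERIV_mult[OF this assms(1)[OF y]]
    show "((\<lambda>s. heat_kernel (a + b * s) x y * r s y) has_real_derivative
        k x y * r' y + b * (laplacian (\<lambda>z. k z y) x * r s y)) (at s)"
      by (simp add: k_def algebra_simps)
  qed
  also have "(\<Sum>y\<in>X. k x y * r' y + b * (laplacian (\<lambda>z. k z y) x * r s y))
      = heat (a + b * s) r' x + b * (\<Sum>y\<in>X. laplacian (\<lambda>z. k z y) x * r s y)"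
    by (simp add: heat_def k_def sum.distrib sum_distrib_left)
  also have "(\<Sum>y\<in>X. laplacian (\<lambda>z. k z y) x * r s y) = laplacian (heat (a + b * s) (r s)) x"
    unfolding laplacian_def heat_def k_def sum_subtractf[symmetric] left_diff_distrib[symmetric]
      sum_distrib_right sum_distrib_left
    by (subst sum.swap) (simp add: mult.assoc)
  finally show ?thesis .
qed

lemma continuous_on_laplacian:
  "(\<And>x. x \<in> X \<Longrightarrow> continuous_on T (\<lambda>t. f t x)) \<Longrightarrow> x \<in> X \<Longrightarrow> continuous_on T (\<lambda>t. laplacian (f t) x)"
  unfolding laplacian_def by (intro continuous_intros) auto

lemma continuous_on_heat_affine:
  assumes "\<And>x. x \<in> X \<Longrightarrow> continuous_on T (\<lambda>t. f t x)" "x \<in> X"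
  shows "continuous_on T (\<lambda>t. heat (a + b * t) (f t) x)"
  unfolding heat_def
proof (intro continuous_intros assms(1))
  fix y assume y: "y \<in> X"
  have "continuous_on UNIV (\<lambda>t. heat_kernel t x y)"
    using heat_kernel_deriv[OF assms(2) y]
    by (intro DERIV_continuous_on) (auto intro: DERIV_subset)
  then show "continuous_on T (\<lambda>t. heat_kernel (a + b * t) x y)"
    by (rule continuous_on_compose2) (auto intro!: continuous_intros)
qed

end

context irreducible_markov_triple
begin

text \<open>On an irreducible chain with positive weights the kernel of the flux operator consists
  of the constants, so its range is all functions of mean zero. Multiplying the equation by \<pi>
  makes the matrix symmetric.\<close>

lemma flux_solvable:
  fixes w :: "'t::topological_space \<Rightarrow> 'a \<Rightarrow> 'a \<Rightarrow> real"
  assumes sym: "\<And>t x y. t \<in> T \<Longrightarrow> x \<in> X \<Longrightarrow> y \<in> X \<Longrightarrow> w t x y = w t y x"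
    and pos: "\<And>t x y. t \<in> T \<Longrightarrow> x \<in> X \<Longrightarrow> y \<in> X \<Longrightarrow> 0 < w t x y"
    and cont_w: "\<And>x y. x \<in> X \<Longrightarrow> y \<in> X \<Longrightarrow> continuous_on T (\<lambda>t. w t x y)"
    and cont_v: "\<And>x. x \<in> X \<Longrightarrow> continuous_on T (\<lambda>t. v t x)"
    and mean_0: "\<And>t. t \<in> T \<Longrightarrow> inner (\<lambda>_. 1) (v t) = 0"
  obtains \<psi> where "\<And>x. x \<in> X \<Longrightarrow> continuous_on T (\<lambda>t. \<psi> t x)"
    and "\<And>t x. t \<in> T \<Longrightarrow> x \<in> X \<Longrightarrow> flux (w t) (\<psi> t) x = v t x"
proof -
  text \<open>The rank one perturbation \<open>1\<close> removes the constants from the kernel.\<close>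
  define a where "a t x y = \<pi> x * ((if x = y then \<Sum>z\<in>X. w t x z * Q x z else 0) - w t x y * Q x y) + 1"
    for t x y
  have a: "(\<Sum>y\<in>X. a t x y * \<phi> y) = \<pi> x * flux (w t) \<phi> x + (\<Sum>y\<in>X. \<phi> y)"
    if "x \<in> X" for t x \<phi>
  proof -
    have "(\<Sum>y\<in>X. a t x y * \<phi> y) = (\<Sum>y\<in>X. (if x = y then \<pi> x * (\<Sum>z\<in>X. w t x z * Q x z) * \<phi> x else 0)
        - \<pi> x * (w t x y * Q x y * \<phi> y) + \<phi> y)"
      by (intro sum.cong) (auto simp: a_def algebra_simps)
    also have "\<dots> = \<pi> x * (\<Sum>z\<in>X. w t x z * Q x z) * \<phi> x - \<pi> x * (\<Sum>y\<in>X. w t x y * Q x y * \<phi> y) + (\<Sum>y\<in>X. \<phi> y)"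
      using that finite_space by (simp add: sum.distrib sum_subtractf sum_distrib_left)
    also have "\<dots> = \<pi> x * flux (w t) \<phi> x + (\<Sum>y\<in>X. \<phi> y)"
      unfolding flux_def by (simp add: left_diff_distrib sum_subtractf sum_distrib_left sum_distrib_right mult_ac right_diff_distrib)
    finally show ?thesis .
  qed
  have "\<exists>\<psi>. (\<forall>x\<in>X. continuous_on T (\<lambda>t. \<psi> t x)) \<and>
      (\<forall>t\<in>T. \<forall>x\<in>X. (\<Sum>y\<in>X. a t x y * \<psi> t y) = \<pi> x * v t x)"
  proof (rule positive_definite_system_solvable[OF finite_space])
    fix t x y assume "t \<in> T" "x \<in> X" "y \<in> X"
    then show "a t x y = a t y x"
      using sym[of t x y] detailed_balance[of x y] unfolding a_def by (simp add: algebra_simps)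
  next
    fix t \<phi> assume t: "t \<in> T" and nz: "\<exists>x\<in>X. \<phi> x \<noteq> (0::real)"
    have "(\<Sum>x\<in>X. \<Sum>y\<in>X. a t x y * \<phi> x * \<phi> y) = (\<Sum>x\<in>X. \<phi> x * (\<Sum>y\<in>X. a t x y * \<phi> y))"
      by (simp add: sum_distrib_left mult_ac)
    also have "\<dots> = (\<Sum>x\<in>X. \<phi> x * (\<pi> x * flux (w t) \<phi> x + (\<Sum>y\<in>X. \<phi> y)))"
      using a by (intro sum.cong) auto
    also have "\<dots> = inner \<phi> (flux (w t) \<phi>) + (\<Sum>y\<in>X. \<phi> y)\<^sup>2"
      by (simp add: inner_def distrib_left sum.distrib sum_distrib_right[symmetric] power2_eq_square mult_ac)
    also have "inner \<phi> (flux (w t) \<phi>) = dirichlet (w t) \<phi> \<phi>"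
      using sym[OF t] by (rule inner_flux)
    finally have eq: "(\<Sum>x\<in>X. \<Sum>y\<in>X. a t x y * \<phi> x * \<phi> y) = dirichlet (w t) \<phi> \<phi> + (\<Sum>y\<in>X. \<phi> y)\<^sup>2" .
    have d: "0 \<le> dirichlet (w t) \<phi> \<phi>" using pos[OF t] by (intro dirichlet_nonneg) (auto intro: less_imp_le)
    have "dirichlet (w t) \<phi> \<phi> + (\<Sum>y\<in>X. \<phi> y)\<^sup>2 \<noteq> 0"
    proof
      assume "dirichlet (w t) \<phi> \<phi> + (\<Sum>y\<in>X. \<phi> y)\<^sup>2 = 0"
      then have 0: "dirichlet (w t) \<phi> \<phi> = 0" "(\<Sum>y\<in>X. \<phi> y) = 0"
        using d by (auto simp: add_nonneg_eq_0_iff)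
      obtain x where x: "x \<in> X" "\<phi> x \<noteq> 0" using nz by blast
      have "(\<Sum>y\<in>X. \<phi> y) = (\<Sum>y\<in>X. \<phi> x)"
        using dirichlet_eq_0D[OF pos[OF t] 0(1) x(1)] by (intro sum.cong) auto
      then show False using 0(2) x finite_space by (auto simp: card_eq_0_iff)
    qed
    then show "0 < (\<Sum>x\<in>X. \<Sum>y\<in>X. a t x y * \<phi> x * \<phi> y)" using d eq by (simp add: add_nonneg_nonneg order_less_le)
  next
    fix x y assume "x \<in> X" "y \<in> X"
    then show "continuous_on T (\<lambda>t. a t x y)"
      unfolding a_def by (cases "x = y") (auto intro!: continuous_intros cont_w)
  next
    fix x assume "x \<in> X"
    then show "continuous_on T (\<lambda>t. \<pi> x * v t x)" by (intro continuous_intros cont_v)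
  qed
  then obtain \<psi> where \<psi>: "\<And>x. x \<in> X \<Longrightarrow> continuous_on T (\<lambda>t. \<psi> t x)"
    "\<And>t x. t \<in> T \<Longrightarrow> x \<in> X \<Longrightarrow> (\<Sum>y\<in>X. a t x y * \<psi> t y) = \<pi> x * v t x" by blast
  show thesis
  proof (rule that[of \<psi>])
    show "flux (w t) (\<psi> t) x = v t x" if t: "t \<in> T" and x: "x \<in> X" for t x
    proof -
      have e: "\<pi> y * flux (w t) (\<psi> t) y + (\<Sum>z\<in>X. \<psi> t z) = \<pi> y * v t y" if "y \<in> X" for y
        using \<psi>(2)[OF t that] a[OF that] by simp
      \<comment> \<open>Summing all equations, flux and velocity both drop out, so the sum of the
        potential is zero and the rank one term disappears from the equations.\<close>
      have "inner (\<lambda>_. 1) (flux (w t) (\<psi> t)) + (\<Sum>y\<in>X. \<Sum>z\<in>X. \<psi> t z) = inner (\<lambda>_. 1) (v t)"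
        unfolding inner_def using e
        by (simp add: sum.distrib[symmetric] del: sum_constant cong: sum.cong)
      then have "real (card X) * (\<Sum>z\<in>X. \<psi> t z) = 0"
        using mean_0[OF t] sum_flux[where w = "w t" and c = 1, OF sym[OF t]] by simp
      then have "(\<Sum>z\<in>X. \<psi> t z) = 0" using x finite_space by auto
      then show ?thesis using e[OF x] prob_pos[OF x] by simp
    qed
  qed (use \<psi>(1) in blast)
qed

text \<open>Serves three purposes: a constant curve with \<open>b = 1\<close> gives the heat flow
  itself, \<open>b = 0\<close> smooths a given curve, and \<open>b = h\<close> gives the deformation
  behind the variational inequality. The last conclusion splits the action into transported velocity
  and entropy production.\<close>

lemma heat_along_curve:
  assumes smooth: "\<And>x. x \<in> X \<Longrightarrow> piecewise_smooth_along B (\<lambda>s. r s x)"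
    and dens: "\<And>s. s \<in> {0..1} \<Longrightarrow> r s \<in> densities X \<pi>"
    and r': "\<And>s x. s \<in> {0..1} - B \<Longrightarrow> x \<in> X \<Longrightarrow> ((\<lambda>s. r s x) has_real_derivative r' s x) (at s)"
    and time: "\<And>s. s \<in> {0..1} \<Longrightarrow> 0 \<le> a + b * s" "\<And>s. s \<in> {0<..<1} \<Longrightarrow> 0 < a + b * s"
  obtains \<psi> h' where
    "solves_continuity_eq X Q (\<lambda>s. heat (a + b * s) (r s)) \<psi>"
    and "continuous_on ({0..1} - B)
        (\<lambda>s. dirichlet (mean_weight (heat (a + b * s) (r s))) (\<psi> s) (\<psi> s))"
    and "continuous_on ({0..1} - B) h'"
    and "(h' has_integral entropy X \<pi> (heat (a + b) (r 1)) - entropy X \<pi> (heat a (r 0))) {0..1}"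
    and "\<And>s. s \<in> {0..1} - B \<Longrightarrow> dirichlet (mean_weight (heat (a + b * s) (r s))) (\<psi> s) (\<psi> s)
        = inner (\<psi> s) (heat (a + b * s) (r' s)) - b * h' s"
proof -
  define \<mu> where "\<mu> s = heat (a + b * s) (r s)" for s
  define v where "v s x = heat (a + b * s) (r' s) x + b * laplacian (\<mu> s) x" for s x
  define h' where "h' s = inner (v s) (\<lambda>x. ln (\<mu> s x))" for s
  define T where "T = {0..1} - B"
  have "X \<noteq> {}" using prob_sum by auto
  then have B: "finite B" "{0, 1} \<subseteq> B" "B \<subseteq> {0..1}"
    using smooth by (auto simp: piecewise_smooth_along_def)
  have T: "0 < s" "s < 1" if "s \<in> T" for s using that B by (auto simp: T_def less_le)
  have cont_r: "continuous_on {0..1} (\<lambda>s. r s x)" if "x \<in> X" for x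
    using smooth[OF that] by (rule piecewise_smooth_along_continuous)
  have cont_r': "continuous_on T (\<lambda>s. r' s x)" if x: "x \<in> X" for x
  proof -
    obtain f' where f': "\<And>t. t \<in> {0..1} - B \<Longrightarrow> ((\<lambda>s. r s x) has_real_derivative f' t) (at t)"
      "continuous_on ({0..1} - B) f'"
      using piecewise_smooth_along_derivative[OF smooth[OF x]] by blast
    \<comment> \<open>\<open>r'\<close> is only assumed to be the derivative off \<open>B\<close>;
      uniqueness identifies it with the continuous one.\<close>
    have "f' s = r' s x" if "s \<in> T" for s
      using DERIV_unique[OF f'(1) r'[OF _ x], of s] that by (simp add: T_def)
    then show ?thesis using f'(2) continuous_on_cong[OF refl, of T f'] by (simp add: T_def)
  qed
  have dens_\<mu>: "\<mu> s \<in> densities X \<pi>" if "s \<in> {0..1}" for s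
    unfolding \<mu>_def using that by (intro heat_density dens time)
  have pos: "0 < \<mu> s x" if "s \<in> T" "x \<in> X" for s x
    unfolding \<mu>_def using that T[of s] by (intro heat_pos dens time) auto
  have cont_\<mu>: "continuous_on {0..1} (\<lambda>s. \<mu> s x)" if "x \<in> X" for x
    unfolding \<mu>_def using that by (intro continuous_on_heat_affine cont_r)
  have cont_\<mu>': "continuous_on T (\<lambda>s. \<mu> s x)" if "x \<in> X" for x
    using cont_\<mu>[OF that] by (rule continuous_on_subset) (auto simp: T_def)
  have cont_v: "continuous_on T (\<lambda>s. v s x)" if "x \<in> X" for x
    unfolding v_def using that
    by (intro continuous_intros continuous_on_heat_affine continuous_on_laplacian cont_r' cont_\<mu>')
  have deriv: "((\<lambda>s. \<mu> s x) has_real_derivative v s x) (at s)" if "s \<in> T" "x \<in> X" for s x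
    unfolding \<mu>_def v_def using that by (intro heat_curve_deriv r') (auto simp: T_def)
  have v0: "inner (\<lambda>_. 1) (v s) = 0" if s: "s \<in> T" for s
  proof -
    have "((\<lambda>s. inner (\<lambda>_. 1) (\<mu> s)) has_real_derivative inner (\<lambda>_. 1) (v s)) (at s)"
      unfolding inner_def using deriv[OF s] by (intro DERIV_sum DERIV_cmult) auto
    moreover have "\<forall>\<^sub>F u in nhds s. inner (\<lambda>_. 1) (\<mu> u) = 1"
      using eventually_nhds_in_open[of "{0<..<1}" s] T[OF s] dens_\<mu>
      by (auto elim!: eventually_mono simp: densities_def inner_def)
    ultimately have "((\<lambda>s. 1) has_real_derivative inner (\<lambda>_. 1) (v s)) (at s)"
      using DERIV_cong_ev by force
    then show ?thesis using DERIV_unique DERIV_const by blast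
  qed
  have w_sym: "mean_weight (\<mu> s) x y = mean_weight (\<mu> s) y x" if "s \<in> T" "x \<in> X" "y \<in> X" for s x y
    using that pos by (intro mean_weight_sym) (auto intro: less_imp_le)
  have cont_w: "continuous_on T (\<lambda>s. mean_weight (\<mu> s) x y)" if "x \<in> X" "y \<in> X" for x y
    unfolding mean_weight_def using that pos by (intro continuous_on_log_mean cont_\<mu>')
  obtain \<psi> where \<psi>: "\<And>x. x \<in> X \<Longrightarrow> continuous_on T (\<lambda>t. \<psi> t x)"
    and flux: "\<And>t x. t \<in> T \<Longrightarrow> x \<in> X \<Longrightarrow> flux (mean_weight (\<mu> t)) (\<psi> t) x = v t x"
    by (rule flux_solvable[of T "\<lambda>s. mean_weight (\<mu> s)" v])
       (use w_sym cont_w cont_v v0 pos in \<open>auto simp: mean_weight_def intro: log_mean_pos\<close>)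
  have h'_deriv: "((\<lambda>s. entropy X \<pi> (\<mu> s)) has_real_derivative h' s) (at s)" if "s \<in> T" for s
    unfolding h'_def using that by (intro entropy_deriv deriv pos v0)
  show thesis
  proof (rule that[of \<psi> h'])
    show "solves_continuity_eq X Q (\<lambda>s. heat (a + b * s) (r s)) \<psi>"
      unfolding solves_continuity_eq_def
    proof (intro exI[of _ B] conjI ballI)
      fix x assume x: "x \<in> X"
      show "piecewise_smooth_along B (\<lambda>s. heat (a + b * s) (r s) x)"
        unfolding piecewise_smooth_along_def
      proof (intro conjI ballI impI)
        fix c d assume cd: "c \<in> B" "d \<in> B" "c < d \<and> B \<inter> {c<..<d} = {}"
        have "times_differentiable k {c..d} (\<lambda>s. r s y)" if "y \<in> X" for k y
        proof -
          have "smooth_on_interval (\<lambda>s. r s y) c d"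
            using smooth[OF that] cd by (simp add: piecewise_smooth_along_def)
          then show ?thesis using cd by (simp add: smooth_on_interval_iff)
        qed
        then have "times_differentiable k {c..d} (\<lambda>s. heat (a + b * s) (r s) x)" for k
          unfolding heat_def using x
          by (intro times_differentiable_sum times_differentiable_mult
              times_differentiable_compose[OF times_differentiable_heat_kernel[where S = UNIV]]
              times_differentiable_affine) auto
        then show "smooth_on_interval (\<lambda>s. heat (a + b * s) (r s) x) c d"
          using cd by (simp add: smooth_on_interval_iff)
      qed (use B in auto)
    next
      fix s x assume s: "s \<in> {0..1} - B" and x: "x \<in> X"
      have "(\<Sum>y\<in>X. (\<psi> s y - \<psi> s x) * log_mean (\<mu> s x) (\<mu> s y) * Q x y)
          = - flux (mean_weight (\<mu> s)) (\<psi> s) x"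
        unfolding flux_def mean_weight_def sum_negf[symmetric]
        by (intro sum.cong refl) (simp add: algebra_simps)
      then have "v s x + (\<Sum>y\<in>X. (\<psi> s y - \<psi> s x) * log_mean (\<mu> s x) (\<mu> s y) * Q x y)
          = v s x - flux (mean_weight (\<mu> s)) (\<psi> s) x" by simp
      then show "\<exists>D. ((\<lambda>s. heat (a + b * s) (r s) x) has_real_derivative D) (at s) \<and>
          D + (\<Sum>y\<in>X. (\<psi> s y - \<psi> s x) *
            log_mean (heat (a + b * s) (r s) x) (heat (a + b * s) (r s) y) * Q x y) = 0"
        using deriv[of s x] flux[of s x] s x unfolding T_def \<mu>_def by auto
    qed
    show "continuous_on ({0..1} - B)
        (\<lambda>s. dirichlet (mean_weight (heat (a + b * s) (r s))) (\<psi> s) (\<psi> s))"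
      unfolding dirichlet_def \<mu>_def[symmetric] T_def[symmetric]
      by (intro continuous_intros \<psi> cont_w)
    show "continuous_on ({0..1} - B) h'"
      unfolding h'_def inner_def T_def[symmetric] using pos
      by (intro continuous_intros cont_v cont_\<mu>') (auto simp: less_imp_neq[THEN not_sym])
    show "(h' has_integral entropy X \<pi> (heat (a + b) (r 1)) - entropy X \<pi> (heat a (r 0))) {0..1}"
    proof -
      have "(h' has_integral entropy X \<pi> (\<mu> 1) - entropy X \<pi> (\<mu> 0)) {0..1}"
      proof (rule fundamental_theorem_of_calculus_interior_strong[OF B(1)])
        show "continuous_on {0..1} (\<lambda>s. entropy X \<pi> (\<mu> s))"
          using dens_\<mu> by (intro continuous_on_entropy cont_\<mu>) (auto simp: densities_def)
        show "((\<lambda>s. entropy X \<pi> (\<mu> s)) has_vector_derivative h' s) (at s)" if "s \<in> {0<..<1} - B" for s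
          using h'_deriv[of s] that
          by (auto simp: T_def has_real_derivative_iff_has_vector_derivative[symmetric])
      qed simp
      then show ?thesis by (simp add: \<mu>_def)
    qed
    show "dirichlet (mean_weight (heat (a + b * s) (r s))) (\<psi> s) (\<psi> s)
        = inner (\<psi> s) (heat (a + b * s) (r' s)) - b * h' s" if "s \<in> {0..1} - B" for s
    proof -
      have s: "s \<in> T" using that by (simp add: T_def)
      have "dirichlet (mean_weight (\<mu> s)) (\<psi> s) (\<psi> s) = inner (\<psi> s) (v s)"
        using inner_flux[where w = "mean_weight (\<mu> s)", OF w_sym[OF s], of "\<psi> s" "\<psi> s"]
          inner_cong[of "\<psi> s" "\<psi> s" "flux (mean_weight (\<mu> s)) (\<psi> s)" "v s"] flux[OF s] by simp
      also have "\<dots> = inner (\<psi> s) (heat (a + b * s) (r' s)) + b * inner (\<psi> s) (laplacian (\<mu> s))"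
        unfolding v_def by (rule inner_add)
      also have "inner (\<psi> s) (laplacian (\<mu> s)) = - inner (\<psi> s) (flux (mean_weight (\<mu> s)) (\<lambda>x. ln (\<mu> s x)))"
        unfolding inner_def sum_negf[symmetric] using laplacian_eq_flux_ln pos[OF s]
        by (intro sum.cong) auto
      also have "inner (\<psi> s) (flux (mean_weight (\<mu> s)) (\<lambda>x. ln (\<mu> s x)))
          = dirichlet (mean_weight (\<mu> s)) (\<psi> s) (\<lambda>x. ln (\<mu> s x))"
        using w_sym[OF s] by (rule inner_flux)
      also have "\<dots> = inner (\<lambda>x. ln (\<mu> s x)) (flux (mean_weight (\<mu> s)) (\<psi> s))"
        unfolding dirichlet_commute[of _ "\<psi> s"] using w_sym[OF s] by (rule inner_flux[symmetric])
      also have "\<dots> = h' s"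
        unfolding h'_def inner_commute[of "v s"] using flux[OF s] by (intro inner_cong) auto
      finally show ?thesis by (simp add: \<mu>_def)
    qed
  qed
qed

end

section \<open>Transport cost along transformed curves\<close>

lemma smooth_on_interval_cong:
  "(\<And>t. t \<in> {a..b} \<Longrightarrow> f t = g t) \<Longrightarrow> smooth_on_interval f a b \<Longrightarrow> smooth_on_interval g a b"
  by (simp add: smooth_on_interval_def)

text \<open>The action of an admissible pair may integrate a non-measurable function (the potential is
  arbitrary), for which \<open>nn_integral\<close> is the lower integral; hence the changes of
  variables are carried out on the simple functions below the integrand.\<close>

lemma nn_integral_pullback_le:
  fixes F :: "real \<Rightarrow> ennreal" and \<alpha> \<beta> j :: "real \<Rightarrow> real"
  assumes c: "0 < c" and [measurable]: "\<beta> \<in> borel_measurable borel" "j \<in> borel_measurable borel"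
      "R \<in> sets borel"
    and S: "\<And>s. s \<in> S \<Longrightarrow> 0 < j s" "\<And>s. s \<in> S \<Longrightarrow> \<beta> (\<alpha> s) = s"
    and R: "\<And>r. r \<in> R \<Longrightarrow> \<beta> r \<in> S" "\<And>r. r \<in> R \<Longrightarrow> \<alpha> (\<beta> r) = r"
    and substitution: "\<And>k. k \<in> borel_measurable borel \<Longrightarrow>
      (\<integral>\<^sup>+s. ennreal (j s) * k (\<alpha> s) * indicator S s \<partial>lborel) = (\<integral>\<^sup>+r. k r * indicator R r \<partial>lborel)"
  shows "(\<integral>\<^sup>+s. ennreal (c * j s) * F (\<alpha> s) * indicator S s \<partial>lborel)
    \<le> ennreal c * (\<integral>\<^sup>+r. F r * indicator R r \<partial>lborel)"
  unfolding nn_integral_def[of lborel "\<lambda>s. ennreal (c * j s) * F (\<alpha> s) * indicator S s"]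
proof (rule SUP_least, clarify)
  fix g assume g: "simple_function lborel g" "g \<le> (\<lambda>s. ennreal (c * j s) * F (\<alpha> s) * indicator S s)"
  have [measurable]: "g \<in> borel_measurable borel"
    using borel_measurable_simple_function[OF g(1)] by simp
  \<comment> \<open>The simple function carried to the target variable with the factor divided out:
    measurable by construction, and below \<open>F\<close> on \<open>R\<close>.\<close>
  define k where "k r = ennreal (1 / (c * j (\<beta> r))) * g (\<beta> r)" for r
  have [measurable]: "k \<in> borel_measurable borel" unfolding k_def by measurable
  have inv: "ennreal (1 / (c * j s)) * (ennreal (c * j s) * z) = z" if "s \<in> S" for s z
    using S(1)[OF that] c by (simp add: mult.assoc[symmetric] ennreal_mult[symmetric])
  have "g s = ennreal (j s) * (ennreal c * k (\<alpha> s)) * indicator S s" for s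
  proof (cases "s \<in> S")
    case True
    then have "ennreal (j s) * (ennreal c * k (\<alpha> s)) = ennreal (1 / (c * j s)) * (ennreal (c * j s) * g s)"
      using S[of s] c by (simp add: k_def ennreal_mult mult_ac)
    then show ?thesis using inv[OF True] True by simp
  next
    case False
    then show ?thesis using g(2) by (auto simp: le_fun_def dest!: spec[of _ s])
  qed
  then have "integral\<^sup>S lborel g = (\<integral>\<^sup>+s. ennreal (j s) * (ennreal c * k (\<alpha> s)) * indicator S s \<partial>lborel)"
    using nn_integral_eq_simple_integral[OF g(1)] by presburger
  also have "\<dots> = (\<integral>\<^sup>+r. ennreal c * k r * indicator R r \<partial>lborel)"
    by (rule substitution) measurable
  also have "\<dots> = ennreal c * (\<integral>\<^sup>+r. k r * indicator R r \<partial>lborel)"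
    by (simp add: nn_integral_cmult[symmetric] mult.assoc)
  also have "\<dots> \<le> ennreal c * (\<integral>\<^sup>+r. F r * indicator R r \<partial>lborel)"
  proof (intro mult_left_mono nn_integral_mono)
    fix r
    show "k r * indicator R r \<le> F r * indicator R r"
    proof (cases "r \<in> R")
      case True
      have "g (\<beta> r) \<le> ennreal (c * j (\<beta> r)) * F r"
        using g(2) R[OF True] by (auto simp: le_fun_def dest!: spec[of _ "\<beta> r"])
      then have "k r \<le> ennreal (1 / (c * j (\<beta> r))) * (ennreal (c * j (\<beta> r)) * F r)"
        unfolding k_def by (intro mult_left_mono) auto
      then show ?thesis using inv[OF R(1)[OF True]] True by simp
    qed simp
  qed simp
  finally show "integral\<^sup>S lborel g \<le> ennreal c * (\<integral>\<^sup>+r. F r * indicator R r \<partial>lborel)" .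
qed

lemma nn_integral_affine_pullback_le:
  fixes F :: "real \<Rightarrow> ennreal"
  assumes "0 < c" "m \<noteq> 0" and [measurable]: "R \<in> sets borel"
  shows "(\<integral>\<^sup>+s. ennreal (c * \<bar>m\<bar>) * F (a + m * s) * indicator R (a + m * s) \<partial>lborel)
    \<le> ennreal c * (\<integral>\<^sup>+r. F r * indicator R r \<partial>lborel)"
proof -
  have "(\<integral>\<^sup>+s. ennreal (c * \<bar>m\<bar>) * F (a + m * s) * indicator {s. a + m * s \<in> R} s \<partial>lborel)
    \<le> ennreal c * (\<integral>\<^sup>+r. F r * indicator R r \<partial>lborel)"
  proof (rule nn_integral_pullback_le[where \<beta> = "\<lambda>r. (r - a) / m"])
    fix k :: "real \<Rightarrow> ennreal" assume [measurable]: "k \<in> borel_measurable borel"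
    have "(\<integral>\<^sup>+r. k r * indicator R r \<partial>lborel)
        = ennreal \<bar>m\<bar> * (\<integral>\<^sup>+s. k (a + m * s) * indicator R (a + m * s) \<partial>lborel)"
      using assms by (intro nn_integral_real_affine) measurable
    also have "\<dots> = (\<integral>\<^sup>+s. ennreal \<bar>m\<bar> * (k (a + m * s) * indicator R (a + m * s)) \<partial>lborel)"
      by (rule nn_integral_cmult[symmetric]) measurable
    finally show "(\<integral>\<^sup>+s. ennreal \<bar>m\<bar> * k (a + m * s) * indicator {s. a + m * s \<in> R} s \<partial>lborel)
        = (\<integral>\<^sup>+r. k r * indicator R r \<partial>lborel)"
      by (simp add: mult.assoc indicator_def)
  qed (use assms in \<open>auto simp: field_simps\<close>)
  then show ?thesis by (simp add: indicator_def)
qed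

text \<open>Additivity of \<open>nn_integral\<close> needs measurable integrands, but each simple
  function below the integrand may be cut along the measurable sets \<open>A\<close> and
  \<open>B\<close>.\<close>

lemma nn_integral_split_le:
  fixes F :: "real \<Rightarrow> ennreal"
  assumes [measurable]: "A \<in> sets borel" "B \<in> sets borel" and "S \<subseteq> A \<union> B"
  shows "(\<integral>\<^sup>+s. F s * indicator S s \<partial>lborel)
    \<le> (\<integral>\<^sup>+s. F s * indicator A s \<partial>lborel) + (\<integral>\<^sup>+s. F s * indicator B s \<partial>lborel)"
  unfolding nn_integral_def[of lborel "\<lambda>s. F s * indicator S s"]
proof (rule SUP_least, clarify)
  fix g assume g: "simple_function lborel g" "g \<le> (\<lambda>s. F s * indicator S s)"
  have [measurable]: "g \<in> borel_measurable borel"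
    using borel_measurable_simple_function[OF g(1)] by simp
  have le: "g s \<le> F s * indicator S s" for s using g(2) by (simp add: le_fun_def)
  have "integral\<^sup>S lborel g = (\<integral>\<^sup>+s. g s \<partial>lborel)"
    using nn_integral_eq_simple_integral[OF g(1)] by simp
  also have "\<dots> \<le> (\<integral>\<^sup>+s. g s * indicator A s + g s * indicator B s \<partial>lborel)"
  proof (rule nn_integral_mono)
    fix s show "g s \<le> g s * indicator A s + g s * indicator B s"
      using le[of s] assms(3) by (cases "s \<in> S") (auto simp: indicator_def)
  qed
  also have "\<dots> = (\<integral>\<^sup>+s. g s * indicator A s \<partial>lborel) + (\<integral>\<^sup>+s. g s * indicator B s \<partial>lborel)"
    by (rule nn_integral_add) measurable
  also have "\<dots> \<le> (\<integral>\<^sup>+s. F s * indicator A s \<partial>lborel) + (\<integral>\<^sup>+s. F s * indicator B s \<partial>lborel)"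
  proof -
    have "g s \<le> F s" for s using le[of s] by (cases "s \<in> S") auto
    then show ?thesis by (intro add_mono nn_integral_mono mult_right_mono) auto
  qed
  finally show "integral\<^sup>S lborel g
    \<le> (\<integral>\<^sup>+s. F s * indicator A s \<partial>lborel) + (\<integral>\<^sup>+s. F s * indicator B s \<partial>lborel)" .
qed

text \<open>Near-minimisers of the two infima are chosen independently. Positive coefficients make
  both infima finite whenever the right-hand side is.\<close>

lemma ennreal_le_combination_Inf:
  fixes x :: ennreal
  assumes c: "0 < c" "0 < d"
    and le: "\<And>a b. a \<in> A \<Longrightarrow> b \<in> B \<Longrightarrow> x \<le> ennreal c * a + ennreal d * b"
  shows "x \<le> ennreal c * Inf A + ennreal d * Inf B"
proof (rule ennreal_le_epsilon)
  fix e :: real assume fin: "ennreal c * Inf A + ennreal d * Inf B < top" and e: "0 < e"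
  define \<epsilon> where "\<epsilon> = e / (c + d)"
  have \<epsilon>: "0 < \<epsilon>" using c e by (simp add: \<epsilon>_def)
  have *: "Inf S < Inf S + ennreal \<epsilon>" if "Inf S < top" for S :: "ennreal set"
    using that \<epsilon> by (cases "Inf S") (auto simp: ennreal_plus[symmetric] ennreal_less_iff simp del: ennreal_plus)
  have "Inf A < top" "Inf B < top" using fin c by (auto simp: ennreal_mult_less_top)
  then obtain a b where a: "a \<in> A" "a < Inf A + ennreal \<epsilon>" and b: "b \<in> B" "b < Inf B + ennreal \<epsilon>"
    using *[of A] *[of B] by (auto simp: Inf_less_iff)
  have "x \<le> ennreal c * (Inf A + ennreal \<epsilon>) + ennreal d * (Inf B + ennreal \<epsilon>)"
    using le[OF a(1) b(1)] a(2) b(2) by (meson add_mono dual_order.trans less_imp_le mult_left_mono zero_le)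
  also have "\<dots> = ennreal c * Inf A + ennreal d * Inf B + ennreal (c * \<epsilon> + d * \<epsilon>)"
    using c \<epsilon> by (simp add: ennreal_mult distrib_left add_ac)
  also have "c * \<epsilon> + d * \<epsilon> = e"
    using c by (simp add: \<epsilon>_def add_divide_distrib[symmetric] distrib_right[symmetric])
  finally show "x \<le> ennreal c * Inf A + ennreal d * Inf B + ennreal e" .
qed

section \<open>Admissible curves and upper bounds for the squared distance\<close>

context markov_triple
begin

abbreviation distance_sq :: "('a \<Rightarrow> real) \<Rightarrow> ('a \<Rightarrow> real) \<Rightarrow> ennreal" where
  "distance_sq \<equiv> transport_sq X Q \<pi>"

lemma action_eq:
  "action X Q \<pi> \<rho> \<psi> = ennreal (1 / 2) *
    (\<integral>\<^sup>+t. ennreal (2 * dirichlet (mean_weight (\<rho> t)) (\<psi> t) (\<psi> t)) * indicator {0..1} t \<partial>lborel)"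
  unfolding action_def dirichlet_def mean_weight_def
  by (simp add: power2_eq_square mult.assoc mult.commute[of "Q _ _"])

lemma flux_mean_weight:
  "(\<Sum>y\<in>X. (f y - f x) * log_mean (\<rho> x) (\<rho> y) * Q x y) = - flux (mean_weight \<rho>) f x"
  unfolding flux_def mean_weight_def sum_negf[symmetric]
  by (intro sum.cong refl) (simp add: algebra_simps)

lemma flux_scale: "flux w (\<lambda>x. c * f x) x = c * flux w f x"
  unfolding flux_def sum_distrib_left by (intro sum.cong refl) (simp add: algebra_simps)

lemma dirichlet_scale: "dirichlet w (\<lambda>x. c * f x) (\<lambda>x. c * f x) = c * c * dirichlet w f f"
  unfolding dirichlet_def sum_distrib_left by (intro sum.cong refl) (simp add: algebra_simps)

lemma solves_continuity_eqE:
  assumes "solves_continuity_eq X Q \<rho> \<psi>"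
  obtains B where "finite B" "{0, 1} \<subseteq> B" "B \<subseteq> {0..1}"
    and "\<And>x. x \<in> X \<Longrightarrow> piecewise_smooth_along B (\<lambda>t. \<rho> t x)"
    and "\<And>t x. t \<in> {0..1} - B \<Longrightarrow> x \<in> X \<Longrightarrow>
      ((\<lambda>s. \<rho> s x) has_real_derivative flux (mean_weight (\<rho> t)) (\<psi> t) x) (at t)"
proof -
  obtain B where B: "\<forall>x\<in>X. piecewise_smooth_along B (\<lambda>t. \<rho> t x)"
    "\<forall>t\<in>{0..1} - B. \<forall>x\<in>X. \<exists>D. ((\<lambda>s. \<rho> s x) has_real_derivative D) (at t) \<and>
      D + - flux (mean_weight (\<rho> t)) (\<psi> t) x = 0"
    using assms unfolding solves_continuity_eq_def flux_mean_weight by blast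
  have *: "finite B \<and> {0, 1} \<subseteq> B \<and> B \<subseteq> {0..1}"
  proof -
    obtain x where "x \<in> X" using prob_sum by fastforce
    then show ?thesis using B(1) by (simp add: piecewise_smooth_along_def)
  qed
  show thesis
  proof (rule that[of B])
    fix t x assume "t \<in> {0..1} - B" "x \<in> X"
    then obtain D where "((\<lambda>s. \<rho> s x) has_real_derivative D) (at t)"
      "D + - flux (mean_weight (\<rho> t)) (\<psi> t) x = 0"
      using B(2) by blast
    then show "((\<lambda>s. \<rho> s x) has_real_derivative flux (mean_weight (\<rho> t)) (\<psi> t) x) (at t)" by simp
  qed (use B(1) * in auto)
qed

lemma solves_continuity_eqI:
  assumes "\<And>x. x \<in> X \<Longrightarrow> piecewise_smooth_along B (\<lambda>t. \<rho> t x)"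
    and "\<And>t x. t \<in> {0..1} - B \<Longrightarrow> x \<in> X \<Longrightarrow>
      ((\<lambda>s. \<rho> s x) has_real_derivative flux (mean_weight (\<rho> t)) (\<psi> t) x) (at t)"
  shows "solves_continuity_eq X Q \<rho> \<psi>"
  unfolding solves_continuity_eq_def flux_mean_weight
proof (intro exI[of _ B] conjI ballI)
  fix t x assume "t \<in> {0..1} - B" "x \<in> X"
  then show "\<exists>D. ((\<lambda>s. \<rho> s x) has_real_derivative D) (at t) \<and> D + - flux (mean_weight (\<rho> t)) (\<psi> t) x = 0"
    using assms(2) by (intro exI[of _ "flux (mean_weight (\<rho> t)) (\<psi> t) x"]) simp
qed (use assms(1) in blast)

lemma transport_sq_le_action:
  assumes "\<And>s. s \<in> {0..1} \<Longrightarrow> \<mu> s \<in> densities X \<pi>" "solves_continuity_eq X Q \<mu> \<psi>"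
    and "\<And>x. x \<in> X \<Longrightarrow> \<mu> 0 x = \<sigma> x" "\<And>x. x \<in> X \<Longrightarrow> \<mu> 1 x = \<rho> x"
  shows "distance_sq \<sigma> \<rho> \<le> action X Q \<pi> \<mu> \<psi>"
  unfolding transport_sq_def using assms by (intro Inf_lower) blast

lemma transport_sq_le_integral:
  assumes dens: "\<And>s. s \<in> {0..1} \<Longrightarrow> \<mu> s \<in> densities X \<pi>" and "solves_continuity_eq X Q \<mu> \<psi>"
    and "\<And>x. x \<in> X \<Longrightarrow> \<mu> 0 x = \<sigma> x" "\<And>x. x \<in> X \<Longrightarrow> \<mu> 1 x = \<rho> x"
    and B: "finite B" and I: "(k has_integral I) {0..1}"
    and le: "\<And>s. s \<in> {0..1} - B \<Longrightarrow> dirichlet (mean_weight (\<mu> s)) (\<psi> s) (\<psi> s) \<le> k s"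
  shows "distance_sq \<sigma> \<rho> \<le> ennreal I" "0 \<le> I"
proof -
  \<comment> \<open>On \<open>B\<close> nothing is known about \<open>k\<close>; resetting it there
    makes the majorant nonnegative on the whole interval, as the passage from the gauge integral to
    \<open>nn_integral\<close> requires. The factor 2 cancels the \<open>1 / 2\<close> in the
    action.\<close>
  define k' where "k' s = (if s \<in> B then 0 else 2 * k s)" for s
  have nn: "0 \<le> dirichlet (mean_weight (\<mu> s)) (\<psi> s) (\<psi> s)" if "s \<in> {0..1}" for s
    using dens[OF that]
    by (intro dirichlet_nonneg) (auto simp: mean_weight_def densities_def intro!: log_mean_nonneg)
  have k'_nonneg: "0 \<le> k' s" if "s \<in> {0..1}" for s
    using nn[OF that] le[of s] that by (auto simp: k'_def)
  have "(k' has_integral 2 * I) {0..1}"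
    using has_integral_mult_right[OF I, of 2]
    by (rule has_integral_spike_finite[OF B, rotated]) (simp add: k'_def)
  then have k': "(\<integral>\<^sup>+s. ennreal (k' s) * indicator {0..1} s \<partial>lborel) = ennreal (2 * I)" and "0 \<le> 2 * I"
    using k'_nonneg nn_integral_has_integral_lebesgue' has_integral_nonneg by blast+
  then show "0 \<le> I" by simp
  have "distance_sq \<sigma> \<rho> \<le> action X Q \<pi> \<mu> \<psi>"
    using assms(1-4) by (rule transport_sq_le_action)
  also have "\<dots> \<le> ennreal (1 / 2) * (\<integral>\<^sup>+s. ennreal (k' s) * indicator {0..1} s \<partial>lborel)"
    unfolding action_eq
  proof (intro mult_left_mono nn_integral_mono_AE)
    have "AE s in lborel. s \<notin> B"
      using B by (intro AE_not_in finite_imp_null_set_lborel)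
    then show "AE s in lborel. ennreal (2 * dirichlet (mean_weight (\<mu> s)) (\<psi> s) (\<psi> s)) * indicator {0..1} s
        \<le> ennreal (k' s) * indicator {0..1} s"
      by eventually_elim (auto simp: k'_def indicator_def le intro!: ennreal_leI)
  qed simp
  also have "\<dots> = ennreal I"
    unfolding k' using \<open>0 \<le> I\<close> by (subst ennreal_mult[symmetric]) auto
  finally show "distance_sq \<sigma> \<rho> \<le> ennreal I" .
qed

text \<open>The second curve is traversed backwards, which combines the triangle inequality with the
  symmetry of the metric.\<close>

lemma transport_sq_triangle:
  assumes \<theta>: "0 < \<theta>" "\<theta> < 1"
  shows "distance_sq \<sigma> \<tau> \<le> ennreal (1 / \<theta>) * distance_sq \<sigma> \<rho> + ennreal (1 / (1 - \<theta>)) * distance_sq \<tau> \<rho>"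
proof -
  have main: "distance_sq \<sigma> \<tau> \<le> ennreal (1 / \<theta>) * action X Q \<pi> \<rho>1 \<psi>1 + ennreal (1 / (1 - \<theta>)) * action X Q \<pi> \<rho>2 \<psi>2"
    if 1: "\<forall>t\<in>{0..1}. \<rho>1 t \<in> densities X \<pi>" "solves_continuity_eq X Q \<rho>1 \<psi>1"
        "\<forall>x\<in>X. \<rho>1 0 x = \<sigma> x" "\<forall>x\<in>X. \<rho>1 1 x = \<rho> x"
      and 2: "\<forall>t\<in>{0..1}. \<rho>2 t \<in> densities X \<pi>" "solves_continuity_eq X Q \<rho>2 \<psi>2"
        "\<forall>x\<in>X. \<rho>2 0 x = \<tau> x" "\<forall>x\<in>X. \<rho>2 1 x = \<rho> x"
    for \<rho>1 \<psi>1 \<rho>2 \<psi>2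
  proof -
    obtain B1 where fin1: "finite B1" "{0, 1} \<subseteq> B1" "B1 \<subseteq> {0..1}"
      and B1: "\<And>x. x \<in> X \<Longrightarrow> piecewise_smooth_along B1 (\<lambda>t. \<rho>1 t x)"
        "\<And>t x. t \<in> {0..1} - B1 \<Longrightarrow> x \<in> X \<Longrightarrow>
          ((\<lambda>s. \<rho>1 s x) has_real_derivative flux (mean_weight (\<rho>1 t)) (\<psi>1 t) x) (at t)"
      using 1(2) by (rule solves_continuity_eqE) (blast intro: that)
    obtain B2 where fin2: "finite B2" "{0, 1} \<subseteq> B2" "B2 \<subseteq> {0..1}"
      and B2: "\<And>x. x \<in> X \<Longrightarrow> piecewise_smooth_along B2 (\<lambda>t. \<rho>2 t x)"
        "\<And>t x. t \<in> {0..1} - B2 \<Longrightarrow> x \<in> X \<Longrightarrow>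
          ((\<lambda>s. \<rho>2 s x) has_real_derivative flux (mean_weight (\<rho>2 t)) (\<psi>2 t) x) (at t)"
      using 2(2) by (rule solves_continuity_eqE) (blast intro: that)
    note fin = fin1 fin2
    \<comment> \<open>The slopes of the two time changes. Squared speed contributes
      \<open>m1\<^sup>2\<close> and the change of variables divides by \<open>m1\<close>, so each
      action is multiplied by its slope.\<close>
    define m1 where "m1 = 1 / \<theta>"
    define m2 where "m2 = 1 / (1 - \<theta>)"
    have m: "0 < m1" "0 < m2" "m1 * \<theta> = 1" "m2 * (1 - \<theta>) = 1" using \<theta> by (auto simp: m1_def m2_def)
    define \<alpha>1 where "\<alpha>1 s = 0 + m1 * s" for s
    define \<alpha>2 where "\<alpha>2 s = m2 + (- m2) * s" for s
    have \<alpha>1_less: "\<alpha>1 s < \<alpha>1 t \<longleftrightarrow> s < t" and \<alpha>2_less: "\<alpha>2 s < \<alpha>2 t \<longleftrightarrow> t < s" for s t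
      using m by (auto simp: \<alpha>1_def \<alpha>2_def)
    have \<alpha>1_le: "\<alpha>1 s \<le> \<alpha>1 t \<longleftrightarrow> s \<le> t" and \<alpha>2_le: "\<alpha>2 s \<le> \<alpha>2 t \<longleftrightarrow> t \<le> s" for s t
      using \<alpha>1_less \<alpha>2_less by (metis linorder_not_le)+
    have \<alpha>_ends: "\<alpha>1 0 = 0" "\<alpha>1 \<theta> = 1" "\<alpha>2 \<theta> = 1" "\<alpha>2 1 = 0"
      using m by (auto simp: \<alpha>1_def \<alpha>2_def algebra_simps)
    define \<beta>1 where "\<beta>1 r = \<theta> * r" for r
    define \<beta>2 where "\<beta>2 r = 1 - (1 - \<theta>) * r" for r
    have inv: "\<alpha>1 (\<beta>1 r) = r" "\<beta>1 (\<alpha>1 r) = r" "\<alpha>2 (\<beta>2 r) = r" "\<beta>2 (\<alpha>2 r) = r" for r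
      using \<theta> by (auto simp: \<alpha>1_def \<beta>1_def \<alpha>2_def \<beta>2_def m1_def m2_def field_simps)
    define \<mu> where "\<mu> s = (if s \<le> \<theta> then \<rho>1 (\<alpha>1 s) else \<rho>2 (\<alpha>2 s))" for s
    define \<psi> where "\<psi> s x = (if s \<le> \<theta> then m1 * \<psi>1 (\<alpha>1 s) x else - m2 * \<psi>2 (\<alpha>2 s) x)" for s x
    define B where "B = \<beta>1 ` B1 \<union> \<beta>2 ` B2"
    have B_iff: "s \<in> B \<longleftrightarrow> \<alpha>1 s \<in> B1 \<or> \<alpha>2 s \<in> B2" for s
      unfolding B_def image_iff Un_iff using inv by metis
    have \<alpha>1_range: "\<alpha>1 s \<in> {0..1}" if "0 \<le> s" "s \<le> \<theta>" for s
      using that \<alpha>1_le[of 0 s] \<alpha>1_le[of s \<theta>] \<alpha>_ends by simp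
    have \<alpha>2_range: "\<alpha>2 s \<in> {0..1}" if "\<theta> \<le> s" "s \<le> 1" for s
      using that \<alpha>2_le[of s \<theta>] \<alpha>2_le[of 1 s] \<alpha>_ends by simp
    \<comment> \<open>At \<theta> both formulas agree, since both curves end in \<rho>.\<close>
    have \<mu>2: "\<mu> s x = \<rho>2 (\<alpha>2 s) x" if "\<theta> \<le> s" "x \<in> X" for s x
      using that 1(4) 2(4) \<alpha>_ends by (cases "s = \<theta>") (auto simp: \<mu>_def)
    have B01: "finite B" "{0, 1} \<subseteq> B" "B \<subseteq> {0..1}" "\<theta> \<in> B"
    proof -
      show "finite B" using fin by (simp add: B_def)
      show "{0, 1} \<subseteq> B" "\<theta> \<in> B" using fin \<alpha>_ends by (auto simp: B_iff)
      have "\<beta>1 r \<in> {0..1}" "\<beta>2 r \<in> {0..1}" if "r \<in> {0..1}" for r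
        using that \<theta> by (auto simp: \<beta>1_def \<beta>2_def mult_le_one)
      then show "B \<subseteq> {0..1}" using fin by (auto simp: B_def)
    qed
    have solves: "solves_continuity_eq X Q \<mu> \<psi>"
    proof (rule solves_continuity_eqI[of B])
      fix x assume x: "x \<in> X"
      show "piecewise_smooth_along B (\<lambda>s. \<mu> s x)"
        unfolding piecewise_smooth_along_def
      proof (intro conjI ballI impI)
        fix c d assume "c \<in> B" "d \<in> B" and cd: "c < d \<and> B \<inter> {c<..<d} = {}"
        then have cd01: "0 \<le> c" "d \<le> 1" "c < d" using B01 by auto
        have \<alpha>B: "\<alpha>1 s \<notin> B1" "\<alpha>2 s \<notin> B2" if "c < s" "s < d" for s
          using cd that B_iff by auto
        show "smooth_on_interval (\<lambda>s. \<mu> s x) c d"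
        proof (cases "d \<le> \<theta>")
          case True
          have "smooth_on_interval (\<lambda>s. \<rho>1 (\<alpha>1 s) x) c d"
          proof (rule piecewise_smooth_along_compose[OF B1(1)[OF x] cd01(3), where c = "\<alpha>1 c" and d = "\<alpha>1 d"])
            show "0 \<le> \<alpha>1 c" "\<alpha>1 d \<le> 1" using True cd01 \<alpha>1_range[of c] \<alpha>1_range[of d] by auto
            show "\<alpha>1 c < \<alpha>1 d" using cd01 \<alpha>1_less by simp
            show "B1 \<inter> {\<alpha>1 c<..<\<alpha>1 d} = {}"
              using \<alpha>B(1) inv \<alpha>1_less by (metis (no_types, lifting) disjoint_iff greaterThanLessThan_iff)
            show "times_differentiable k {c..d} \<alpha>1" for k
              unfolding \<alpha>1_def by (rule times_differentiable_affine)
            show "\<alpha>1 ` {c..d} \<subseteq> {\<alpha>1 c..\<alpha>1 d}" using \<alpha>1_le by auto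
          qed
          then show ?thesis
            by (rule smooth_on_interval_cong[rotated]) (use True in \<open>auto simp: \<mu>_def\<close>)
        next
          case False
          \<comment> \<open>The junction \<theta> is a break point, so no cell straddles it.\<close>
          then have "\<theta> \<le> c" using cd B01(4) by (meson disjoint_iff greaterThanLessThan_iff linorder_not_le)
          have "smooth_on_interval (\<lambda>s. \<rho>2 (\<alpha>2 s) x) c d"
          proof (rule piecewise_smooth_along_compose[OF B2(1)[OF x] cd01(3), where c = "\<alpha>2 d" and d = "\<alpha>2 c"])
            show "0 \<le> \<alpha>2 d" "\<alpha>2 c \<le> 1" using \<open>\<theta> \<le> c\<close> cd01 \<alpha>2_range[of c] \<alpha>2_range[of d] by auto
            show "\<alpha>2 d < \<alpha>2 c" using cd01 \<alpha>2_less by simp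
            show "B2 \<inter> {\<alpha>2 d<..<\<alpha>2 c} = {}"
              using \<alpha>B(2) inv \<alpha>2_less by (metis (no_types, lifting) disjoint_iff greaterThanLessThan_iff)
            show "times_differentiable k {c..d} \<alpha>2" for k
              unfolding \<alpha>2_def by (rule times_differentiable_affine)
            show "\<alpha>2 ` {c..d} \<subseteq> {\<alpha>2 d..\<alpha>2 c}" using \<alpha>2_le by auto
          qed
          then show ?thesis
            by (rule smooth_on_interval_cong[rotated]) (use \<open>\<theta> \<le> c\<close> \<mu>2[OF _ x] in auto)
        qed
      qed (use B01 in auto)
    next
      fix s x assume s: "s \<in> {0..1} - B" and x: "x \<in> X"
      then have "s \<noteq> \<theta>" "\<alpha>1 s \<notin> B1" "\<alpha>2 s \<notin> B2" using B01 B_iff by auto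
      show "((\<lambda>s. \<mu> s x) has_real_derivative flux (mean_weight (\<mu> s)) (\<psi> s) x) (at s)"
      proof (cases "s < \<theta>")
        case True
        then have "\<alpha>1 s \<in> {0..1} - B1" using \<alpha>1_range[of s] s \<open>\<alpha>1 s \<notin> B1\<close> by auto
        moreover have "(\<alpha>1 has_real_derivative m1) (at s)"
          unfolding \<alpha>1_def by (auto intro!: derivative_eq_intros)
        ultimately have "((\<lambda>s. \<rho>1 (\<alpha>1 s) x) has_real_derivative
            flux (mean_weight (\<rho>1 (\<alpha>1 s))) (\<psi>1 (\<alpha>1 s)) x * m1) (at s)"
          using DERIV_chain2[OF B1(2)[OF _ x]] by blast
        then have "((\<lambda>s. \<mu> s x) has_real_derivative
            flux (mean_weight (\<rho>1 (\<alpha>1 s))) (\<psi>1 (\<alpha>1 s)) x * m1) (at s)"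
          by (rule has_field_derivative_transform_within_open[where S = "{..<\<theta>}"])
             (use True in \<open>auto simp: \<mu>_def\<close>)
        moreover have "\<mu> s = \<rho>1 (\<alpha>1 s)" "\<psi> s = (\<lambda>x. m1 * \<psi>1 (\<alpha>1 s) x)"
          using True by (auto simp: \<mu>_def \<psi>_def)
        ultimately show ?thesis by (simp add: flux_scale mult.commute)
      next
        case False
        then have "\<theta> < s" using \<open>s \<noteq> \<theta>\<close> by simp
        then have "\<alpha>2 s \<in> {0..1} - B2" using \<alpha>2_range[of s] s \<open>\<alpha>2 s \<notin> B2\<close> by auto
        moreover have "(\<alpha>2 has_real_derivative - m2) (at s)"
          unfolding \<alpha>2_def by (auto intro!: derivative_eq_intros)
        ultimately have "((\<lambda>s. \<rho>2 (\<alpha>2 s) x) has_real_derivative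
            flux (mean_weight (\<rho>2 (\<alpha>2 s))) (\<psi>2 (\<alpha>2 s)) x * - m2) (at s)"
          using DERIV_chain2[OF B2(2)[OF _ x]] by blast
        then have "((\<lambda>s. \<mu> s x) has_real_derivative
            flux (mean_weight (\<rho>2 (\<alpha>2 s))) (\<psi>2 (\<alpha>2 s)) x * - m2) (at s)"
          by (rule has_field_derivative_transform_within_open[where S = "{\<theta><..}"])
             (use \<open>\<theta> < s\<close> in \<open>auto simp: \<mu>_def\<close>)
        moreover have "\<mu> s = \<rho>2 (\<alpha>2 s)" "\<psi> s = (\<lambda>x. - m2 * \<psi>2 (\<alpha>2 s) x)"
          using \<open>\<theta> < s\<close> by (auto simp: \<mu>_def \<psi>_def)
        ultimately show ?thesis by (simp only: flux_scale mult.commute)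
      qed
    qed
    have dens: "\<mu> s \<in> densities X \<pi>" if "s \<in> {0..1}" for s
      using that 1(1) 2(1) \<alpha>1_range[of s] \<alpha>2_range[of s] by (auto simp: \<mu>_def)
    define F1 where "F1 r = ennreal (2 * dirichlet (mean_weight (\<rho>1 r)) (\<psi>1 r) (\<psi>1 r))" for r
    define F2 where "F2 r = ennreal (2 * dirichlet (mean_weight (\<rho>2 r)) (\<psi>2 r) (\<psi>2 r))" for r
    define F where "F r = ennreal (2 * dirichlet (mean_weight (\<mu> r)) (\<psi> r) (\<psi> r))" for r
    have F1: "F s = ennreal (m1 * \<bar>m1\<bar>) * F1 (0 + m1 * s)" if "s \<le> \<theta>" for s
    proof -
      have "\<mu> s = \<rho>1 (\<alpha>1 s)" "\<psi> s = (\<lambda>x. m1 * \<psi>1 (\<alpha>1 s) x)"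
        using that by (auto simp: \<mu>_def \<psi>_def)
      then show ?thesis
        unfolding F_def F1_def using m
        by (subst ennreal_mult'[symmetric]) (simp_all add: dirichlet_scale \<alpha>1_def mult_ac)
    qed
    have F2: "F s = ennreal (m2 * \<bar>- m2\<bar>) * F2 (m2 + (- m2) * s)" if "\<theta> < s" for s
    proof -
      have "\<mu> s = \<rho>2 (\<alpha>2 s)" "\<psi> s = (\<lambda>x. - m2 * \<psi>2 (\<alpha>2 s) x)"
        using that by (auto simp: \<mu>_def \<psi>_def)
      then show ?thesis
        unfolding F_def F2_def using m dirichlet_scale[of _ "- m2"]
        by (subst ennreal_mult'[symmetric]) (simp_all add: \<alpha>2_def mult_ac)
    qed
    have "distance_sq \<sigma> \<tau> \<le> action X Q \<pi> \<mu> \<psi>"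
      using dens solves 1(3) 2(3) \<theta> \<alpha>_ends
      by (intro transport_sq_le_action) (auto simp: \<mu>_def)
    also have "\<dots> = ennreal (1 / 2) * (\<integral>\<^sup>+s. F s * indicator {0..1} s \<partial>lborel)"
      unfolding action_eq F_def ..
    also have "(\<integral>\<^sup>+s. F s * indicator {0..1} s \<partial>lborel)
        \<le> (\<integral>\<^sup>+s. F s * indicator {0..\<theta>} s \<partial>lborel) + (\<integral>\<^sup>+s. F s * indicator {\<theta><..1} s \<partial>lborel)"
      by (rule nn_integral_split_le) (use \<theta> in auto)
    also have "(\<integral>\<^sup>+s. F s * indicator {0..\<theta>} s \<partial>lborel)
        \<le> (\<integral>\<^sup>+s. ennreal (m1 * \<bar>m1\<bar>) * F1 (0 + m1 * s) * indicator {0..1} (0 + m1 * s) \<partial>lborel)"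
      using F1 \<alpha>1_range unfolding \<alpha>1_def by (intro nn_integral_mono) (auto simp: indicator_def)
    also have "\<dots> \<le> ennreal m1 * (\<integral>\<^sup>+r. F1 r * indicator {0..1} r \<partial>lborel)"
      using m by (intro nn_integral_affine_pullback_le) auto
    also have "(\<integral>\<^sup>+s. F s * indicator {\<theta><..1} s \<partial>lborel)
        \<le> (\<integral>\<^sup>+s. ennreal (m2 * \<bar>- m2\<bar>) * F2 (m2 + (- m2) * s) * indicator {0..1} (m2 + (- m2) * s) \<partial>lborel)"
      using F2 \<alpha>2_range unfolding \<alpha>2_def by (intro nn_integral_mono) (auto simp: indicator_def)
    also have "\<dots> \<le> ennreal m2 * (\<integral>\<^sup>+r. F2 r * indicator {0..1} r \<partial>lborel)"
      using m by (intro nn_integral_affine_pullback_le) auto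
    finally show ?thesis
      unfolding action_eq F1_def F2_def m1_def m2_def
      by (simp add: distrib_left mult.left_commute add_mono mult_left_mono)
  qed
  show ?thesis
    unfolding transport_sq_def[of X Q \<pi> \<sigma> \<rho>] transport_sq_def[of X Q \<pi> \<tau> \<rho>]
    by (rule ennreal_le_combination_Inf) (use \<theta> main in auto)
qed

end

section \<open>The evolution variational inequality\<close>

context markov_triple
begin

lemma entropy_cong: "(\<And>x. x \<in> X \<Longrightarrow> f x = g x) \<Longrightarrow> entropy X \<pi> f = entropy X \<pi> g"
  by (simp add: entropy_def cong: sum.cong)

lemma mean_weight_nonneg:
  "\<rho> \<in> densities X \<pi> \<Longrightarrow> x \<in> X \<Longrightarrow> y \<in> X \<Longrightarrow> 0 \<le> mean_weight \<rho> x y"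
  by (auto simp: mean_weight_def densities_def intro!: log_mean_nonneg)

lemma piecewise_smooth_along_affine: "piecewise_smooth_along {0, 1} (\<lambda>s. a + b * s)"
  by (auto simp: piecewise_smooth_along_def smooth_on_interval_iff times_differentiable_affine)

end

section \<open>Finiteness of the metric on irreducible chains\<close>

context irreducible_markov_triple
begin

text \<open>The heat flow started at \<sigma> is an admissible curve whose action is bounded by its
  entropy drop, and the entropy is finite even where \<sigma> vanishes.\<close>

lemma transport_sq_heat_finite:
  assumes \<sigma>: "\<sigma> \<in> densities X \<pi>"
  shows "distance_sq \<sigma> (heat 1 \<sigma>) < \<infinity>"
proof -
  obtain \<psi> h' where
    sol: "solves_continuity_eq X Q (\<lambda>s. heat (0 + 1 * s) \<sigma>) \<psi>"
    and h': "(h' has_integral entropy X \<pi> (heat (0 + 1) \<sigma>) - entropy X \<pi> (heat 0 \<sigma>)) {0..1}"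
    and eq: "\<And>s. s \<in> {0..1} - {0, 1} \<Longrightarrow> dirichlet (mean_weight (heat (0 + 1 * s) \<sigma>)) (\<psi> s) (\<psi> s)
        = inner (\<psi> s) (heat (0 + 1 * s) (\<lambda>_. 0)) - 1 * h' s"
    by (rule heat_along_curve[of "{0, 1}" "\<lambda>_. \<sigma>" "\<lambda>_ _. 0" 0 1])
       (use \<sigma> piecewise_smooth_along_affine[of _ 0] in auto)
  have "distance_sq \<sigma> (heat 1 \<sigma>) \<le> ennreal (- (entropy X \<pi> (heat (0 + 1) \<sigma>) - entropy X \<pi> (heat 0 \<sigma>)))"
  proof (rule transport_sq_le_integral(1)[OF _ sol _ _ _ has_integral_neg[OF h'], of _ _ "{0, 1}"])
    show "dirichlet (mean_weight (heat (0 + 1 * s) \<sigma>)) (\<psi> s) (\<psi> s) \<le> - h' s" if "s \<in> {0..1} - {0, 1}" for s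
      using eq[OF that] by (simp add: inner_def heat_def)
  qed (use \<sigma> heat_0 in \<open>auto intro: heat_density\<close>)
  then show ?thesis using le_less_trans by fastforce
qed

text \<open>The straight segment from 1 to \<sigma>, smoothed by \<open>heat 1\<close>, stays above
  a constant \<open>c > 0\<close>; its weights are then at least \<open>c\<close>, which bounds its
  action.\<close>

lemma transport_sq_one_heat_finite:
  assumes \<sigma>: "\<sigma> \<in> densities X \<pi>"
  shows "distance_sq (\<lambda>_. 1) (heat 1 \<sigma>) < \<infinity>"
proof -
  define r where "r s x = 1 + (\<sigma> x - 1) * s" for s x
  define v where "v x = heat 1 (\<lambda>x. \<sigma> x - 1) x" for x
  define c where "c = Min (insert 1 (heat 1 \<sigma> ` X))"
  have "0 < c"
    unfolding c_def using finite_space heat_pos[OF _ _ \<sigma>, of _ 1] by (subst Min_gr_iff) auto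
  moreover have "c \<le> 1" "\<And>x. x \<in> X \<Longrightarrow> c \<le> heat 1 \<sigma> x"
    unfolding c_def using finite_space by (auto intro!: Min_le)
  ultimately have c: "0 < c" "c \<le> 1" "\<And>x. x \<in> X \<Longrightarrow> c \<le> heat 1 \<sigma> x" by blast+
  have heat_r: "heat 1 (r s) x = (1 - s) + s * heat 1 \<sigma> x" if "x \<in> X" for s x
  proof -
    have "heat 1 (r s) x = (1 - s) * (\<Sum>y\<in>X. heat_kernel 1 x y) + s * heat 1 \<sigma> x"
      unfolding heat_def r_def sum_distrib_left sum.distrib[symmetric]
      by (intro sum.cong refl) (simp add: algebra_simps)
    then show ?thesis using sum_heat_kernel[OF that] by simp
  qed
  have r_dens: "r s \<in> densities X \<pi>" if s: "s \<in> {0..1}" for s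
  proof -
    have eq: "r s x = (1 - s) + s * \<sigma> x" for x by (simp add: r_def algebra_simps)
    have "(\<Sum>x\<in>X. \<pi> x * r s x) = (1 - s) * (\<Sum>x\<in>X. \<pi> x) + s * (\<Sum>x\<in>X. \<pi> x * \<sigma> x)"
      unfolding eq sum_distrib_left sum.distrib[symmetric]
      by (intro sum.cong refl) (simp add: algebra_simps)
    then show ?thesis using \<sigma> s prob_sum eq by (auto simp: densities_def)
  qed
  obtain \<psi> h' where
    sol: "solves_continuity_eq X Q (\<lambda>s. heat (1 + 0 * s) (r s)) \<psi>"
    and eq: "\<And>s. s \<in> {0..1} - {0, 1} \<Longrightarrow> dirichlet (mean_weight (heat (1 + 0 * s) (r s))) (\<psi> s) (\<psi> s)
        = inner (\<psi> s) (heat (1 + 0 * s) (\<lambda>x. \<sigma> x - 1)) - 0 * h' s"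
  proof (rule heat_along_curve[of "{0, 1}" r "\<lambda>_ x. \<sigma> x - 1" 1 0])
    show "piecewise_smooth_along {0, 1} (\<lambda>s. r s x)" for x
      unfolding r_def by (rule piecewise_smooth_along_affine)
    show "((\<lambda>s. r s x) has_real_derivative \<sigma> x - 1) (at s)" for s x
      unfolding r_def by (auto intro!: derivative_eq_intros)
  qed (use r_dens in auto)
  have mean_0: "inner (\<lambda>_. 1) v = 0"
  proof -
    have "inner (\<lambda>_. 1) v = inner (heat 1 (\<lambda>_. 1)) (\<lambda>x. \<sigma> x - 1)"
      unfolding v_def by (rule inner_heat[symmetric])
    also have "\<dots> = inner (\<lambda>_. 1) (\<lambda>x. \<sigma> x - 1)"
      by (rule inner_cong) (auto simp: heat_const)
    also have "\<dots> = 0"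
      using \<sigma> prob_sum by (simp add: inner_def densities_def right_diff_distrib sum_subtractf)
    finally show ?thesis .
  qed
  \<comment> \<open>The velocity \<open>v\<close> is the same at all times, so the system is solved
    over a one-point parameter set, with unit weights.\<close>
  obtain u' where u': "\<And>t x. t \<in> {0::real} \<Longrightarrow> x \<in> X \<Longrightarrow> flux (\<lambda>_ _. 1) (u' t) x = v x"
    by (rule flux_solvable[of "{0::real}" "\<lambda>_ _ _. 1" "\<lambda>_. v"]) (use mean_0 in auto)
  define u where "u = u' 0"
  have u: "flux (\<lambda>_ _. 1) u x = v x" if "x \<in> X" for x
    using u'[OF _ that] by (simp add: u_def)
  define M where "M = dirichlet (\<lambda>_ _. 1) u u / c"
  have le: "dirichlet (mean_weight (heat (1 + 0 * s) (r s))) (\<psi> s) (\<psi> s) \<le> M"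
    if s: "s \<in> {0..1} - {0, 1}" for s
  proof -
    define D where "D = dirichlet (mean_weight (heat (1 + 0 * s) (r s))) (\<psi> s) (\<psi> s)"
    have "D = inner (\<psi> s) v" using eq[OF s] by (simp add: D_def v_def[abs_def])
    also have "\<dots> = inner (\<psi> s) (flux (\<lambda>_ _. 1) u)" using u by (intro inner_cong) auto
    also have "\<dots> = dirichlet (\<lambda>_ _. 1) (\<psi> s) u" by (rule inner_flux) simp
    \<comment> \<open>Young's inequality with the lower bound \<open>c\<close> of the weights: the
      first term is at most \<open>D\<close> and is absorbed, leaving
      \<open>D \<le> M\<close>.\<close>
    finally have "2 * D \<le> c * dirichlet (\<lambda>_ _. 1) (\<psi> s) (\<psi> s) + M"
      using dirichlet_polarization_le[of "\<lambda>_ _. 1" c 1 "\<psi> s" u] c by (simp add: M_def)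
    also have "c * dirichlet (\<lambda>_ _. 1) (\<psi> s) (\<psi> s) = dirichlet (\<lambda>_ _. c) (\<psi> s) (\<psi> s)"
      unfolding dirichlet_def by (simp add: sum_distrib_left algebra_simps)
    also have "\<dots> \<le> D"
      unfolding D_def
    proof (rule dirichlet_mono)
      fix x y assume xy: "x \<in> X" "y \<in> X"
      have "c \<le> (1 - s) + s * heat 1 \<sigma> z" if "z \<in> X" for z
      proof -
        have "c = (1 - s) * c + s * c" by (simp add: algebra_simps)
        also have "\<dots> \<le> (1 - s) * 1 + s * heat 1 \<sigma> z"
          using c s that by (intro add_mono mult_left_mono) auto
        finally show ?thesis by simp
      qed
      then have "log_mean c c \<le> log_mean (heat 1 (r s) x) (heat 1 (r s) y)"
        using c xy heat_r by (intro log_mean_mono) auto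
      then show "c \<le> mean_weight (heat (1 + 0 * s) (r s)) x y"
        using c by (simp add: mean_weight_def log_mean_self)
    qed
    finally show ?thesis by (simp add: D_def)
  qed
  have "distance_sq (\<lambda>_. 1) (heat 1 \<sigma>) \<le> ennreal ((1 - 0) * M)"
  proof (rule transport_sq_le_integral(1)[where k = "\<lambda>_. M" and B = "{0, 1}", OF _ sol _ _ _ _ le])
    show "((\<lambda>_. M) has_integral (1 - 0) * M) {0..1::real}"
      using has_integral_const_real[of M 0 1] by simp
  qed (use r_dens heat_r in \<open>auto intro: heat_density\<close>)
  then show ?thesis using le_less_trans by fastforce
qed

text \<open>\<open>heat 1 \<sigma>\<close> is an intermediate point at finite distance from both
  \<sigma> and 1.\<close>

lemma transport_sq_one_finite:
  assumes "\<sigma> \<in> densities X \<pi>"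
  shows "distance_sq \<sigma> (\<lambda>_. 1) < \<infinity>"
  using transport_sq_triangle[of "1/2" \<sigma> "\<lambda>_. 1" "heat 1 \<sigma>"]
    transport_sq_heat_finite[OF assms] transport_sq_one_heat_finite[OF assms]
  by (auto simp: ennreal_mult_less_top elim!: le_less_trans)

lemma transport_sq_finite:
  assumes "\<sigma> \<in> densities X \<pi>" "\<tau> \<in> densities X \<pi>"
  shows "distance_sq \<sigma> \<tau> < \<infinity>"
  using transport_sq_triangle[of "1/2" \<sigma> \<tau> "\<lambda>_. 1"]
    transport_sq_one_finite[OF assms(1)] transport_sq_one_finite[OF assms(2)]
  by (auto simp: ennreal_mult_less_top elim!: le_less_trans)

end

section \<open>The variational inequality and convexity of the entropy\<close>

context bochner_markov_triple
begin

lemma evolution_variational_inequality_curve: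
  assumes dens: "\<And>t. t \<in> {0..1} \<Longrightarrow> \<rho> t \<in> densities X \<pi>" and sol: "solves_continuity_eq X Q \<rho> \<psi>"
    and A: "action X Q \<pi> \<rho> \<psi> = ennreal A" "0 \<le> A" and h: "0 < h"
    and ends: "\<And>x. x \<in> X \<Longrightarrow> \<rho> 0 x = \<sigma> x" "\<And>x. x \<in> X \<Longrightarrow> \<rho> 1 x = \<tau> x"
  shows "\<exists>I. distance_sq \<sigma> (heat h \<tau>) \<le> ennreal I \<and> 0 \<le> I \<and>
    I \<le> 2 * \<kappa> * h / (exp (2 * \<kappa> * h) - 1) * A + 2 * h * (entropy X \<pi> \<sigma> - entropy X \<pi> (heat h \<tau>))"
proof -
  define a where "a = 2 * \<kappa> * h"
  define E where "E = exp a - 1"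
  \<comment> \<open>Normalises the speed \<open>C * exp (a * s)\<close> to have integral 1 over the
    unit interval.\<close>
  define C where "C = a / E"
  have a: "0 < a" using curvature_pos h by (simp add: a_def)
  then have E: "0 < E" by (simp add: E_def)
  then have C: "0 < C" using a by (simp add: C_def)
  obtain B where B: "finite B" "{0, 1} \<subseteq> B" "B \<subseteq> {0..1}"
    and smooth: "\<And>x. x \<in> X \<Longrightarrow> piecewise_smooth_along B (\<lambda>t. \<rho> t x)"
    and \<rho>': "\<And>t x. t \<in> {0..1} - B \<Longrightarrow> x \<in> X \<Longrightarrow>
      ((\<lambda>s. \<rho> s x) has_real_derivative flux (mean_weight (\<rho> t)) (\<psi> t) x) (at t)"
    using sol by (rule solves_continuity_eqE) (blast intro: that)
  text \<open>The time change whose speed compensates the factor \<open>exp (- 2 * \<kappa> * h * s)\<close> gained from the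
    gradient estimate after running the heat flow for time \<open>h * s\<close>.\<close>
  define \<alpha> where "\<alpha> s = - 1 / E + 1 / E * exp (a * s)" for s
  define j where "j s = C * exp (a * s)" for s
  define \<beta> where "\<beta> r = ln (1 + r * E) / a" for r
  have \<alpha>_deriv: "(\<alpha> has_real_derivative j s) (at s)" for s
    unfolding \<alpha>_def j_def C_def using E by (auto intro!: derivative_eq_intros)
  have exp_\<alpha>: "1 + \<alpha> s * E = exp (a * s)" for s using E by (simp add: \<alpha>_def field_simps)
  have \<beta>\<alpha>: "\<beta> (\<alpha> s) = s" for s using a by (simp add: \<beta>_def exp_\<alpha>)
  have \<alpha>\<beta>: "\<alpha> (\<beta> r) = r" if "0 \<le> r" for r
  proof -
    have "exp (a * \<beta> r) = 1 + r * E"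
      using a E that by (simp add: \<beta>_def add_pos_nonneg)
    then show ?thesis using E by (simp add: \<alpha>_def field_simps)
  qed
  have \<alpha>_less: "\<alpha> s < \<alpha> t \<longleftrightarrow> s < t" for s t
    using a E by (simp add: \<alpha>_def divide_strict_right_mono divide_less_cancel)
  have \<alpha>_le: "\<alpha> s \<le> \<alpha> t \<longleftrightarrow> s \<le> t" for s t using \<alpha>_less by (metis linorder_not_le)
  have "\<alpha> 1 * E = E" using exp_\<alpha>[of 1] by (simp only: E_def mult_1_right)
  then have \<alpha>01: "\<alpha> 0 = 0" "\<alpha> 1 = 1" using E by (simp_all only: \<alpha>_def) simp_all
  have range: "\<alpha> s \<in> {0..1}" if "s \<in> {0..1}" for s
    using that \<alpha>_le[of 0 s] \<alpha>_le[of s 1] \<alpha>01 by simp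
  have \<beta>_range: "\<beta> r \<in> {0..1}" if "r \<in> {0..1}" for r
    using that \<alpha>\<beta>[of r] \<alpha>_le[of 0 "\<beta> r"] \<alpha>_le[of "\<beta> r" 1] \<alpha>01 by simp
  define B' where "B' = \<beta> ` B"
  have B'_iff: "s \<in> B' \<longleftrightarrow> \<alpha> s \<in> B" for s
  proof
    assume "s \<in> B'"
    then obtain u where "u \<in> B" "s = \<beta> u" by (auto simp: B'_def)
    then show "\<alpha> s \<in> B" using B(3) \<alpha>\<beta>[of u] by auto
  next
    assume "\<alpha> s \<in> B"
    then show "s \<in> B'" unfolding B'_def by (metis \<beta>\<alpha> image_eqI)
  qed
  have B': "finite B'" "{0, 1} \<subseteq> B'" "B' \<subseteq> {0..1}"
  proof -
    show "finite B'" using B(1) by (simp add: B'_def)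
    show "{0, 1} \<subseteq> B'" using B(2) \<alpha>01 B'_iff by simp
    show "B' \<subseteq> {0..1}" using B(3) \<beta>_range unfolding B'_def by blast
  qed
  define r where "r s = \<rho> (\<alpha> s)" for s
  define r' where "r' s x = flux (mean_weight (r s)) (\<psi> (\<alpha> s)) x * j s" for s x
  have r_dens: "r s \<in> densities X \<pi>" if "s \<in> {0..1}" for s
    using dens range[OF that] by (simp add: r_def)
  obtain \<phi> h' where
    sol': "solves_continuity_eq X Q (\<lambda>s. heat (0 + h * s) (r s)) \<phi>"
    and cont: "continuous_on ({0..1} - B') (\<lambda>s. dirichlet (mean_weight (heat (0 + h * s) (r s))) (\<phi> s) (\<phi> s))"
      "continuous_on ({0..1} - B') h'"
    and h': "(h' has_integral entropy X \<pi> (heat (0 + h) (r 1)) - entropy X \<pi> (heat 0 (r 0))) {0..1}"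
    and eq: "\<And>s. s \<in> {0..1} - B' \<Longrightarrow> dirichlet (mean_weight (heat (0 + h * s) (r s))) (\<phi> s) (\<phi> s)
        = inner (\<phi> s) (heat (0 + h * s) (r' s)) - h * h' s"
  proof (rule heat_along_curve[of B' r r' 0 h])
    fix x assume x: "x \<in> X"
    show "piecewise_smooth_along B' (\<lambda>s. r s x)"
      unfolding piecewise_smooth_along_def
    proof (intro conjI ballI impI)
      fix c d assume "c \<in> B'" "d \<in> B'" and cd: "c < d \<and> B' \<inter> {c<..<d} = {}"
      then have cd01: "0 \<le> c" "d \<le> 1" "c < d" using B' by auto
      have "s \<notin> B'" if "c < s" "s < d" for s using cd that by auto
      then have \<alpha>B: "\<alpha> s \<notin> B" if "c < s" "s < d" for s using that B'_iff by blast
      show "smooth_on_interval (\<lambda>s. r s x) c d"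
        unfolding r_def
      proof (rule piecewise_smooth_along_compose[OF smooth[OF x] cd01(3), where c = "\<alpha> c" and d = "\<alpha> d"])
        show "0 \<le> \<alpha> c" "\<alpha> d \<le> 1" using cd01 range[of c] range[of d] by auto
        show "\<alpha> c < \<alpha> d" using cd01 \<alpha>_less by simp
        have "\<not> (\<alpha> c < u \<and> u < \<alpha> d)" if "u \<in> B" for u
          using \<alpha>B[of "\<beta> u"] \<alpha>\<beta>[of u] \<alpha>_less[of c "\<beta> u"] \<alpha>_less[of "\<beta> u" d] that B(3) by auto
        then show "B \<inter> {\<alpha> c<..<\<alpha> d} = {}" by auto
        show "times_differentiable k {c..d} \<alpha>" for k
          unfolding \<alpha>_def
          by (intro times_differentiable_add times_differentiable_mult times_differentiable_const
              times_differentiable_exp)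
        show "\<alpha> ` {c..d} \<subseteq> {\<alpha> c..\<alpha> d}" using \<alpha>_le by auto
      qed
    qed (use B' in auto)
  next
    fix s x assume s: "s \<in> {0..1} - B'" and x: "x \<in> X"
    then have "\<alpha> s \<in> {0..1} - B" using range[of s] B'_iff by auto
    from DERIV_chain2[OF \<rho>'[OF this x] \<alpha>_deriv]
    show "((\<lambda>s. r s x) has_real_derivative r' s x) (at s)" by (simp add: r_def r'_def)
  qed (use r_dens h in auto)
  define D where "D s = dirichlet (mean_weight (heat (0 + h * s) (r s))) (\<phi> s) (\<phi> s)" for s
  define f where "f t = dirichlet (mean_weight (\<rho> t)) (\<psi> t) (\<psi> t)" for t
  have f_nonneg: "0 \<le> f t" if "t \<in> {0..1}" for t
    unfolding f_def using dens[OF that] by (intro dirichlet_nonneg mean_weight_nonneg)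
  have bound: "D s + 2 * h * h' s \<le> C * j s * f (\<alpha> s)" if s: "s \<in> {0..1} - B'" for s
  proof -
    have pos: "0 < 0 + h * s" using s B'(2) h by (auto simp: less_le)
    define u where "u = heat (0 + h * s) (\<phi> s)"
    have sym: "mean_weight (r s) x y = mean_weight (r s) y x" if "x \<in> X" "y \<in> X" for x y
      using r_dens s that by (intro mean_weight_sym) (auto simp: densities_def)
    have "inner (\<phi> s) (heat (0 + h * s) (r' s)) = inner u (r' s)"
      unfolding u_def by (rule inner_heat[symmetric])
    also have "\<dots> = j s * inner u (flux (mean_weight (r s)) (\<psi> (\<alpha> s)))"
      unfolding r'_def inner_def sum_distrib_left by (intro sum.cong refl) (simp add: mult_ac)
    also have "inner u (flux (mean_weight (r s)) (\<psi> (\<alpha> s))) = dirichlet (mean_weight (r s)) u (\<psi> (\<alpha> s))"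
      using sym by (rule inner_flux)
    finally have D: "D s = j s * dirichlet (mean_weight (r s)) u (\<psi> (\<alpha> s)) - h * h' s"
      using eq[OF s] by (simp add: D_def)
    \<comment> \<open>Young's inequality with weight \<open>exp (a * s)\<close>: the gradient
      estimate absorbs the first term into one of two copies of \<open>D s\<close>, which is why the
      entropy term carries the factor \<open>2 * h\<close>. The speed \<open>j\<close> makes the
      other coefficient \<open>C * j s\<close>, so that a change of variables applies.\<close>
    have "2 * j s * dirichlet (mean_weight (r s)) u (\<psi> (\<alpha> s))
        \<le> exp (a * s) * dirichlet (mean_weight (r s)) u u + (j s)\<^sup>2 / exp (a * s) * f (\<alpha> s)"
      unfolding f_def r_def using dens range s
      by (intro dirichlet_polarization_le mean_weight_nonneg) auto
    also have "exp (a * s) * dirichlet (mean_weight (r s)) u u \<le> D s"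
      using gradient_estimate[OF pos r_dens, of s "\<phi> s"] s by (simp add: D_def u_def a_def mult.assoc)
    also have "(j s)\<^sup>2 / exp (a * s) = C * j s" by (simp add: j_def power2_eq_square)
    finally show ?thesis using D by simp
  qed
  define F where "F t = ennreal (2 * f t)" for t
  define T where "T = {0..1} - B'"
  have [measurable]: "T \<in> sets borel" unfolding T_def using B'(1) by (simp add: finite_imp_closed borel_closed)
  \<comment> \<open>A measurable function between the quantity to be bounded and the possibly
    non-measurable action density. The cut-off at 0 preserves the bound because
    \<open>C * j s * f (\<alpha> s)\<close> is nonnegative.\<close>
  define G where "G s = indicator T s *\<^sub>R max 0 (D s + 2 * h * h' s)" for s
  have [measurable]: "G \<in> borel_measurable borel"
    unfolding G_def
  proof (rule borel_measurable_continuous_on_indicator)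
    show "T \<in> sets borel" by measurable
    show "continuous_on T (\<lambda>s. max 0 (D s + 2 * h * h' s))"
      unfolding T_def D_def by (intro continuous_intros cont)
  qed
  have "ennreal (1 / 2) * (\<integral>\<^sup>+t. F t * indicator {0..1} t \<partial>lborel) = ennreal A"
    using A(1) unfolding action_eq F_def f_def .
  then have double: "ennreal 2 * (ennreal (1 / 2) * (\<integral>\<^sup>+t. F t * indicator {0..1} t \<partial>lborel)) = ennreal (2 * A)"
    using A(2) by (simp add: ennreal_mult)
  then have F: "(\<integral>\<^sup>+t. F t * indicator {0..1} t \<partial>lborel) = ennreal (2 * A)"
  proof -
    have "ennreal 2 * ennreal (1 / 2) = 1" by (subst ennreal_mult[symmetric]) auto
    then show ?thesis
      using double by (simp only: mult.assoc[symmetric] mult_1_left)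
  qed
  have "(\<integral>\<^sup>+s. ennreal (G s) \<partial>lborel)
      \<le> (\<integral>\<^sup>+s. ennreal (C / 2 * j s) * F (\<alpha> s) * indicator {0..1} s \<partial>lborel)"
  proof (rule nn_integral_mono)
    fix s
    show "ennreal (G s) \<le> ennreal (C / 2 * j s) * F (\<alpha> s) * indicator {0..1} s"
    proof (cases "s \<in> T")
      case True
      then have s: "s \<in> {0..1} - B'" by (simp add: T_def)
      have nn: "0 \<le> C * j s * f (\<alpha> s)" using C f_nonneg[of "\<alpha> s"] range[of s] s by (simp add: j_def)
      have "G s \<le> C * j s * f (\<alpha> s)" using bound[OF s] nn True by (simp add: G_def)
      \<comment> \<open>\<open>F\<close> carries the factor 2 of the action, hence
        \<open>C / 2\<close> in front.\<close>
      then have "ennreal (G s) \<le> ennreal (C / 2 * j s * (2 * f (\<alpha> s)))" by (intro ennreal_leI) simp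
      also have "\<dots> = ennreal (C / 2 * j s) * F (\<alpha> s)"
        unfolding F_def using C by (intro ennreal_mult') (simp add: j_def)
      finally show ?thesis using s by simp
    qed (simp add: G_def)
  qed
  also have "\<dots> \<le> ennreal (C / 2) * (\<integral>\<^sup>+t. F t * indicator {0..1} t \<partial>lborel)"
  proof (rule nn_integral_pullback_le[where \<beta> = \<beta>])
    show "\<beta> \<in> borel_measurable borel" unfolding \<beta>_def by measurable
    show "j \<in> borel_measurable borel" unfolding j_def by measurable
    fix k :: "real \<Rightarrow> ennreal" assume k: "k \<in> borel_measurable borel"
    have "(\<integral>\<^sup>+x. k x * indicator {\<alpha> 0..\<alpha> 1} x \<partial>lborel)
        = (\<integral>\<^sup>+x. k (\<alpha> x) * ennreal (j x) * indicator {0..1} x \<partial>lborel)"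
      using k C by (intro nn_integral_substitution_aux \<alpha>_deriv) (auto simp: j_def intro!: continuous_intros)
    then show "(\<integral>\<^sup>+s. ennreal (j s) * k (\<alpha> s) * indicator {0..1} s \<partial>lborel)
        = (\<integral>\<^sup>+r. k r * indicator {0..1} r \<partial>lborel)"
      by (simp add: \<alpha>01 mult.commute)
  qed (use C \<beta>\<alpha> \<alpha>\<beta> \<beta>_range in \<open>auto simp: j_def\<close>)
  also have "\<dots> = ennreal (C * A)"
    unfolding F using A C by (subst ennreal_mult[symmetric]) auto
  finally have G_le: "(\<integral>\<^sup>+s. ennreal (G s) \<partial>lborel) \<le> ennreal (C * A)" .
  have G_nonneg: "0 \<le> G s" for s by (simp add: G_def)
  have "(\<integral>\<^sup>+s. ennreal (G s) \<partial>lborel) < \<infinity>" using G_le by (rule le_less_trans) simp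
  then obtain g where g: "(G has_integral g) UNIV"
    using nn_integral_integrable_on[of G] G_nonneg by auto
  then have "ennreal g \<le> ennreal (C * A)"
    using nn_integral_has_integral_lborel[of G g] G_nonneg G_le by simp
  then have g_le: "g \<le> C * A" using A C by (simp add: ennreal_le_iff)
  have "(\<lambda>s. if s \<in> {0..1} then G s else 0) = G"
    by (auto simp: fun_eq_iff G_def T_def indicator_def)
  then have "(G has_integral g) {0..1}"
    using g has_integral_restrict_UNIV[of "{0..1}" G g] by simp
  from has_integral_diff[OF this has_integral_mult_right[OF h', of "2 * h"]]
  have int: "((\<lambda>s. G s - 2 * h * h' s) has_integral
      g - 2 * h * (entropy X \<pi> (heat (0 + h) (r 1)) - entropy X \<pi> (heat 0 (r 0)))) {0..1}" .
  have ends': "r 1 x = \<tau> x" "r 0 x = \<sigma> x" if "x \<in> X" for x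
    using ends that by (simp_all add: r_def \<alpha>01)
  have heat_cong: "heat t (r 1) x = heat t \<tau> x" for t x
    unfolding heat_def using ends' by (intro sum.cong) auto
  have "entropy X \<pi> (heat (0 + h) (r 1)) = entropy X \<pi> (heat h \<tau>)" "entropy X \<pi> (heat 0 (r 0)) = entropy X \<pi> \<sigma>"
    using heat_cong ends' by (auto intro!: entropy_cong simp: heat_0)
  note int = int[unfolded this]
  have le: "dirichlet (mean_weight (heat (0 + h * s) (r s))) (\<phi> s) (\<phi> s) \<le> G s - 2 * h * h' s"
    if "s \<in> {0..1} - B'" for s
    using that unfolding D_def[symmetric] by (simp add: G_def T_def)
  have mu0: "heat (0 + h * 0) (r 0) x = \<sigma> x" if "x \<in> X" for x using that ends' by (simp add: heat_0)
  have mu1: "heat (0 + h * 1) (r 1) x = heat h \<tau> x" if "x \<in> X" for x using heat_cong by simp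
  have mu: "heat (0 + h * s) (r s) \<in> densities X \<pi>" if "s \<in> {0..1}" for s
    using r_dens[OF that] that h by (intro heat_density) auto
  note * = transport_sq_le_integral[OF mu sol' mu0 mu1 B'(1) int le]
  show ?thesis
    using * g_le by (intro exI conjI) (assumption, assumption, simp add: C_def E_def a_def algebra_simps)
qed

definition heat_distance_factor :: "real \<Rightarrow> real" where
  "heat_distance_factor h = 2 * \<kappa> * h / (exp (2 * \<kappa> * h) - 1)"

lemma evolution_variational_inequality:
  assumes \<sigma>: "\<sigma> \<in> densities X \<pi>" and \<tau>: "\<tau> \<in> densities X \<pi>" and h: "0 < h"
  shows "enn2real (distance_sq \<sigma> (heat h \<tau>)) \<le> heat_distance_factor h * enn2real (distance_sq \<sigma> \<tau>)
    + 2 * h * (entropy X \<pi> \<sigma> - entropy X \<pi> (heat h \<tau>))"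
proof (rule field_le_epsilon)
  fix e :: real assume e: "0 < e"
  define C where "C = heat_distance_factor h"
  have C: "0 < C" using curvature_pos h by (simp add: C_def heat_distance_factor_def)
  define d where "d = enn2real (distance_sq \<sigma> \<tau>)"
  have d: "distance_sq \<sigma> \<tau> = ennreal d" "0 \<le> d"
    using transport_sq_finite[OF \<sigma> \<tau>] by (auto simp: d_def)
  \<comment> \<open>Slack \<open>e / C\<close> in the action becomes \<open>e\<close> after
    multiplication by \<open>C\<close>.\<close>
  then have "distance_sq \<sigma> \<tau> < ennreal (d + e / C)"
    using e C by (simp add: ennreal_less_iff)
  then obtain \<rho> \<psi> where \<rho>: "action X Q \<pi> \<rho> \<psi> < ennreal (d + e / C)" "\<forall>t\<in>{0..1}. \<rho> t \<in> densities X \<pi>"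
    "solves_continuity_eq X Q \<rho> \<psi>" "\<forall>x\<in>X. \<rho> 0 x = \<sigma> x" "\<forall>x\<in>X. \<rho> 1 x = \<tau> x"
    unfolding transport_sq_def Inf_less_iff by blast
  then obtain A where A: "action X Q \<pi> \<rho> \<psi> = ennreal A" "0 \<le> A"
    by (cases "action X Q \<pi> \<rho> \<psi>") auto
  then have "A < d + e / C" using \<rho>(1) by (simp add: ennreal_less_iff)
  then have "C * A \<le> C * d + e" using C by (simp add: field_simps)
  moreover obtain I where "distance_sq \<sigma> (heat h \<tau>) \<le> ennreal I" "0 \<le> I"
    "I \<le> C * A + 2 * h * (entropy X \<pi> \<sigma> - entropy X \<pi> (heat h \<tau>))"
    using evolution_variational_inequality_curve[of \<rho> \<psi> A h \<sigma> \<tau>] \<rho> A h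
    unfolding C_def heat_distance_factor_def by blast
  moreover from this have "enn2real (distance_sq \<sigma> (heat h \<tau>)) \<le> I"
    using enn2real_mono[of "distance_sq \<sigma> (heat h \<tau>)" "ennreal I"] by simp
  ultimately show "enn2real (distance_sq \<sigma> (heat h \<tau>)) \<le> heat_distance_factor h * enn2real (distance_sq \<sigma> \<tau>)
      + 2 * h * (entropy X \<pi> \<sigma> - entropy X \<pi> (heat h \<tau>)) + e"
    unfolding C_def[symmetric] d_def[symmetric] by linarith
qed

lemma entropy_convex:
  assumes dens: "\<sigma> \<in> densities X \<pi>" "\<tau> \<in> densities X \<pi>" "\<rho> \<in> densities X \<pi>" and \<theta>: "0 < \<theta>" "\<theta> < 1"
    and 1: "enn2real (distance_sq \<sigma> \<rho>) = \<theta>\<^sup>2 * d" and 2: "enn2real (distance_sq \<tau> \<rho>) = (1 - \<theta>)\<^sup>2 * d"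
    and d: "d = enn2real (distance_sq \<sigma> \<tau>)"
  shows "entropy X \<pi> \<rho> \<le> (1 - \<theta>) * entropy X \<pi> \<sigma> + \<theta> * entropy X \<pi> \<tau> - \<kappa> / 2 * \<theta> * (1 - \<theta>) * d"
proof -
  let ?H = "entropy X \<pi>"
  let ?R = "(1 - \<theta>) * ?H \<sigma> + \<theta> * ?H \<tau>"
  have le: "(1 - heat_distance_factor h) / (2 * h) * (\<theta> * (1 - \<theta>) * d) + ?H (heat h \<rho>) \<le> ?R"
    if h: "0 < h" for h
  proof -
    define C where "C = heat_distance_factor h"
    define \<mu> where "\<mu> = heat h \<rho>"
    have \<mu>: "\<mu> \<in> densities X \<pi>" unfolding \<mu>_def using h dens by (intro heat_density) auto
    define p where "p = enn2real (distance_sq \<sigma> \<mu>)"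
    define q where "q = enn2real (distance_sq \<tau> \<mu>)"
    have pq: "distance_sq \<sigma> \<mu> = ennreal p" "0 \<le> p" "distance_sq \<tau> \<mu> = ennreal q" "0 \<le> q"
      using transport_sq_finite[OF dens(1) \<mu>] transport_sq_finite[OF dens(2) \<mu>] by (auto simp: p_def q_def)
    have "ennreal d \<le> ennreal (1 / \<theta>) * ennreal p + ennreal (1 / (1 - \<theta>)) * ennreal q"
      using transport_sq_triangle[OF \<theta>, of \<sigma> \<tau> \<mu>] transport_sq_finite[OF dens(1,2)] pq d by simp
    also have "\<dots> = ennreal (1 / \<theta> * p + 1 / (1 - \<theta>) * q)"
      using \<theta> pq by (simp add: ennreal_mult[symmetric] ennreal_plus[symmetric] del: ennreal_plus)
    finally have "d \<le> 1 / \<theta> * p + 1 / (1 - \<theta>) * q"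
      using \<theta> pq by (subst (asm) ennreal_le_iff) auto
    then have "\<theta> * (1 - \<theta>) * d \<le> \<theta> * (1 - \<theta>) * (1 / \<theta> * p + 1 / (1 - \<theta>) * q)"
      using \<theta> by (intro mult_left_mono) auto
    also have "\<dots> = (1 - \<theta>) * p + \<theta> * q" using \<theta> by (simp add: field_simps)
    also have "\<dots> \<le> (1 - \<theta>) * (C * (\<theta>\<^sup>2 * d) + 2 * h * (?H \<sigma> - ?H \<mu>))
        + \<theta> * (C * ((1 - \<theta>)\<^sup>2 * d) + 2 * h * (?H \<tau> - ?H \<mu>))"
      unfolding p_def q_def C_def \<mu>_def using \<theta>
        evolution_variational_inequality[OF dens(1,3) h] evolution_variational_inequality[OF dens(2,3) h]
      by (intro add_mono mult_left_mono) (auto simp: 1 2)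
    \<comment> \<open>Since (1 - \<theta>) \<theta>^2 + \<theta> (1 - \<theta>)^2 = \<theta> (1 -
      \<theta>), the two distances recombine to the left-hand side up to the factor
      \<open>C\<close>.\<close>
    also have "\<dots> = C * (\<theta> * (1 - \<theta>) * d) + 2 * h * (?R - ?H \<mu>)"
      by (simp add: algebra_simps power2_eq_square)
    finally have "(1 - C) * (\<theta> * (1 - \<theta>) * d) \<le> 2 * h * (?R - ?H \<mu>)"
      by (simp add: algebra_simps)
    then have "(1 - C) * (\<theta> * (1 - \<theta>) * d) / (2 * h) \<le> ?R - ?H \<mu>"
      using h by (simp add: field_simps)
    then show ?thesis unfolding C_def \<mu>_def by simp
  qed
  \<comment> \<open>With \<open>x = 2 * \<kappa> * h\<close>, the factor
    \<open>x / (exp x - 1)\<close> is \<open>1 - x / 2\<close> to first order.\<close>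
  have "((\<lambda>h. (1 - heat_distance_factor h) / (2 * h)) \<longlongrightarrow> \<kappa> / 2) (at_right 0)"
    unfolding heat_distance_factor_def using curvature_pos
    by real_asymp (simp add: field_simps)
  moreover have "((\<lambda>h. ?H (heat h \<rho>)) \<longlongrightarrow> ?H \<rho>) (at_right 0)"
  proof -
    have "continuous_on {0..} (\<lambda>h. ?H (heat (0 + 1 * h) \<rho>))"
      using dens(3) heat_nonneg
      by (intro continuous_on_entropy continuous_on_heat_affine) (auto simp: densities_def)
    then have "((\<lambda>h. ?H (heat h \<rho>)) \<longlongrightarrow> ?H (heat 0 \<rho>)) (at 0 within {0..})"
      unfolding continuous_on_def by simp
    moreover have "?H (heat 0 \<rho>) = ?H \<rho>" by (intro entropy_cong heat_0)
    ultimately show ?thesis by (simp add: at_within_Ici_at_right)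
  qed
  ultimately have lim: "((\<lambda>h. (1 - heat_distance_factor h) / (2 * h) * (\<theta> * (1 - \<theta>) * d) + ?H (heat h \<rho>))
      \<longlongrightarrow> \<kappa> / 2 * (\<theta> * (1 - \<theta>) * d) + ?H \<rho>) (at_right 0)"
    by (intro tendsto_add tendsto_mult_right)
  have "\<kappa> / 2 * (\<theta> * (1 - \<theta>) * d) + ?H \<rho> \<le> ?R"
  proof (rule tendsto_upperbound[OF lim])
    show "\<forall>\<^sub>F h in at_right 0.
        (1 - heat_distance_factor h) / (2 * h) * (\<theta> * (1 - \<theta>) * d) + ?H (heat h \<rho>) \<le> ?R"
      using eventually_at_right_less[of 0] by (rule eventually_mono) (rule le)
  qed simp
  then show ?thesis by (simp add: mult.assoc)
qed

theorem Ric_bounded_below_curvature: "Ric_bounded_below X Q \<pi> \<kappa>"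
  unfolding Ric_bounded_below_def
proof (intro conjI allI impI ballI)
  show "markov_triple X Q \<pi>" by (rule markov_triple_axioms)
  fix \<rho> and t :: real
  assume \<rho>: "constant_speed_geodesic X Q \<pi> \<rho>" and t: "t \<in> {0..1}"
  have dens: "\<rho> s \<in> densities X \<pi>" if "s \<in> {0..1}" for s
    using \<rho> that by (simp add: constant_speed_geodesic_def)
  define d where "d = enn2real (distance_sq (\<rho> 0) (\<rho> 1))"
  have d: "distance_sq (\<rho> 0) (\<rho> 1) = ennreal d" "0 \<le> d"
    using transport_sq_finite[OF dens dens, of 0 1] by (auto simp: d_def)
  \<comment> \<open>The geodesic condition covers both orders of the two times, so the distance from
    \<open>\<rho> 1\<close> to an intermediate point needs no separate symmetry argument.\<close>
  have speed: "enn2real (distance_sq (\<rho> s) (\<rho> u)) = (u - s)\<^sup>2 * d" if "s \<in> {0..1}" "u \<in> {0..1}" for s u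
  proof -
    have "transport_dist X Q \<pi> (\<rho> s) (\<rho> u) = ennreal \<bar>u - s\<bar> * transport_dist X Q \<pi> (\<rho> 0) (\<rho> 1)"
      using \<rho> that unfolding constant_speed_geodesic_def by blast
    then have "distance_sq (\<rho> s) (\<rho> u) = (ennreal \<bar>u - s\<bar>)\<^sup>2 * ennreal d"
      unfolding transport_dist_squared[symmetric] d(1)[symmetric] by (simp add: power_mult_distrib)
    also have "\<dots> = ennreal ((u - s)\<^sup>2 * d)"
      using d by (simp add: ennreal_power ennreal_mult)
    finally show ?thesis using d by simp
  qed
  have "entropy X \<pi> (\<rho> t) \<le> (1 - t) * entropy X \<pi> (\<rho> 0) + t * entropy X \<pi> (\<rho> 1) - \<kappa> / 2 * t * (1 - t) * d"
  \<comment> \<open>At the end points the claim is an equality, while the weighted triangle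
    inequality needs \<theta> strictly inside.\<close>
  proof (cases "t = 0 \<or> t = 1")
    case False
    then show ?thesis
      using t dens speed[of 0 t] speed[of 1 t]
      by (intro entropy_convex) (auto simp: d_def power2_commute)
  qed auto
  moreover have "enn2ereal ((transport_dist X Q \<pi> (\<rho> 0) (\<rho> 1))\<^sup>2) = ereal d"
    unfolding transport_dist_squared d(1) using d(2) by simp
  ultimately show "ereal (entropy X \<pi> (\<rho> t))
      \<le> ereal ((1 - t) * entropy X \<pi> (\<rho> 0) + t * entropy X \<pi> (\<rho> 1))
        - ereal (\<kappa> / 2 * t * (1 - t)) * enn2ereal ((transport_dist X Q \<pi> (\<rho> 0) (\<rho> 1))\<^sup>2)"
    by simp
qed

end

section \<open>The Bernoulli--Laplace model\<close>

text \<open>Moves are indexed by all pairs of sites, also those that fix a configuration. The index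
  set is then independent of the configuration, each move is an involution of the slice, and trivial
  moves contribute zero differences.\<close>

definition exchange :: "nat \<Rightarrow> nat \<Rightarrow> (nat \<Rightarrow> int) \<Rightarrow> nat \<Rightarrow> int" where
  "exchange i j x = x(i := x j, j := x i)"

lemma exchange_exchange [simp]: "exchange i j (exchange i j x) = x"
  by (auto simp: exchange_def fun_eq_iff)

lemma exchange_same [simp]: "exchange i i x = x"
  by (simp add: exchange_def)

lemma exchange_sym: "exchange i j x = exchange j i x"
  by (auto simp: exchange_def fun_eq_iff)

lemma exchange_eq: "x i = x j \<Longrightarrow> exchange i j x = x"
  by (auto simp: exchange_def fun_eq_iff)

lemma exchange_commute:
  "i \<noteq> k \<Longrightarrow> i \<noteq> l \<Longrightarrow> j \<noteq> k \<Longrightarrow> j \<noteq> l \<Longrightarrow>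
    exchange i j (exchange k l x) = exchange k l (exchange i j x)"
  by (auto simp: exchange_def fun_eq_iff)

lemma exchange_slice:
  assumes "x \<in> slice n k" "i \<in> {1..n}" "j \<in> {1..n}"
  shows "exchange i j x \<in> slice n k"
proof -
  have "(\<Sum>l\<in>{1..n}. exchange i j x l) = (\<Sum>l\<in>{1..n}. x l)"
    by (rule sum.reindex_bij_witness[of _ "\<lambda>l. if l = i then j else if l = j then i else l"
          "\<lambda>l. if l = i then j else if l = j then i else l"])
       (use assms in \<open>auto simp: exchange_def\<close>)
  then show ?thesis
    using assms by (auto simp: slice_def exchange_def PiE_iff extensional_def)
qed

lemma finite_slice: "finite (slice n k)"
proof -
  have "finite ({1..n} \<rightarrow>\<^sub>E {0, 1 :: int})" by (intro finite_PiE) auto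
  then show ?thesis by (rule rev_finite_subset) (auto simp: slice_def)
qed

lemma slice_value: "x \<in> slice n k \<Longrightarrow> i \<in> {1..n} \<Longrightarrow> x i = 0 \<or> x i = 1"
  by (auto simp: slice_def PiE_iff)

text \<open>For moves sharing one site \<open>i\<close> or \<open>j\<close> with the edge from \<open>x\<close> to \<open>exchange i j x\<close>,
  the third corner \<open>z\<close> of a triangle is reached from both ends of the edge.\<close>

lemma exchange_triangle:
  assumes x: "x i \<in> {0, 1}" "x j \<in> {0, 1}" "x l \<in> {0, 1}" and "x i \<noteq> x j" and "l \<noteq> i" "l \<noteq> j" "i \<noteq> j"
  obtains z where "z = exchange i l x \<or> z = exchange j l x"
    and "\<And>g :: (nat \<Rightarrow> int) \<Rightarrow> real. g (exchange i l x) + g (exchange j l x) = g z + g x"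
    and "\<And>g :: (nat \<Rightarrow> int) \<Rightarrow> real. g (exchange i l (exchange i j x)) + g (exchange j l (exchange i j x))
      = g z + g (exchange i j x)"
\<comment> \<open>Site \<open>l\<close> carries the value of \<open>i\<close> or of
  \<open>j\<close>, so one of the two moves is trivial at \<open>x\<close> and the other leads to
  \<open>z\<close>; at the other end of the edge the roles are interchanged.\<close>
proof (cases "x l = x i")
  case True
  have "exchange i l x = x" using True by (simp add: exchange_eq)
  moreover have "exchange i l (exchange i j x) = exchange j l x"
    "exchange j l (exchange i j x) = exchange i j x"
    using True assms by (auto simp: exchange_def fun_eq_iff)
  ultimately show ?thesis by (intro that[of "exchange j l x"]) auto
next
  case False
  then have "x l = x j" using assms by auto
  then have "exchange j l x = x" by (simp add: exchange_eq)
  moreover have "exchange i l (exchange i j x) = exchange i j x"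
    "exchange j l (exchange i j x) = exchange i l x"
    using \<open>x l = x j\<close> assms by (auto simp: exchange_def fun_eq_iff)
  ultimately show ?thesis by (intro that[of "exchange i l x"]) auto
qed

lemma sum_pairs_split:
  fixes t :: "nat \<Rightarrow> nat \<Rightarrow> real"
  assumes "finite N" "i \<in> N" "j \<in> N" "i \<noteq> j"
    and "\<And>k l. t k l = t l k" "\<And>k. t k k = 0"
  shows "(\<Sum>k\<in>N. \<Sum>l\<in>N. t k l)
    = 2 * t i j + 2 * (\<Sum>l\<in>N - {i, j}. t i l + t j l) + (\<Sum>k\<in>N - {i, j}. \<Sum>l\<in>N - {i, j}. t k l)"
proof -
  define R where "R = N - {i, j}"
  have N: "N = insert i (insert j R)" and R: "finite R" "i \<notin> R" "j \<notin> R"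
    using assms by (auto simp: R_def)
  have "(\<Sum>k\<in>R. t k i) = (\<Sum>l\<in>R. t i l)" "(\<Sum>k\<in>R. t k j) = (\<Sum>l\<in>R. t j l)"
    using assms(5) by (auto intro: sum.cong)
  then show ?thesis
    unfolding R_def[symmetric] unfolding N
    using R assms(4,6) assms(5)[of j i] by (simp add: sum.distrib)
qed

text \<open>The Bochner inequality, up to the factor \<open>rate\<^sup>2 / 8\<close>: the moves \<open>(k, l)\<close> equal to,
  sharing one site with, and disjoint from the edge move \<open>(i, j)\<close> contribute at least
  \<open>8\<close>, \<open>2 (n - 2)\<close> and \<open>0\<close> times the Dirichlet form.\<close>

lemma bernoulli_laplace_bochner:
  fixes \<rho> f :: "(nat \<Rightarrow> int) \<Rightarrow> real"
  assumes p: "0 \<le> p" "p \<le> 1" and \<rho>: "\<And>x. x \<in> slice n k \<Longrightarrow> 0 < \<rho> x"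
  defines "w \<equiv> \<lambda>i j x. geometric_mean p (\<rho> x) (\<rho> (exchange i j x))"
    and "d \<equiv> \<lambda>i j g x. g (exchange i j x) - g x :: real"
  shows "2 * (real n + 2) * (\<Sum>x\<in>slice n k. \<Sum>i\<in>{1..n}. \<Sum>j\<in>{1..n}. w i j x * (d i j f x)\<^sup>2)
    \<le> (\<Sum>x\<in>slice n k. \<Sum>i\<in>{1..n}. \<Sum>j\<in>{1..n}. \<Sum>a\<in>{1..n}. \<Sum>b\<in>{1..n}.
        w i j x * ((d i j f x)\<^sup>2 * ((1 - p) * (d a b \<rho> x / \<rho> x)
            + p * (d a b \<rho> (exchange i j x) / \<rho> (exchange i j x)))
          + 2 * d i j f x * (d a b f x - d a b f (exchange i j x))))"
proof -
  define N where "N = {1..n}"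
  define X where "X = slice n k"
  define t where "t i j a b x = w i j x * ((d i j f x)\<^sup>2 * ((1 - p) * (d a b \<rho> x / \<rho> x)
            + p * (d a b \<rho> (exchange i j x) / \<rho> (exchange i j x)))
          + 2 * d i j f x * (d a b f x - d a b f (exchange i j x)))" for i j a b x
  have fin: "finite N" "finite X" by (auto simp: N_def X_def finite_slice)
  have closed: "exchange i j x \<in> X" if "x \<in> X" "i \<in> N" "j \<in> N" for i j x
    using that exchange_slice unfolding X_def N_def by blast
  have reindex: "(\<Sum>x\<in>X. g (exchange i j x)) = (\<Sum>x\<in>X. g x)" if "i \<in> N" "j \<in> N" for i j and g :: "_ \<Rightarrow> real"
    by (rule sum.reindex_bij_witness[of _ "exchange i j" "exchange i j"]) (use that closed in auto)
  have pos: "0 < \<rho> x" if "x \<in> X" for x using that \<rho> by (simp add: X_def)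
  have w_nonneg: "0 \<le> w i j x" for i j x by (simp add: w_def)
  have tangent: "geometric_mean p u v \<le> w i j x * ((1 - p) * (u / \<rho> x) + p * (v / \<rho> (exchange i j x)))"
    if "x \<in> X" "i \<in> N" "j \<in> N" "0 < u" "0 < v" for i j x u v
    unfolding w_def using that pos closed p by (intro geometric_mean_tangent) auto
  have main: "2 * (real n + 2) * (\<Sum>x\<in>X. w i j x * (d i j f x)\<^sup>2) \<le> (\<Sum>x\<in>X. \<Sum>a\<in>N. \<Sum>b\<in>N. t i j a b x)"
    if ij: "i \<in> N" "j \<in> N" for i j
  proof (cases "i = j")
    case True
    then show ?thesis by (simp add: d_def t_def)
  next
    case False
    define R where "R = N - {i, j}"
    have R: "R \<subseteq> N" "finite R" "real (card R) = real n - 2"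
    proof -
      have "card R = n - 2" and "2 \<le> n"
        using ij False card_mono[of N "{i, j}"] fin by (auto simp: R_def N_def card_Diff_subset)
      then show "real (card R) = real n - 2" by simp
    qed (use fin in \<open>auto simp: R_def\<close>)
    have homogeneous: "w i j x * ((1 - p) * (u / \<rho> x - 1) + p * (v / \<rho> (exchange i j x) - 1))
        = w i j x * ((1 - p) * (u / \<rho> x) + p * (v / \<rho> (exchange i j x))) - w i j x" for u v x
      by (simp add: algebra_simps)
    \<comment> \<open>Crossing the edge changes the sign of \<open>d i j f\<close>, so the potential
      terms give \<open>4 * w * d\<^sup>2\<close>. The density terms are bounded below by a
      difference of weights that cancels in the sum over \<open>x\<close>.\<close>
    have self: "4 * (\<Sum>x\<in>X. w i j x * (d i j f x)\<^sup>2) \<le> (\<Sum>x\<in>X. t i j i j x)"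
    proof -
      have le: "(d i j f x)\<^sup>2 * (w i j (exchange i j x) - w i j x) + 4 * (w i j x * (d i j f x)\<^sup>2) \<le> t i j i j x"
        if x: "x \<in> X" for x
      proof -
        define y where "y = exchange i j x"
        have y: "y \<in> X" "exchange i j y = x" using closed x ij by (auto simp: y_def)
        have D: "d i j f y = - d i j f x" using y by (simp add: d_def y_def)
        have "w i j y \<le> w i j x * ((1 - p) * (\<rho> y / \<rho> x) + p * (\<rho> x / \<rho> y))"
          using tangent[OF x ij, of "\<rho> y" "\<rho> x"] pos x y by (simp add: w_def y_def)
        then have "w i j y - w i j x \<le> w i j x * ((1 - p) * (\<rho> y / \<rho> x - 1) + p * (\<rho> x / \<rho> y - 1))"
          using homogeneous[of x "\<rho> y" "\<rho> x"] by (simp add: y_def)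
        also have "\<dots> = w i j x * ((1 - p) * (d i j \<rho> x / \<rho> x) + p * (d i j \<rho> y / \<rho> y))"
          using pos[OF x] pos[OF y(1)] y by (simp add: d_def y_def[symmetric] diff_divide_distrib)
        finally have "(d i j f x)\<^sup>2 * (w i j y - w i j x)
            \<le> (d i j f x)\<^sup>2 * (w i j x * ((1 - p) * (d i j \<rho> x / \<rho> x) + p * (d i j \<rho> y / \<rho> y)))"
          by (intro mult_left_mono) auto
        then show ?thesis
          unfolding t_def y_def[symmetric] D by (simp add: algebra_simps power2_eq_square)
      qed
      have "(\<Sum>x\<in>X. (d i j f x)\<^sup>2 * (w i j (exchange i j x) - w i j x)) = 0"
      proof -
        have "(\<Sum>x\<in>X. (d i j f x)\<^sup>2 * w i j (exchange i j x)) = (\<Sum>x\<in>X. (d i j f (exchange i j x))\<^sup>2 * w i j x)"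
          using reindex[OF ij, of "\<lambda>x. (d i j f (exchange i j x))\<^sup>2 * w i j x"] by simp
        also have "\<dots> = (\<Sum>x\<in>X. (d i j f x)\<^sup>2 * w i j x)"
          by (simp add: d_def power2_commute)
        finally show ?thesis by (simp add: right_diff_distrib sum_subtractf)
      qed
      moreover have "(\<Sum>x\<in>X. (d i j f x)\<^sup>2 * (w i j (exchange i j x) - w i j x) + 4 * (w i j x * (d i j f x)\<^sup>2))
          \<le> (\<Sum>x\<in>X. t i j i j x)"
        by (rule sum_mono) (rule le)
      ultimately show ?thesis by (simp add: sum.distrib sum_distrib_left)
    qed
    \<comment> \<open>Up to the weight, the potential terms telescope through \<open>z\<close> to
      \<open>2 * d\<^sup>2\<close>, and the density terms lose at most \<open>d\<^sup>2\<close>,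
      because \<open>\<rho> z\<close> is positive and \<open>1 - p\<close> and \<open>p\<close> add
      up to 1.\<close>
    have triangle: "w i j x * (d i j f x)\<^sup>2 \<le> t i j i l x + t i j j l x" if x: "x \<in> X" and l: "l \<in> R" for x l
    proof (cases "x i = x j")
      case True
      then show ?thesis by (simp add: t_def d_def exchange_eq)
    next
      case ne: False
      have l': "l \<in> N" "l \<noteq> i" "l \<noteq> j" using l by (auto simp: R_def)
      define y where "y = exchange i j x"
      have y: "y \<in> X" using closed x ij by (auto simp: y_def)
      obtain z where z: "z = exchange i l x \<or> z = exchange j l x"
        "\<And>g :: (nat \<Rightarrow> int) \<Rightarrow> real. g (exchange i l x) + g (exchange j l x) = g z + g x"
        "\<And>g :: (nat \<Rightarrow> int) \<Rightarrow> real. g (exchange i l y) + g (exchange j l y) = g z + g y"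
        unfolding y_def
        by (rule exchange_triangle[of x i j l])
           (use slice_value[of x n k] x ij l' ne False in \<open>auto simp: X_def N_def\<close>)
      have "z \<in> X" using z(1) closed x ij l' by auto
      have sums: "d i l g x + d j l g x = g z - g x" "d i l g y + d j l g y = g z - g y" for g
        using z(2,3)[of g] by (simp_all add: d_def)
      have "t i j i l x + t i j j l x = w i j x * ((d i j f x)\<^sup>2 *
          ((1 - p) * ((d i l \<rho> x + d j l \<rho> x) / \<rho> x) + p * ((d i l \<rho> y + d j l \<rho> y) / \<rho> y))
          + 2 * d i j f x * ((d i l f x + d j l f x) - (d i l f y + d j l f y)))"
        unfolding t_def y_def[symmetric] by (simp add: algebra_simps add_divide_distrib)
      also have "\<dots> = w i j x * ((d i j f x)\<^sup>2 *
          ((1 - p) * ((\<rho> z - \<rho> x) / \<rho> x) + p * ((\<rho> z - \<rho> y) / \<rho> y)) + 2 * d i j f x * d i j f x)"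
        unfolding sums by (simp add: d_def y_def)
      also have "\<dots> = w i j x * (d i j f x)\<^sup>2 * ((1 - p) * (\<rho> z / \<rho> x) + p * (\<rho> z / \<rho> y) + 1)"
        using pos[OF x] pos[OF y] by (simp add: diff_divide_distrib power2_eq_square algebra_simps)
      also have "\<dots> \<ge> w i j x * (d i j f x)\<^sup>2 * 1"
        using p pos[OF x] pos[OF y] pos[OF \<open>z \<in> X\<close>]
        by (intro mult_left_mono mult_nonneg_nonneg w_nonneg) auto
      finally show ?thesis by simp
    qed
    \<comment> \<open>Disjoint exchanges commute, so the tangent inequality compares the edge with
      its parallel translate. After reindexing by the involution, the lower bound is a sum of
      weighted squares.\<close>
    have square: "0 \<le> (\<Sum>x\<in>X. t i j a b x)" if ab: "a \<in> R" "b \<in> R" for a b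
    proof -
      have abN: "a \<in> N" "b \<in> N" using ab by (auto simp: R_def)
      have le: "(d i j f x)\<^sup>2 * w i j (exchange a b x) + (d i j f x)\<^sup>2 * w i j x
          - 2 * w i j x * d i j f x * d i j f (exchange a b x) \<le> t i j a b x" if x: "x \<in> X" for x
      proof -
        define y where "y = exchange i j x"
        define z where "z = exchange a b x"
        have yz: "y \<in> X" "z \<in> X" "exchange i j z \<in> X" using closed x ij abN by (auto simp: y_def z_def)
        have comm: "exchange a b y = exchange i j z"
          using ab exchange_commute[of a i j b x] exchange_commute[of i a b j x]
          by (auto simp: y_def z_def R_def)
        have "w i j z \<le> w i j x * ((1 - p) * (\<rho> z / \<rho> x) + p * (\<rho> (exchange i j z) / \<rho> y))"
          using tangent[OF x ij, of "\<rho> z" "\<rho> (exchange i j z)"] pos yz by (simp add: w_def y_def)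
        then have "w i j z - w i j x \<le> w i j x * ((1 - p) * (\<rho> z / \<rho> x - 1) + p * (\<rho> (exchange i j z) / \<rho> y - 1))"
          using homogeneous[of x "\<rho> z" "\<rho> (exchange i j z)"] by (simp add: y_def)
        also have "\<dots> = w i j x * ((1 - p) * (d a b \<rho> x / \<rho> x) + p * (d a b \<rho> y / \<rho> y))"
          using pos[OF x] pos[OF yz(1)] comm by (simp add: d_def z_def[symmetric] diff_divide_distrib)
        finally have "(d i j f x)\<^sup>2 * (w i j z - w i j x)
            \<le> (d i j f x)\<^sup>2 * (w i j x * ((1 - p) * (d a b \<rho> x / \<rho> x) + p * (d a b \<rho> y / \<rho> y)))"
          by (intro mult_left_mono) auto
        note le = this
        have diff: "d a b f x - d a b f y = d i j f x - d i j f z"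
          using comm by (simp add: d_def y_def z_def)
        have "t i j a b x
            = (d i j f x)\<^sup>2 * (w i j x * ((1 - p) * (d a b \<rho> x / \<rho> x) + p * (d a b \<rho> y / \<rho> y)))
              + 2 * w i j x * d i j f x * (d i j f x - d i j f z)"
          unfolding t_def y_def[symmetric] diff by (simp add: algebra_simps)
        moreover have "(d i j f x)\<^sup>2 * w i j z + (d i j f x)\<^sup>2 * w i j x - 2 * w i j x * d i j f x * d i j f z
            = (d i j f x)\<^sup>2 * (w i j z - w i j x) + 2 * w i j x * d i j f x * (d i j f x - d i j f z)"
          by (simp add: algebra_simps power2_eq_square)
        ultimately show ?thesis unfolding z_def[symmetric] using le by linarith
      qed
      have "(\<Sum>x\<in>X. (d i j f x)\<^sup>2 * w i j (exchange a b x)) = (\<Sum>x\<in>X. (d i j f (exchange a b x))\<^sup>2 * w i j x)"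
        using reindex[OF abN, of "\<lambda>x. (d i j f (exchange a b x))\<^sup>2 * w i j x"] by simp
      then have "(\<Sum>x\<in>X. (d i j f x)\<^sup>2 * w i j (exchange a b x) + (d i j f x)\<^sup>2 * w i j x
            - 2 * w i j x * d i j f x * d i j f (exchange a b x))
          = (\<Sum>x\<in>X. w i j x * (d i j f (exchange a b x) - d i j f x)\<^sup>2)"
        by (simp add: sum.distrib sum_subtractf power2_diff algebra_simps)
      moreover have "0 \<le> (\<Sum>x\<in>X. w i j x * (d i j f (exchange a b x) - d i j f x)\<^sup>2)"
        by (intro sum_nonneg mult_nonneg_nonneg w_nonneg) auto
      moreover have "(\<Sum>x\<in>X. (d i j f x)\<^sup>2 * w i j (exchange a b x) + (d i j f x)\<^sup>2 * w i j x
            - 2 * w i j x * d i j f x * d i j f (exchange a b x)) \<le> (\<Sum>x\<in>X. t i j a b x)"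
        by (intro sum_mono le)
      ultimately show ?thesis by linarith
    qed
    have t_sym: "t i j a b x = t i j b a x" and t_diag: "t i j a a x = 0" for a b x
      using exchange_sym[of a b] by (simp_all add: t_def d_def)
    have "(\<Sum>x\<in>X. \<Sum>a\<in>N. \<Sum>b\<in>N. t i j a b x)
        = (\<Sum>x\<in>X. 2 * t i j i j x + 2 * (\<Sum>l\<in>R. t i j i l x + t i j j l x) + (\<Sum>a\<in>R. \<Sum>b\<in>R. t i j a b x))"
      unfolding R_def using fin ij False t_sym t_diag by (intro sum.cong refl sum_pairs_split) auto
    also have "\<dots> = 2 * (\<Sum>x\<in>X. t i j i j x) + 2 * (\<Sum>x\<in>X. \<Sum>l\<in>R. t i j i l x + t i j j l x)
        + (\<Sum>x\<in>X. \<Sum>a\<in>R. \<Sum>b\<in>R. t i j a b x)"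
      by (simp add: sum.distrib sum_distrib_left)
    also have "(\<Sum>x\<in>X. \<Sum>a\<in>R. \<Sum>b\<in>R. t i j a b x) = (\<Sum>a\<in>R. \<Sum>b\<in>R. \<Sum>x\<in>X. t i j a b x)"
      by (subst sum.swap) (simp add: sum.swap[of _ X])
    finally have eq: "(\<Sum>x\<in>X. \<Sum>a\<in>N. \<Sum>b\<in>N. t i j a b x)
        = 2 * (\<Sum>x\<in>X. t i j i j x) + 2 * (\<Sum>x\<in>X. \<Sum>l\<in>R. t i j i l x + t i j j l x)
        + (\<Sum>a\<in>R. \<Sum>b\<in>R. \<Sum>x\<in>X. t i j a b x)" .
    have "(\<Sum>x\<in>X. \<Sum>l\<in>R. w i j x * (d i j f x)\<^sup>2) \<le> (\<Sum>x\<in>X. \<Sum>l\<in>R. t i j i l x + t i j j l x)"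
      by (intro sum_mono triangle)
    then have "(real n - 2) * (\<Sum>x\<in>X. w i j x * (d i j f x)\<^sup>2) \<le> (\<Sum>x\<in>X. \<Sum>l\<in>R. t i j i l x + t i j j l x)"
      using R(3) by (simp add: sum_distrib_left)
    moreover have "0 \<le> (\<Sum>a\<in>R. \<Sum>b\<in>R. \<Sum>x\<in>X. t i j a b x)"
      by (intro sum_nonneg square)
    ultimately show ?thesis using self unfolding eq by (simp add: algebra_simps)
  qed
  have "2 * (real n + 2) * (\<Sum>x\<in>X. \<Sum>i\<in>N. \<Sum>j\<in>N. w i j x * (d i j f x)\<^sup>2)
      = (\<Sum>i\<in>N. \<Sum>j\<in>N. 2 * (real n + 2) * (\<Sum>x\<in>X. w i j x * (d i j f x)\<^sup>2))"
    by (subst sum.swap) (simp add: sum.swap[of _ X] sum_distrib_left)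
  also have "\<dots> \<le> (\<Sum>i\<in>N. \<Sum>j\<in>N. \<Sum>x\<in>X. \<Sum>a\<in>N. \<Sum>b\<in>N. t i j a b x)"
    by (intro sum_mono main)
  also have "\<dots> = (\<Sum>x\<in>X. \<Sum>i\<in>N. \<Sum>j\<in>N. \<Sum>a\<in>N. \<Sum>b\<in>N. t i j a b x)"
    by (subst (2) sum.swap) (simp add: sum.swap[of _ _ X])
  finally show ?thesis unfolding X_def N_def t_def .
qed

text \<open>With equal numbers of particles, as many sites are emptied as are filled; the distance
  is therefore even, and distance 2 means that one particle has moved.\<close>

lemma slice_difference_cards:
  assumes "x \<in> slice n k" "y \<in> slice n k"
  defines "A \<equiv> {l \<in> {1..n}. x l = 1 \<and> y l = 0}" and "B \<equiv> {l \<in> {1..n}. x l = 0 \<and> y l = 1}"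
  shows "card A = card B" "(\<Sum>l\<in>{1..n}. \<bar>x l - y l\<bar>) = 2 * int (card A)"
proof -
  have A: "int (card A) = (\<Sum>l\<in>{1..n}. of_bool (x l = 1 \<and> y l = 0))"
    and B: "int (card B) = (\<Sum>l\<in>{1..n}. of_bool (x l = 0 \<and> y l = 1))"
    unfolding A_def B_def by (simp_all add: Int_def of_bool_def sum.If_cases)
  note v = slice_value[OF assms(1)] slice_value[OF assms(2)]
  have "int (card A) - int (card B) = (\<Sum>l\<in>{1..n}. x l - y l)"
    unfolding A B sum_subtractf[symmetric] using v by (intro sum.cong refl) force
  also have "\<dots> = 0" using assms(1,2) by (simp add: slice_def sum_subtractf)
  finally show AB: "card A = card B" by simp
  have "(\<Sum>l\<in>{1..n}. \<bar>x l - y l\<bar>) = int (card A) + int (card B)"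
    unfolding A B sum.distrib[symmetric] using v by (intro sum.cong refl) force
  then show "(\<Sum>l\<in>{1..n}. \<bar>x l - y l\<bar>) = 2 * int (card A)" using AB by simp
qed

lemma exchange_distance:
  assumes "x \<in> slice n k" "i \<in> {1..n}" "j \<in> {1..n}" "x i = 1" "x j = 0"
  shows "(\<Sum>l\<in>{1..n}. \<bar>x l - exchange i j x l\<bar>) = 2"
proof -
  have "{l \<in> {1..n}. x l = 1 \<and> exchange i j x l = 0} = {i}"
    using assms by (auto simp: exchange_def)
  then show ?thesis using slice_difference_cards(2)[OF assms(1) exchange_slice[OF assms(1-3)]] by simp
qed

text \<open>A neighbour determines the site its particle left and the site it entered. This turns
  sums over neighbours into sums over pairs of an occupied and an empty site.\<close>

lemma bij_betw_exchange:
  assumes x: "x \<in> slice n k"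
  shows "bij_betw (\<lambda>(i, j). exchange i j x) ({i \<in> {1..n}. x i = 1} \<times> {j \<in> {1..n}. x j = 0})
    {y \<in> slice n k. (\<Sum>l\<in>{1..n}. \<bar>x l - y l\<bar>) = 2}"
  unfolding bij_betw_def
proof (intro conjI subset_antisym subsetI)
  show "inj_on (\<lambda>(i, j). exchange i j x) ({i \<in> {1..n}. x i = 1} \<times> {j \<in> {1..n}. x j = 0})"
  proof (rule inj_onI, clarify)
    fix i j i' j'
    assume *: "x i = 1" "x j = 0" "x i' = 1" "x j' = 0" "exchange i j x = exchange i' j' x"
    have "exchange i j x i = 0" "exchange i j x j = 1" using *(1-4) by (auto simp: exchange_def)
    then have "exchange i' j' x i = 0" "exchange i' j' x j = 1" using *(5) by auto
    then show "i = i' \<and> j = j'" using *(1-4) by (auto simp: exchange_def split: if_splits)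
  qed
next
  fix y assume "y \<in> (\<lambda>(i, j). exchange i j x) ` ({i \<in> {1..n}. x i = 1} \<times> {j \<in> {1..n}. x j = 0})"
  then show "y \<in> {y \<in> slice n k. (\<Sum>l\<in>{1..n}. \<bar>x l - y l\<bar>) = 2}"
    using exchange_slice[OF x] exchange_distance[OF x] by auto
next
  fix y assume "y \<in> {y \<in> slice n k. (\<Sum>l\<in>{1..n}. \<bar>x l - y l\<bar>) = 2}"
  then have y: "y \<in> slice n k" "(\<Sum>l\<in>{1..n}. \<bar>x l - y l\<bar>) = 2" by auto
  then have "card {l \<in> {1..n}. x l = 1 \<and> y l = 0} = 1" "card {l \<in> {1..n}. x l = 0 \<and> y l = 1} = 1"
    using slice_difference_cards[OF x y(1)] by auto
  then obtain i j where i: "{l \<in> {1..n}. x l = 1 \<and> y l = 0} = {i}" and j: "{l \<in> {1..n}. x l = 0 \<and> y l = 1} = {j}"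
    by (auto simp: card_1_singleton_iff)
  have ij: "i \<in> {1..n}" "x i = 1" "y i = 0" "j \<in> {1..n}" "x j = 0" "y j = 1" using i j by blast+
  have "y = exchange i j x"
  proof
    fix l
    show "y l = exchange i j x l"
    proof (cases "l \<in> {1..n}")
      case True
      have "x l = y l" if "l \<noteq> i" "l \<noteq> j"
      proof -
        have "l \<notin> {l \<in> {1..n}. x l = 1 \<and> y l = 0}" "l \<notin> {l \<in> {1..n}. x l = 0 \<and> y l = 1}"
          unfolding i j using that by simp_all
        then show ?thesis
          using True slice_value[OF x True] slice_value[OF y(1) True] by auto
      qed
      then show ?thesis using ij by (cases "l = i \<or> l = j") (auto simp: exchange_def)
    next
      case False
      then show ?thesis
        using x y(1) ij by (auto simp: exchange_def slice_def PiE_iff extensional_def)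
    qed
  qed
  then show "y \<in> (\<lambda>(i, j). exchange i j x) ` ({i \<in> {1..n}. x i = 1} \<times> {j \<in> {1..n}. x j = 0})"
    using ij by (intro image_eqI[of _ _ "(i, j)"]) auto
qed

text \<open>Every neighbour is counted twice on the right, as \<open>(i, j)\<close> and as \<open>(j, i)\<close>.\<close>

lemma sum_Q_BL:
  fixes g :: "(nat \<Rightarrow> int) \<Rightarrow> real"
  assumes x: "x \<in> slice n k" and g: "g x = 0"
  shows "(\<Sum>y\<in>slice n k. Q_BL n k x y * g y)
    = 1 / (real k * (real n - real k)) / 2 * (\<Sum>i\<in>{1..n}. \<Sum>j\<in>{1..n}. g (exchange i j x))"
proof -
  define c where "c = 1 / (real k * (real n - real k))"
  define s where "s = (\<Sum>i\<in>{i \<in> {1..n}. x i = 1}. \<Sum>j\<in>{j \<in> {1..n}. x j = 0}. g (exchange i j x))"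
  have "(\<Sum>y\<in>slice n k. Q_BL n k x y * g y)
      = (\<Sum>y\<in>{y \<in> slice n k. (\<Sum>l\<in>{1..n}. \<bar>x l - y l\<bar>) = 2}. c * g y)"
    using finite_slice by (intro sum.mono_neutral_cong_right) (auto simp: Q_BL_def c_def)
  also have "\<dots> = c * (\<Sum>y\<in>{y \<in> slice n k. (\<Sum>l\<in>{1..n}. \<bar>x l - y l\<bar>) = 2}. g y)"
    by (simp add: sum_distrib_left)
  also have "(\<Sum>y\<in>{y \<in> slice n k. (\<Sum>l\<in>{1..n}. \<bar>x l - y l\<bar>) = 2}. g y) = s"
    unfolding s_def sum.cartesian_product
    by (subst sum.reindex_bij_betw[OF bij_betw_exchange[OF x], symmetric]) (simp add: case_prod_beta)
  finally have lhs: "(\<Sum>y\<in>slice n k. Q_BL n k x y * g y) = c * s" .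
  \<comment> \<open>Pairs of sites with equal values fix \<open>x\<close> and contribute
    \<open>g x = 0\<close>; the others have exactly one occupied site, which is either
    \<open>i\<close> or \<open>j\<close>.\<close>
  have "(\<Sum>i\<in>{1..n}. \<Sum>j\<in>{1..n}. g (exchange i j x))
      = (\<Sum>i\<in>{1..n}. \<Sum>j\<in>{1..n}. (if x i = 1 then if x j = 0 then g (exchange i j x) else 0 else 0)
          + (if x j = 1 then if x i = 0 then g (exchange j i x) else 0 else 0))"
  proof (intro sum.cong refl)
    fix i j assume "i \<in> {1..n}" "j \<in> {1..n}"
    then show "g (exchange i j x) = (if x i = 1 then if x j = 0 then g (exchange i j x) else 0 else 0)
          + (if x j = 1 then if x i = 0 then g (exchange j i x) else 0 else 0)"
      using slice_value[OF x, of i] slice_value[OF x, of j] g exchange_eq[of x i j] exchange_sym[of i j x]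
      by auto
  qed
  also have "\<dots> = (\<Sum>i\<in>{1..n}. \<Sum>j\<in>{1..n}. if x i = 1 then if x j = 0 then g (exchange i j x) else 0 else 0)
      + (\<Sum>j\<in>{1..n}. \<Sum>i\<in>{1..n}. if x j = 1 then if x i = 0 then g (exchange j i x) else 0 else 0)"
    unfolding sum.distrib by (subst (2) sum.swap) simp
  also have "\<dots> = 2 * s"
  proof -
    have "(\<Sum>j\<in>{1..n}. if x i = 1 then if x j = 0 then g (exchange i j x) else 0 else 0)
        = (if x i = 1 then \<Sum>j\<in>{j \<in> {1..n}. x j = 0}. g (exchange i j x) else 0)" for i
      using sum.inter_filter[of "{1..n}" "\<lambda>j. g (exchange i j x)" "\<lambda>j. x j = 0"] by simp
    then have "(\<Sum>i\<in>{1..n}. \<Sum>j\<in>{1..n}. if x i = 1 then if x j = 0 then g (exchange i j x) else 0 else 0) = s"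
      unfolding s_def
      using sum.inter_filter[of "{1..n}" "\<lambda>i. \<Sum>j\<in>{j \<in> {1..n}. x j = 0}. g (exchange i j x)" "\<lambda>i. x i = 1"]
      by simp
    then show ?thesis by simp
  qed
  finally show ?thesis unfolding lhs c_def[symmetric] by simp
qed

text \<open>Induction on the number of occupied sites of \<open>x\<close> that are empty in
  \<open>y\<close>. Equally many sites remain to be filled, so a particle can be moved from one of
  the former to one of the latter.\<close>

lemma slice_connected:
  assumes n: "1 \<le> k" "k < n"
    and S: "S \<subseteq> slice n k" "S \<noteq> {}"
    and closed: "\<And>x y. x \<in> S \<Longrightarrow> y \<in> slice n k \<Longrightarrow> 0 < Q_BL n k x y \<Longrightarrow> y \<in> S"
  shows "S = slice n k"
proof (rule antisym[OF S(1)], rule subsetI)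
  fix y assume y: "y \<in> slice n k"
  have "x \<in> S \<Longrightarrow> y \<in> S" for x
  proof (induction "card {l \<in> {1..n}. x l = 1 \<and> y l = 0}" arbitrary: x rule: less_induct)
    case less
    have x: "x \<in> slice n k" using less.prems S(1) by blast
    note cards = slice_difference_cards(1)[OF x y]
    show ?case
    proof (cases "{l \<in> {1..n}. x l = 1 \<and> y l = 0} = {}")
      case True
      then have none: "{l \<in> {1..n}. x l = 0 \<and> y l = 1} = {}"
        using cards by (metis (no_types, lifting) card.empty card_0_eq finite_Collect_conjI finite_atLeastAtMost
            finite_subset mem_Collect_eq subsetI)
      have "x = y"
      proof
        fix l
        show "x l = y l"
        proof (cases "l \<in> {1..n}")
          case l: True
          have "l \<notin> {l \<in> {1..n}. x l = 1 \<and> y l = 0}" "l \<notin> {l \<in> {1..n}. x l = 0 \<and> y l = 1}"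
            unfolding True none by simp_all
          then show ?thesis
            using l slice_value[OF x l] slice_value[OF y l] by auto
        next
          case False
          then show ?thesis using x y by (auto simp: slice_def PiE_iff extensional_def)
        qed
      qed
      then show ?thesis using less.prems by simp
    next
      case False
      then obtain i where i: "i \<in> {1..n}" "x i = 1" "y i = 0" by blast
      have "card {l \<in> {1..n}. x l = 0 \<and> y l = 1} \<noteq> 0" using False cards[symmetric] by simp
      then have "{l \<in> {1..n}. x l = 0 \<and> y l = 1} \<noteq> {}" by (metis card.empty)
      then obtain j where j: "j \<in> {1..n}" "x j = 0" "y j = 1" by blast
      have "0 < Q_BL n k x (exchange i j x)"
        using exchange_distance[OF x i(1) j(1) i(2) j(2)] n by (simp add: Q_BL_def)
      then have "exchange i j x \<in> S"
        using closed less.prems exchange_slice[OF x i(1) j(1)] by blast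
      moreover have "{l \<in> {1..n}. exchange i j x l = 1 \<and> y l = 0} \<subset> {l \<in> {1..n}. x l = 1 \<and> y l = 0}"
        using i j by (auto simp: exchange_def)
      then have "card {l \<in> {1..n}. exchange i j x l = 1 \<and> y l = 0} < card {l \<in> {1..n}. x l = 1 \<and> y l = 0}"
        by (intro psubset_card_mono) auto
      ultimately show ?thesis using less.hyps by blast
    qed
  qed
  then show "y \<in> S" using S(2) by blast
qed

lemma bochner_markov_triple_BL:
  assumes k: "1 \<le> k" "k < n"
  shows "bochner_markov_triple (slice n k) (Q_BL n k) (pi_BL n k)
    ((real n + 2) / (2 * real k * (real n - real k)))"
proof -
  interpret markov_triple "slice n k" "Q_BL n k" "pi_BL n k"
    using k by (intro markov_triple_BL) simp
  define c where "c = 1 / (real k * (real n - real k))"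
  define \<kappa> where "\<kappa> = (real n + 2) / (2 * real k * (real n - real k))"
  have c: "0 < c" using k by (simp add: c_def)
  have \<kappa>: "\<kappa> = (real n + 2) * c / 2" by (simp add: \<kappa>_def c_def)
  define \<pi>0 where "\<pi>0 = 1 / real (n choose k)"
  have \<pi>0: "0 < \<pi>0" using k by (simp add: \<pi>0_def)
  show ?thesis
    unfolding \<kappa>_def[symmetric]
  proof unfold_locales
    show "0 < pi_BL n k x" if "x \<in> slice n k" for x using \<pi>0 by (simp add: pi_BL_def \<pi>0_def)
    show "S = slice n k" if "S \<subseteq> slice n k" "S \<noteq> {}"
      "\<And>x y. x \<in> S \<Longrightarrow> y \<in> slice n k \<Longrightarrow> 0 < Q_BL n k x y \<Longrightarrow> y \<in> S" for S
      by (rule slice_connected[OF k that(1,2)]) (rule that(3))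
    show "0 < \<kappa>" using k by (simp add: \<kappa>_def)
    fix p :: real and \<rho> f :: "(nat \<Rightarrow> int) \<Rightarrow> real"
    assume p: "0 \<le> p" "p \<le> 1" and \<rho>: "\<And>x. x \<in> slice n k \<Longrightarrow> 0 < \<rho> x"
    define d where "d i j g x = g (exchange i j x) - g x" for i j and g :: "(nat \<Rightarrow> int) \<Rightarrow> real" and x
    define w where "w i j x = geometric_mean p (\<rho> x) (\<rho> (exchange i j x))" for i j x
    define l where "l x y = geometric_mean p (\<rho> x) (\<rho> y) *
        ((f x - f y)\<^sup>2 * ((1 - p) * (laplacian \<rho> x / \<rho> x) + p * (laplacian \<rho> y / \<rho> y))
          - 2 * (f x - f y) * (laplacian f x - laplacian f y))" for x y
    have lap: "laplacian g x = c / 2 * (\<Sum>a\<in>{1..n}. \<Sum>b\<in>{1..n}. d a b g x)" if "x \<in> slice n k" for g x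
      unfolding laplacian_def d_def c_def
      using sum_Q_BL[OF that, of "\<lambda>y. g y - g x"] by simp
    have sum_BL: "(\<Sum>x\<in>slice n k. \<Sum>y\<in>slice n k. g x y * (pi_BL n k x * Q_BL n k x y))
        = \<pi>0 * (c / 2) * (\<Sum>x\<in>slice n k. \<Sum>i\<in>{1..n}. \<Sum>j\<in>{1..n}. g x (exchange i j x))"
      if "\<And>x. g x x = 0" for g
    proof -
      have "(\<Sum>y\<in>slice n k. g x y * (pi_BL n k x * Q_BL n k x y))
          = \<pi>0 * (c / 2) * (\<Sum>i\<in>{1..n}. \<Sum>j\<in>{1..n}. g x (exchange i j x))" if "x \<in> slice n k" for x
      proof -
        have "(\<Sum>y\<in>slice n k. g x y * (pi_BL n k x * Q_BL n k x y)) = \<pi>0 * (\<Sum>y\<in>slice n k. Q_BL n k x y * g x y)"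
          unfolding sum_distrib_left by (intro sum.cong refl) (simp add: pi_BL_def \<pi>0_def)
        also have "(\<Sum>y\<in>slice n k. Q_BL n k x y * g x y) = c / 2 * (\<Sum>i\<in>{1..n}. \<Sum>j\<in>{1..n}. g x (exchange i j x))"
          using sum_Q_BL[OF that, of "g x"] \<open>\<And>x. g x x = 0\<close> by (simp add: c_def)
        finally show ?thesis by simp
      qed
      then show ?thesis unfolding sum_distrib_left[of "\<pi>0 * (c / 2)" _ "slice n k"] by (intro sum.cong) auto
    qed
    have lhs: "2 * \<kappa> * dirichlet (\<lambda>x y. geometric_mean p (\<rho> x) (\<rho> y)) f f
        = \<kappa> * \<pi>0 * (c / 2) * (\<Sum>x\<in>slice n k. \<Sum>i\<in>{1..n}. \<Sum>j\<in>{1..n}. w i j x * (d i j f x)\<^sup>2)"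
    proof -
      have "(\<Sum>x\<in>slice n k. \<Sum>y\<in>slice n k. (f x - f y) * (f x - f y) * geometric_mean p (\<rho> x) (\<rho> y) * (pi_BL n k x * Q_BL n k x y))
          = \<pi>0 * (c / 2) * (\<Sum>x\<in>slice n k. \<Sum>i\<in>{1..n}. \<Sum>j\<in>{1..n}. (f x - f (exchange i j x)) * (f x - f (exchange i j x)) * w i j x)"
        unfolding w_def by (rule sum_BL) simp
      then show ?thesis
        unfolding dirichlet_def d_def by (simp add: power2_eq_square algebra_simps)
    qed
    have rhs: "(\<Sum>x\<in>slice n k. \<Sum>y\<in>slice n k. l x y * (pi_BL n k x * Q_BL n k x y))
        = \<pi>0 * (c / 2) * (c / 2) * (\<Sum>x\<in>slice n k. \<Sum>i\<in>{1..n}. \<Sum>j\<in>{1..n}. \<Sum>a\<in>{1..n}. \<Sum>b\<in>{1..n}.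
          w i j x * ((d i j f x)\<^sup>2 * ((1 - p) * (d a b \<rho> x / \<rho> x)
              + p * (d a b \<rho> (exchange i j x) / \<rho> (exchange i j x)))
            + 2 * d i j f x * (d a b f x - d a b f (exchange i j x))))"
    proof -
      have "l x (exchange i j x) = c / 2 * (\<Sum>a\<in>{1..n}. \<Sum>b\<in>{1..n}.
          w i j x * ((d i j f x)\<^sup>2 * ((1 - p) * (d a b \<rho> x / \<rho> x)
              + p * (d a b \<rho> (exchange i j x) / \<rho> (exchange i j x)))
            + 2 * d i j f x * (d a b f x - d a b f (exchange i j x))))"
        if x: "x \<in> slice n k" and ij: "i \<in> {1..n}" "j \<in> {1..n}" for x i j
      proof -
        define y where "y = exchange i j x"
        have y: "y \<in> slice n k" unfolding y_def by (rule exchange_slice[OF x ij])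
        have dy: "d i j f x = f y - f x" by (simp add: d_def y_def)
        have flip: "m * ((u - v)\<^sup>2 * K - 2 * (u - v) * M) = m * ((v - u)\<^sup>2 * K + 2 * (v - u) * M)"
          for m u v K M :: real
          by (simp add: power2_eq_square algebra_simps)
        let ?s = "\<lambda>g x. \<Sum>a\<in>{1..n}. \<Sum>b\<in>{1..n}. d a b g x"
        have "l x y = w i j x * ((d i j f x)\<^sup>2 * ((1 - p) * (c / 2 * ?s \<rho> x / \<rho> x) + p * (c / 2 * ?s \<rho> y / \<rho> y))
            + 2 * d i j f x * (c / 2 * ?s f x - c / 2 * ?s f y))"
          unfolding l_def lap[OF x] lap[OF y] dy w_def y_def[symmetric] by (rule flip)
        also have "\<dots> = c / 2 * (w i j x * (d i j f x)\<^sup>2 * ((1 - p) / \<rho> x) * ?s \<rho> x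
            + w i j x * (d i j f x)\<^sup>2 * (p / \<rho> y) * ?s \<rho> y
            + w i j x * 2 * d i j f x * ?s f x - w i j x * 2 * d i j f x * ?s f y)"
          by (simp add: algebra_simps diff_divide_distrib)
        also have "\<dots> = c / 2 * (\<Sum>a\<in>{1..n}. \<Sum>b\<in>{1..n}. w i j x * (d i j f x)\<^sup>2 * ((1 - p) / \<rho> x) * d a b \<rho> x
            + w i j x * (d i j f x)\<^sup>2 * (p / \<rho> y) * d a b \<rho> y
            + w i j x * 2 * d i j f x * d a b f x - w i j x * 2 * d i j f x * d a b f y)"
          by (simp only: sum.distrib sum_subtractf sum_distrib_left)
        also have "\<dots> = c / 2 * (\<Sum>a\<in>{1..n}. \<Sum>b\<in>{1..n}.
          w i j x * ((d i j f x)\<^sup>2 * ((1 - p) * (d a b \<rho> x / \<rho> x) + p * (d a b \<rho> y / \<rho> y))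
            + 2 * d i j f x * (d a b f x - d a b f y)))"
          by (intro arg_cong2[of _ _ _ _ "(*)"] sum.cong refl) (simp add: algebra_simps)
        finally show ?thesis unfolding y_def .
      qed
      then have "(\<Sum>x\<in>slice n k. \<Sum>i\<in>{1..n}. \<Sum>j\<in>{1..n}. l x (exchange i j x)) =
        c / 2 * (\<Sum>x\<in>slice n k. \<Sum>i\<in>{1..n}. \<Sum>j\<in>{1..n}. \<Sum>a\<in>{1..n}. \<Sum>b\<in>{1..n}.
          w i j x * ((d i j f x)\<^sup>2 * ((1 - p) * (d a b \<rho> x / \<rho> x)
              + p * (d a b \<rho> (exchange i j x) / \<rho> (exchange i j x)))
            + 2 * d i j f x * (d a b f x - d a b f (exchange i j x))))"
        by (simp add: sum_distrib_left)
      note sum_l = this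
      have "l x x = 0" for x by (simp add: l_def)
      from sum_BL[of l, OF this] show ?thesis unfolding sum_l by (simp only: mult.assoc)
    qed
    show "2 * \<kappa> * dirichlet (\<lambda>x y. geometric_mean p (\<rho> x) (\<rho> y)) f f
      \<le> 1 / 2 * (\<Sum>x\<in>slice n k. \<Sum>y\<in>slice n k. geometric_mean p (\<rho> x) (\<rho> y) *
          ((f x - f y)\<^sup>2 * ((1 - p) * (laplacian \<rho> x / \<rho> x) + p * (laplacian \<rho> y / \<rho> y))
            - 2 * (f x - f y) * (laplacian f x - laplacian f y)) * (pi_BL n k x * Q_BL n k x y))"
    proof -
      have "2 * (real n + 2) * (\<Sum>x\<in>slice n k. \<Sum>i\<in>{1..n}. \<Sum>j\<in>{1..n}. w i j x * (d i j f x)\<^sup>2)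
          \<le> (\<Sum>x\<in>slice n k. \<Sum>i\<in>{1..n}. \<Sum>j\<in>{1..n}. \<Sum>a\<in>{1..n}. \<Sum>b\<in>{1..n}.
          w i j x * ((d i j f x)\<^sup>2 * ((1 - p) * (d a b \<rho> x / \<rho> x)
              + p * (d a b \<rho> (exchange i j x) / \<rho> (exchange i j x)))
            + 2 * d i j f x * (d a b f x - d a b f (exchange i j x))))" (is "?A \<le> ?B")
        unfolding d_def w_def by (rule bernoulli_laplace_bochner[OF p \<rho>])
      \<comment> \<open>One factor \<open>c / 2\<close> comes from the sum over edges, another from
        the Laplacian, and \<open>1 / 2\<close> from the right-hand side of \<open>bochner\<close>;
        the value of \<kappa> turns the left-hand side into the same multiple of
        \<open>?A\<close>.\<close>
      then have "\<pi>0 * c\<^sup>2 / 8 * ?A \<le> \<pi>0 * c\<^sup>2 / 8 * ?B"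
        using \<pi>0 by (intro mult_left_mono) simp_all
      moreover have "\<kappa> * \<pi>0 * (c / 2) * a = \<pi>0 * c\<^sup>2 / 8 * (2 * (real n + 2) * a)" for a
        by (simp add: \<kappa> power2_eq_square field_simps)
      moreover have "1 / 2 * (\<pi>0 * (c / 2) * (c / 2) * b) = \<pi>0 * c\<^sup>2 / 8 * b" for b
        by (simp add: power2_eq_square)
      ultimately show ?thesis
        unfolding lhs l_def[symmetric] rhs by (simp only:)
    qed
  qed
qed

theorem theorem1p1:
  fixes n k :: nat
  assumes "n > 1" and "1 \<le> k" and "k \<le> n - 1"
  shows "Ric_bounded_below (slice n k) (Q_BL n k) (pi_BL n k)
           ((real n + 2) / (2 * real k * (real n - real k)))"
  using assms by (intro bochner_markov_triple.Ric_bounded_below_curvature bochner_markov_triple_BL) auto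

end
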